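(* Let $G$ be a countable simple graph. (A) The following statements are equivalent. (i) $G$ is rigid in $(\mathbb R^2,\|\cdot\|_2)$. (ii) $G$ contains a $(2,3)$-tight vertex-complete tower. (B) If $q\in(1,2)\cup(2,\infty)$ then the following statements are equivalent. (i) $G$ is rigid in $(\mathbb R^2,\|\cdot\|_q)$. (ii) $G$ contains a $(2,2)$-tight vertex-complete tower.
   Context: "Countable" means countably infinite; $\|\cdot\|_q$ is the $\ell^q$ norm on $\mathbb R^d$ (here $d=2$). Towers and sparsity: A tower in $G$ is a sequence of finite subgraphs $\{G_k:k\in\mathbb N\}$ of $G$ with $G_k$ a subgraph of $G_{k+1}$ for each $k$; it is vertex-complete if $V(G)=\bigcup_kV(G_k)$. A graph is $(k,l)$-sparse if $|E(H)|\le k|V(H)|-l$ for each subgraph $H$ with at least two vertices, and $(k,l)$-tight if it is $(k,l)$-sparse and $|E(G)|=k|V(G)|-l$. A $(k,l)$-tight tower is one in which each $G_k$ is $(k,l)$-tight. Rigidity: A bar-joint framework $(G,p)$ in a normed space $X$ consists of a simple graph $G$ and a map (placement) $p:V(G)\to X$ with $p_v\neq p_w$ whenever $vw\in E(G)$; $P(G)$ is the set of placements in $X$. A subframework is $(H,p)$ with $H$ a subgraph and $p$ restricted to $V(H)$. An infinitesimal flex is a map $u:V(G)\to X$ with $\|(p_v+tu_v)-(p_w+tu_w)\|-\|p_v-p_w\|=o(t)$ as $t\to 0$ for each edge $vw$. A continuous rigid motion is a map $\Gamma:X\times[-1,1]\to X$, isometric in $x$, continuous in $t$, with $\Gamma(x,0)=x$;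 an infinitesimal rigid motion is a map $\gamma(x)=\frac{d}{dt}\Gamma(x,t)|_{t=0}$ derived from such $\Gamma$. An infinitesimal flex $u$ is trivial if $u_v=\gamma(p_v)$ for all $v$, for some infinitesimal rigid motion $\gamma$. $(G,p)$ is infinitesimally rigid if all its infinitesimal flexes are trivial. For finite $G$ and $p:V(G)\to\mathbb R^d$ the rigidity matrix $R_q(G,p)$ is the $|E(G)|\times d|V(G)|$ matrix whose row for the edge $vw$ has $(p_v-p_w)^{(q-1)}$ in the $d$ columns of $v$, $-(p_v-p_w)^{(q-1)}$ in the $d$ columns of $w$ and zeros elsewhere, where $x^{(s)}=(\mathrm{sgn}(x_1)|x_1|^s,\dots,\mathrm{sgn}(x_d)|x_d|^s)$. A finite $(G,p)$ is regular if $x\mapsto \operatorname{rank}R_q(G,x)$, $x\in P(G)$, attains its maximum at $p$; it is generic if $p$ is a placement of the complete graph $K_{V(G)}$ on $V(G)$ and every subframework of $(K_{V(G)},p)$ is regular. A placement of a countable graph is generic if every finite subframework is generic. A countable graph is rigid in $(\mathbb R^d,\|\cdot\|_q)$ if its generic placements are infinitesimally rigid (independent of the choice of generic placement). *)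

theory Defs
  imports
    "HOL-Analysis.Analysis"
    "HOL-Library.Landau_Symbols"
    "HOL-Library.Function_Algebras"
begin

section \<open>Simple graphs, sparsity and towers\<close>

type_synonym 'a graph = "'a set \<times> 'a set set"

abbreviation verts :: "'a graph \<Rightarrow> 'a set" where "verts \<equiv> fst"
abbreviation edges :: "'a graph \<Rightarrow> 'a set set" where "edges \<equiv> snd"

definition simple_graph :: "'a graph \<Rightarrow> bool" where
  "simple_graph G \<longleftrightarrow> (\<forall>e\<in>edges G. e \<subseteq> verts G \<and> card e = 2)"

definition subgraph :: "'a graph \<Rightarrow> 'a graph \<Rightarrow> bool" where
  "subgraph H G \<longleftrightarrow> simple_graph H \<and> verts H \<subseteq> verts G \<and> edges H \<subseteq> edges G"

definition finite_subgraph :: "'a graph \<Rightarrow> 'a graph \<Rightarrow> bool" where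
  "finite_subgraph H G \<longleftrightarrow> subgraph H G \<and> finite (verts H)"

definition complete_graph :: "'a set \<Rightarrow> 'a graph" where
  "complete_graph V = (V, {e. e \<subseteq> V \<and> card e = 2})"

text \<open>The counts are compared in the integers, to avoid truncated subtraction.\<close>

definition sparse :: "nat \<Rightarrow> nat \<Rightarrow> 'a graph \<Rightarrow> bool" where
  "sparse k l G \<longleftrightarrow> (\<forall>H. finite_subgraph H G \<and> 2 \<le> card (verts H) \<longrightarrow>
      int (card (edges H)) \<le> int k * int (card (verts H)) - int l)"

definition tight :: "nat \<Rightarrow> nat \<Rightarrow> 'a graph \<Rightarrow> bool" where
  "tight k l G \<longleftrightarrow> finite (verts G) \<and> sparse k l G \<and>
      int (card (edges G)) = int k * int (card (verts G)) - int l"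

definition tower :: "'a graph \<Rightarrow> (nat \<Rightarrow> 'a graph) \<Rightarrow> bool" where
  "tower G T \<longleftrightarrow> (\<forall>k. finite_subgraph (T k) G \<and> subgraph (T k) (T (Suc k)))"

definition vertex_complete :: "'a graph \<Rightarrow> (nat \<Rightarrow> 'a graph) \<Rightarrow> bool" where
  "vertex_complete G T \<longleftrightarrow> verts G = (\<Union>k. verts (T k))"

definition tight_tower :: "nat \<Rightarrow> nat \<Rightarrow> 'a graph \<Rightarrow> (nat \<Rightarrow> 'a graph) \<Rightarrow> bool" where
  "tight_tower k l G T \<longleftrightarrow> tower G T \<and> (\<forall>n. tight k l (T n))"


section \<open>Bar-joint frameworks\<close>

definition lq_norm :: "real \<Rightarrow> real^'d \<Rightarrow> real" where
  "lq_norm q x = (\<Sum>i\<in>UNIV. \<bar>x $ i\<bar> powr q) powr (1 / q)"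

lemma lq_norm_2: "lq_norm 2 x = norm x"
  by (simp add: lq_norm_def norm_vec_def L2_set_def powr_half_sqrt sum_nonneg)

text \<open>
  Placements and flexes are total functions, but all notions below depend only on their
  values on the vertex set.
\<close>

definition placements :: "'a graph \<Rightarrow> ('a \<Rightarrow> real^'d) set" where
  "placements G = {p. \<forall>v w. {v, w} \<in> edges G \<longrightarrow> p v \<noteq> p w}"

definition infinitesimal_flex ::
  "real \<Rightarrow> 'a graph \<Rightarrow> ('a \<Rightarrow> real^'d) \<Rightarrow> ('a \<Rightarrow> real^'d) \<Rightarrow> bool" where
  "infinitesimal_flex q G p u \<longleftrightarrow> (\<forall>v w. {v, w} \<in> edges G \<longrightarrow>
      (\<lambda>t. lq_norm q ((p v + t *\<^sub>R u v) - (p w + t *\<^sub>R u w)) - lq_norm q (p v - p w))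
        \<in> o[at 0](\<lambda>t. t))"

text \<open>
  The standard topology of \<open>real^'d\<close> is used for continuity and differentiation in \<open>t\<close>;
  it agrees with the one induced by \<open>lq_norm q\<close> because all norms on \<open>real^'d\<close> are equivalent.
\<close>

definition continuous_rigid_motion :: "real \<Rightarrow> (real^'d \<Rightarrow> real \<Rightarrow> real^'d) \<Rightarrow> bool" where
  "continuous_rigid_motion q \<Gamma> \<longleftrightarrow>
     (\<forall>t\<in>{-1..1}. \<forall>x y. lq_norm q (\<Gamma> x t - \<Gamma> y t) = lq_norm q (x - y)) \<and>
     (\<forall>x. continuous_on {-1..1} (\<Gamma> x)) \<and>
     (\<forall>x. \<Gamma> x 0 = x)"

definition infinitesimal_rigid_motion :: "real \<Rightarrow> (real^'d \<Rightarrow> real^'d) \<Rightarrow> bool" where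
  "infinitesimal_rigid_motion q \<gamma> \<longleftrightarrow>
     (\<exists>\<Gamma>. continuous_rigid_motion q \<Gamma> \<and> (\<forall>x. (\<Gamma> x has_vector_derivative \<gamma> x) (at 0)))"

definition trivial_flex ::
  "real \<Rightarrow> 'a graph \<Rightarrow> ('a \<Rightarrow> real^'d) \<Rightarrow> ('a \<Rightarrow> real^'d) \<Rightarrow> bool" where
  "trivial_flex q G p u \<longleftrightarrow>
     (\<exists>\<gamma>. infinitesimal_rigid_motion q \<gamma> \<and> (\<forall>v\<in>verts G. u v = \<gamma> (p v)))"

definition infinitesimally_rigid :: "real \<Rightarrow> 'a graph \<Rightarrow> ('a \<Rightarrow> real^'d) \<Rightarrow> bool" where
  "infinitesimally_rigid q G p \<longleftrightarrow>
     (\<forall>u. infinitesimal_flex q G p u \<longrightarrow> trivial_flex q G p u)"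


section \<open>The rigidity matrix and generic placements\<close>

definition signed_power :: "real \<Rightarrow> real^'d \<Rightarrow> real^'d" where
  "signed_power s x = (\<chi> i. sgn (x $ i) * \<bar>x $ i\<bar> powr s)"

text \<open>
  The row of the rigidity matrix for the edge \<open>{v, w}\<close>. Columns are indexed by pairs of a vertex
  and a coordinate. Since the signed power is odd, interchanging \<open>v\<close> and \<open>w\<close> gives the same row.
\<close>

definition rigidity_row ::
  "real \<Rightarrow> ('a \<Rightarrow> real^'d) \<Rightarrow> 'a \<Rightarrow> 'a \<Rightarrow> 'a \<times> 'd \<Rightarrow> real" where
  "rigidity_row q p v w = (\<lambda>(x, i).
     if x = v then signed_power (q - 1) (p v - p w) $ i
     else if x = w then - (signed_power (q - 1) (p v - p w) $ i)
     else 0)"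

lemma signed_power_minus: "signed_power s (- x) = - signed_power s x"
  by (simp add: signed_power_def vec_eq_iff sgn_minus)

lemma rigidity_row_commute: "v \<noteq> w \<Longrightarrow> rigidity_row q p v w = rigidity_row q p w v"
  using signed_power_minus[of "q - 1" "p v - p w"]
  by (auto simp: rigidity_row_def fun_eq_iff)

text \<open>
  Row vectors with pointwise operations. The rank of the matrix is the dimension of its row
  space; all rows vanish in columns belonging to vertices outside the graph.
\<close>

global_interpretation row_space: vector_space "\<lambda>c (f :: 'c \<Rightarrow> real) x. c * f x"
  by unfold_locales (auto simp: fun_eq_iff algebra_simps)

definition rigidity_rank :: "real \<Rightarrow> 'a graph \<Rightarrow> ('a \<Rightarrow> real^'d) \<Rightarrow> nat" where
  "rigidity_rank q G p = row_space.dim {rigidity_row q p v w | v w. {v, w} \<in> edges G}"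

definition regular :: "real \<Rightarrow> 'a graph \<Rightarrow> ('a \<Rightarrow> real^'d) \<Rightarrow> bool" where
  "regular q G p \<longleftrightarrow> p \<in> placements G \<and>
     (\<forall>x \<in> placements G :: ('a \<Rightarrow> real^'d) set. rigidity_rank q G x \<le> rigidity_rank q G p)"

definition finite_generic :: "real \<Rightarrow> 'a graph \<Rightarrow> ('a \<Rightarrow> real^'d) \<Rightarrow> bool" where
  "finite_generic q G p \<longleftrightarrow> p \<in> placements (complete_graph (verts G)) \<and>
     (\<forall>H. subgraph H (complete_graph (verts G)) \<longrightarrow> regular q H p)"

definition generic :: "real \<Rightarrow> 'a graph \<Rightarrow> ('a \<Rightarrow> real^'d) \<Rightarrow> bool" where
  "generic q G p \<longleftrightarrow> p \<in> placements G \<and>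
     (\<forall>H. finite_subgraph H G \<longrightarrow> finite_generic q H p)"

text \<open>Rigidity in \<open>real^'d\<close> with the norm \<open>lq_norm q\<close>; the first argument only supplies \<open>'d\<close>.\<close>

definition rigid :: "'d::finite itself \<Rightarrow> real \<Rightarrow> 'a graph \<Rightarrow> bool" where
  "rigid TYPE('d) q G \<longleftrightarrow>
     (\<forall>p :: 'a \<Rightarrow> real^'d. generic q G p \<longrightarrow> infinitesimally_rigid q G p)"

end

theory Submission
  imports Defs "HOL-Complex_Analysis.Conformal_Mappings"
begin

text \<open>
  A generic placement makes the rows of exactly those finite edge sets independent that are
  \<open>(2, l)\<close>-sparse, where \<open>l = 3\<close> for \<open>q = 2\<close> and \<open>l = 2\<close> otherwise. Necessity is a dimension count.
  For sufficiency, vertices of degree at most three are removed by inverse Henneberg moves; for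
  \<open>l = 2\<close> this leads to multigraphs, in which a double edge ties its end points together. The
  converse moves preserve independence for a dense set of positions of the new vertex, because a
  certain determinant vanishes on no open box: for \<open>q = 2\<close> it is a polynomial, and for \<open>q \<noteq> 2\<close> its
  vanishing would contradict the linear independence of branches of \<open>(z - a) powr (q - 1)\<close> and
  their products, which is seen by analytic continuation. Baire's theorem then gives one placement
  at which all finite sparse edge sets are independent.

  A tight graph has only trivial flexes, so a vertex-complete tight tower gives rigidity. Conversely,
  if some pair of vertices lies in no tight subgraph, then adding it as a (possibly second) edge to
  any finite sparse set of edges keeps that set sparse. So its row is not in the span of the
  rows of the graph, and a linear functional separating it from this span is a flex that moves the
  two points relative to each other. Hence in a rigid graph every pair is in a tight
  subgraph, and these can be amalgamated to a tower.
\<close>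

section \<open>Signed powers\<close>

text \<open>For non-integer \<open>q\<close> the entries of the rigidity matrix are neither
  polynomial nor smooth, so generic cannot be replaced by algebraically independent; and
  \<open>rigid\<close> would hold vacuously if there were no generic placement. Hence the emphasis
  on \<open>solvable\<close>, surjectivity of the rows onto right-hand sides, which for a fixed
  finite multigraph is an open condition on the placement. The constants 3 and 2 are the dimensions
  of the space of infinitesimal rigid motions of the plane: two translations, plus one rotation in
  the Euclidean case. The rows on a vertex set \<open>S\<close> annihilate these motions and so span
  at most \<open>2 * card S - l\<close> dimensions. For \<open>q \<noteq> 2\<close> a rigid motion
  gives two points the same velocity in both coordinates, which is why a second constraint on a pair
  makes sense. Separating a row from the span of infinitely many rows is purely algebraic, while
  membership in that span involves finitely many rows only; this links an infinite graph to its
  finite subgraphs.\<close>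

definition spow :: "real \<Rightarrow> real \<Rightarrow> real" where
  "spow s x = sgn x * \<bar>x\<bar> powr s"

lemma spow_mult: "spow s (x * y) = spow s x * spow s y"
  by (simp add: spow_def sgn_mult abs_mult powr_mult)

lemma spow_eq_0_iff [simp]: "spow s x = 0 \<longleftrightarrow> x = 0"
  by (simp add: spow_def sgn_zero_iff)

lemma spow_0 [simp]: "spow s 0 = 0"
  by simp

lemma spow_1 [simp]: "spow s 1 = 1"
  by (simp add: spow_def)

lemma spow_one [simp]: "spow 1 x = x"
  by (simp add: spow_def sgn_mult_abs)

lemma spow_eq_iff:
  assumes "s > 0"
  shows "spow s x = spow s y \<longleftrightarrow> x = y"
proof
  assume eq: "spow s x = spow s y"
  have abs_spow: "\<bar>spow s z\<bar> = \<bar>z\<bar> powr s" and sgn_spow: "sgn (spow s z) = sgn z" for z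
    using assms by (auto simp: spow_def abs_mult abs_sgn_eq sgn_mult sgn_if)
  have "\<bar>x\<bar> powr s = \<bar>y\<bar> powr s" "sgn x = sgn y"
    using eq by (metis abs_spow, metis sgn_spow)
  then have "\<bar>x\<bar> = \<bar>y\<bar>"
    using assms by (metis abs_ge_zero powr_less_mono2 linorder_neq_iff)
  with \<open>sgn x = sgn y\<close> show "x = y"
    by (metis sgn_mult_abs)
qed simp

lemma has_real_derivative_spow:
  assumes "x \<noteq> 0"
  shows "(spow s has_real_derivative s * spow s x / x) (at x)"
proof (cases "x > 0")
  case True
  have "((\<lambda>y. y powr s) has_real_derivative s * x powr (s - 1)) (at x)"
    using True by (auto intro!: derivative_eq_intros simp: powr_diff)
  then have "(spow s has_real_derivative s * x powr (s - 1)) (at x)"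
    by (rule has_field_derivative_transform_within_open[where S = "{0<..}"])
       (use True in \<open>auto simp: spow_def\<close>)
  with True show ?thesis
    by (simp add: spow_def powr_diff)
next
  case False
  with assms have "x < 0" by simp
  have "((\<lambda>y. - ((- y) powr s)) has_real_derivative s * (- x) powr (s - 1)) (at x)"
    using \<open>x < 0\<close> by (auto intro!: derivative_eq_intros simp: powr_diff)
  then have "(spow s has_real_derivative s * (- x) powr (s - 1)) (at x)"
    by (rule has_field_derivative_transform_within_open[where S = "{..<0}"])
       (use \<open>x < 0\<close> in \<open>auto simp: spow_def\<close>)
  with \<open>x < 0\<close> show ?thesis
    by (simp add: spow_def powr_diff)
qed

lemma has_real_derivative_spow_over_power:
  assumes "z \<noteq> a"
  shows "((\<lambda>z. spow s (z - a) / (z - a) ^ k) has_real_derivative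
            (s - real k) * (spow s (z - a) / (z - a) ^ Suc k)) (at z)"
proof -
  have 1: "((\<lambda>z. spow s (z - a)) has_real_derivative (s * spow s (z - a) / (z - a)) * (1 - 0)) (at z)"
    by (rule DERIV_chain2[of "spow s"])
       (use assms in \<open>auto intro!: has_real_derivative_spow derivative_eq_intros\<close>)
  have 2: "((\<lambda>z. (z - a) ^ k) has_real_derivative real k * (z - a) ^ (k - 1)) (at z)"
    by (auto intro!: derivative_eq_intros)
  have "(s * r / w * (1 - 0) * w ^ k - r * (real k * w ^ (k - 1))) / (w ^ k * w ^ k) = (s - real k) * (r / w ^ Suc k)"
    if "w \<noteq> 0" for r w :: real
    using that by (cases k) (auto simp: field_simps)
  from this[of "z - a"] show ?thesis
    by (intro DERIV_cong[OF DERIV_divide[OF 1 2]]) (use assms in auto)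
qed

text \<open>Two differentiations of the relation multiply its terms by powers of
  \<open>1 / (z - a)\<close>, \<open>1 / (z - b)\<close>, \<open>1 / (z - c)\<close> and by the
  scalars \<open>s\<close> and \<open>s - 1\<close>; a Vandermonde system remains. For
  \<open>s = 1\<close> three affine functions would be dependent.\<close>

lemma spow_linear_independent:
  assumes s: "s > 0" "s \<noteq> 1" and lh: "l < h"
    and ne: "a \<noteq> b" "b \<noteq> c" "a \<noteq> c"
    and out: "a \<notin> {l<..<h}" "b \<notin> {l<..<h}" "c \<notin> {l<..<h}"
    and eq: "\<And>z. z \<in> {l<..<h} \<Longrightarrow> \<alpha> * spow s (z - a) + \<beta> * spow s (z - b) + \<gamma> * spow s (z - c) = 0"
  shows "\<alpha> = 0 \<and> \<beta> = 0 \<and> \<gamma> = 0"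
proof -
  define F where "F k z = \<alpha> * (spow s (z - a) / (z - a) ^ k) + \<beta> * (spow s (z - b) / (z - b) ^ k)
      + \<gamma> * (spow s (z - c) / (z - c) ^ k)" for k z
  have der: "(F k has_real_derivative (s - real k) * F (Suc k) z) (at z)" if "z \<in> {l<..<h}" for k z
  proof -
    have "z \<noteq> a" "z \<noteq> b" "z \<noteq> c" using that out by auto
    note d = has_real_derivative_spow_over_power[OF this(1)] has_real_derivative_spow_over_power[OF this(2)]
      has_real_derivative_spow_over_power[OF this(3)]
    have eq: "\<alpha> * (t * x) + \<beta> * (t * y) + \<gamma> * (t * w) = t * (\<alpha> * x + \<beta> * y + \<gamma> * w)" for t x y w
      by (simp add: algebra_simps)
    show ?thesis
      unfolding F_def eq[symmetric] by (intro DERIV_add DERIV_cmult d)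
  qed
  have step: "\<forall>z\<in>{l<..<h}. F (Suc k) z = 0" if "\<forall>z\<in>{l<..<h}. F k z = 0" "s \<noteq> real k" for k
  proof
    fix z assume z: "z \<in> {l<..<h}"
    have "((\<lambda>_. 0) has_real_derivative (s - real k) * F (Suc k) z) (at z)"
      by (rule has_field_derivative_transform_within_open[OF der[OF z], where S = "{l<..<h}"])
         (use z that(1) in auto)
    with DERIV_unique[OF this DERIV_const] that(2) show "F (Suc k) z = 0" by simp
  qed
  have 0: "\<forall>z\<in>{l<..<h}. F 0 z = 0" using eq by (simp add: F_def)
  have 1: "\<forall>z\<in>{l<..<h}. F 1 z = 0" using step[OF 0] s by simp
  have 2: "\<forall>z\<in>{l<..<h}. F 2 z = 0" using step[OF 1[simplified]] s by (simp add: numeral_2_eq_2)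
  define z where "z = (l + h) / 2"
  have z: "z \<in> {l<..<h}" using lh by (simp add: z_def)
  then have nz: "z - a \<noteq> 0" "z - b \<noteq> 0" "z - c \<noteq> 0" using out by auto
  define A B C where "A = 1 / (z - a)" and "B = 1 / (z - b)" and "C = 1 / (z - c)"
  define X Y Z where "X = \<alpha> * spow s (z - a)" and "Y = \<beta> * spow s (z - b)" and "Z = \<gamma> * spow s (z - c)"
  have d: "A \<noteq> B" "B \<noteq> C" "A \<noteq> C" using nz ne by (auto simp: A_def B_def C_def field_simps)
  have e0: "X + Y + Z = 0" using 0 z by (simp add: F_def X_def Y_def Z_def)
  have e1: "X * A + Y * B + Z * C = 0" using 1 z by (simp add: F_def X_def Y_def Z_def A_def B_def C_def)
  have e2: "X * A^2 + Y * B^2 + Z * C^2 = 0"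
    using 2 z by (simp add: F_def X_def Y_def Z_def A_def B_def C_def power_divide)
  \<comment> \<open>Elimination in the Vandermonde system: the polynomial
    \<open>(t - B) * (t - C)\<close> kills the other two terms.\<close>
  have "X * ((A - B) * (A - C)) = (X * A^2 + Y * B^2 + Z * C^2) - (B + C) * (X * A + Y * B + Z * C) + B * C * (X + Y + Z)"
    by algebra
  then have "X = 0" using e0 e1 e2 d by simp
  have "Y * ((B - A) * (B - C)) = (X * A^2 + Y * B^2 + Z * C^2) - (A + C) * (X * A + Y * B + Z * C) + A * C * (X + Y + Z)"
    by algebra
  then have "Y = 0" using e0 e1 e2 d by simp
  then have "Z = 0" using \<open>X = 0\<close> e0 by simp
  with \<open>X = 0\<close> \<open>Y = 0\<close> show ?thesis using nz by (auto simp: X_def Y_def Z_def)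
qed

section \<open>Analytic continuation of real powers\<close>

text \<open>A branch of \<open>(z - a) powr s\<close> that is holomorphic off the downward slit below \<open>a\<close>.\<close>

definition slit_pow :: "real \<Rightarrow> real \<Rightarrow> complex \<Rightarrow> complex" where
  "slit_pow s a z = exp (of_real s * Ln (- \<i> * (z - of_real a)))"

lemma slit_pow_of_real:
  assumes "x \<noteq> a"
  shows "slit_pow s a (of_real x) = of_real (\<bar>x - a\<bar> powr s) * exp (of_real (- s * pi / 2 * sgn (x - a)) * \<i>)"
proof -
  have "Ln (- \<i> * (of_real x - of_real a)) = of_real (ln \<bar>x - a\<bar>) - of_real (pi / 2 * sgn (x - a)) * \<i>"
  proof (cases "x > a")
    case True
    have eq: "- \<i> * (of_real x - of_real a) = of_real (x - a) * (- \<i>)" by simp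
    show ?thesis
      unfolding eq using True by (subst Ln_times_of_real) (auto simp del: of_real_diff simp: Ln_of_real)
  next
    case False
    have eq: "- \<i> * (of_real x - of_real a) = of_real (a - x) * \<i>" by (simp add: algebra_simps)
    show ?thesis
      unfolding eq using False assms by (subst Ln_times_of_real) (auto simp del: of_real_diff simp: Ln_of_real)
  qed
  then have "slit_pow s a (of_real x) = exp (of_real s * (of_real (ln \<bar>x - a\<bar>) - of_real (pi / 2 * sgn (x - a)) * \<i>))"
    by (simp only: slit_pow_def)
  also have "of_real s * (of_real (ln \<bar>x - a\<bar>) - of_real (pi / 2 * sgn (x - a)) * \<i>)
      = complex_of_real (s * ln \<bar>x - a\<bar>) + of_real (- s * pi / 2 * sgn (x - a)) * \<i>"
    by (simp add: algebra_simps)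
  finally show ?thesis
    using assms by (simp only: exp_add exp_of_real powr_def) simp
qed

lemma norm_slit_pow_of_real:
  "x \<noteq> a \<Longrightarrow> norm (slit_pow s a (of_real x)) = \<bar>x - a\<bar> powr s"
  by (simp add: slit_pow_of_real norm_mult norm_exp_eq_Re)

text \<open>The interval lies on one side of \<open>a\<close>, so the sign of \<open>x - a\<close>
  and the phase of the branch are constant on it and combine to one unimodular factor. Its modulus
  enters the later growth estimate.\<close>

lemma spow_eq_slit_pow:
  assumes "a \<notin> {l<..<h}"
  obtains \<kappa> where "norm \<kappa> = 1"
    "\<And>x. x \<in> {l<..<h} \<Longrightarrow> complex_of_real (spow s (x - a)) = \<kappa> * slit_pow s a (of_real x)"
proof -
  define t :: real where "t = (if a \<le> l then 1 else -1)"
  define \<kappa> where "\<kappa> = of_real t * exp (of_real (s * pi / 2 * t) * \<i>)"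
  show thesis
  proof (rule that[of \<kappa>])
    show "norm \<kappa> = 1" by (simp add: \<kappa>_def t_def norm_mult norm_exp_eq_Re)
    fix x assume "x \<in> {l<..<h}"
    then have x: "x \<noteq> a" "sgn (x - a) = t" using assms by (auto simp: t_def)
    have "\<kappa> * slit_pow s a (of_real x) = of_real t * of_real (\<bar>x - a\<bar> powr s)
        * (exp (of_real (s * pi / 2 * t) * \<i>) * exp (of_real (- s * pi / 2 * t) * \<i>))"
      by (simp add: \<kappa>_def slit_pow_of_real[OF x(1)] x(2))
    also have "exp (of_real (s * pi / 2 * t) * \<i>) * exp (of_real (- s * pi / 2 * t) * \<i>) = 1"
      by (simp flip: exp_add)
    finally show "complex_of_real (spow s (x - a)) = \<kappa> * slit_pow s a (of_real x)"
      by (simp add: spow_def x(2))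
  qed
qed

text \<open>The region connects the interval, above the branch points, with the far right of the real axis.\<close>

definition slit_domain :: "real \<Rightarrow> real \<Rightarrow> real \<Rightarrow> complex set" where
  "slit_domain l h M = {z. Im z > 0} \<union> {z. l < Re z \<and> Re z < h} \<union> {z. Re z > M}"

text \<open>The slit lies on the vertical line through \<open>a\<close>, in the closed lower
  half-plane; the hypotheses on \<open>a\<close> keep that line out of the strip and of the right
  half-plane.\<close>

lemma slit_pow_holomorphic:
  assumes "a \<notin> {l<..<h}" "a \<le> M"
  shows "slit_pow s a holomorphic_on slit_domain l h M"
proof -
  have "- \<i> * (z - of_real a) \<notin> \<real>\<^sub>\<le>\<^sub>0" if "z \<in> slit_domain l h M" for z
    using that assms by (auto simp: slit_domain_def complex_nonpos_Reals_iff)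
  then show ?thesis
    unfolding slit_pow_def by (intro holomorphic_intros) auto
qed

lemma open_slit_domain: "open (slit_domain l h M)"
  unfolding slit_domain_def
  by (intro open_Un open_Collect_conj open_Collect_less continuous_intros)

lemma connected_slit_domain:
  assumes "l < h"
  shows "connected (slit_domain l h M)"
proof -
  have strip: "{z. l < Re z \<and> Re z < h} = {z. Re z > l} \<inter> {z. Re z < h}" by auto
  have "Complex ((l + h) / 2) 1 \<in> {z. Im z > 0} \<inter> {z. l < Re z \<and> Re z < h}"
    using assms by auto
  moreover have "Complex (M + 1) 1 \<in> ({z. Im z > 0} \<union> {z. l < Re z \<and> Re z < h}) \<inter> {z. Re z > M}"
    by auto
  ultimately show ?thesis
    unfolding slit_domain_def strip
    by (intro connected_Un convex_connected convex_Int convex_halfspace_Im_gt convex_halfspace_Re_gt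
        convex_halfspace_Re_lt) blast+
qed

text \<open>After analytic continuation around the branch points, the left hand side of the equation
  would grow like \<open>z powr (2 * s)\<close> and the right hand side at most like \<open>z powr s\<close>.\<close>

lemma spow_product_not_in_span:
  assumes s: "s > 0" and lh: "l < h"
    and out: "a \<notin> {l<..<h}" "b \<notin> {l<..<h}" "c \<notin> {l<..<h}"
    and eq: "\<And>z. z \<in> {l<..<h} \<Longrightarrow> spow s (z - b) * spow s (z - c) =
       \<alpha> * spow s (z - a) + \<beta> * spow s (z - b) + \<gamma> * spow s (z - c)"
  shows False
proof -
  obtain ka where ka: "norm ka = 1"
    "\<And>x. x \<in> {l<..<h} \<Longrightarrow> complex_of_real (spow s (x - a)) = ka * slit_pow s a (of_real x)"
    using spow_eq_slit_pow[OF out(1)] by metis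
  obtain kb where kb: "norm kb = 1"
    "\<And>x. x \<in> {l<..<h} \<Longrightarrow> complex_of_real (spow s (x - b)) = kb * slit_pow s b (of_real x)"
    using spow_eq_slit_pow[OF out(2)] by metis
  obtain kc where kc: "norm kc = 1"
    "\<And>x. x \<in> {l<..<h} \<Longrightarrow> complex_of_real (spow s (x - c)) = kc * slit_pow s c (of_real x)"
    using spow_eq_slit_pow[OF out(3)] by metis
  define M n where "M = max a (max b c)" and "n = min a (min b c)"
  define f where "f z = (kb * slit_pow s b z) * (kc * slit_pow s c z)
     - (of_real \<alpha> * (ka * slit_pow s a z) + of_real \<beta> * (kb * slit_pow s b z)
        + of_real \<gamma> * (kc * slit_pow s c z))" for z
  have hol: "f holomorphic_on slit_domain l h M"
    unfolding f_def by (intro holomorphic_intros slit_pow_holomorphic out) (auto simp: M_def)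
  have sub: "of_real ` {l<..<h} \<subseteq> slit_domain l h M"
    by (auto simp: slit_domain_def)
  have f0: "f z = 0" if "z \<in> of_real ` {l<..<h}" for z
  proof -
    from that obtain x where x: "x \<in> {l<..<h}" "z = of_real x" by auto
    show ?thesis
      unfolding f_def x(2) ka(2)[OF x(1), symmetric] kb(2)[OF x(1), symmetric] kc(2)[OF x(1), symmetric]
      using arg_cong[OF eq[OF x(1)], of complex_of_real] by simp
  qed
  define m where "m = (l + h) / 2"
  have m: "m \<in> {l<..<h}" using lh by (simp add: m_def)
  have "m islimpt {l<..<h}"
    using m by (intro open_imp_islimpt) auto
  have lim: "complex_of_real m islimpt of_real ` {l<..<h}"
    unfolding islimpt_approachable
  proof (intro allI impI)
    fix e :: real assume "e > 0"
    with \<open>m islimpt {l<..<h}\<close> obtain x where "x \<in> {l<..<h}" "x \<noteq> m" "dist x m < e"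
      unfolding islimpt_approachable by blast
    then show "\<exists>x'\<in>complex_of_real ` {l<..<h}. x' \<noteq> of_real m \<and> dist x' (of_real m) < e"
      by (intro bexI[of _ "of_real x"]) auto
  qed
  have fz: "f z = 0" if "z \<in> slit_domain l h M" for z
    by (rule analytic_continuation[OF hol open_slit_domain connected_slit_domain[OF lh] sub _ lim f0 that])
       (use m sub in auto)
  define K where "K = \<bar>\<alpha>\<bar> + \<bar>\<beta>\<bar> + \<bar>\<gamma>\<bar>"
  have bound: "(x - M) powr s * (x - M) powr s \<le> K * (x - n) powr s" if x: "x > M" for x
  proof -
    have xs: "x > a" "x > b" "x > c" using x by (auto simp: M_def)
    have "f (of_real x) = 0"
      by (rule fz) (use x in \<open>simp add: slit_domain_def\<close>)
    then have "norm ((kb * slit_pow s b (of_real x)) * (kc * slit_pow s c (of_real x)))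
      = norm (of_real \<alpha> * (ka * slit_pow s a (of_real x)) + of_real \<beta> * (kb * slit_pow s b (of_real x))
        + of_real \<gamma> * (kc * slit_pow s c (of_real x)))"
      by (simp add: f_def)
    also have "\<dots> \<le> norm (of_real \<alpha> * (ka * slit_pow s a (of_real x))) + norm (of_real \<beta> * (kb * slit_pow s b (of_real x)))
        + norm (of_real \<gamma> * (kc * slit_pow s c (of_real x)))"
      by (intro norm_triangle_le add_mono order_refl norm_triangle_ineq)
    finally have 1: "(x - b) powr s * (x - c) powr s \<le>
        \<bar>\<alpha>\<bar> * (x - a) powr s + \<bar>\<beta>\<bar> * (x - b) powr s + \<bar>\<gamma>\<bar> * (x - c) powr s"
      using xs ka(1) kb(1) kc(1) by (simp add: norm_mult norm_slit_pow_of_real)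
    have "(x - M) powr s * (x - M) powr s \<le> (x - b) powr s * (x - c) powr s"
      using x s by (intro mult_mono powr_mono2) (auto simp: M_def)
    also note 1
    also have "\<bar>\<alpha>\<bar> * (x - a) powr s + \<bar>\<beta>\<bar> * (x - b) powr s + \<bar>\<gamma>\<bar> * (x - c) powr s \<le>
        \<bar>\<alpha>\<bar> * (x - n) powr s + \<bar>\<beta>\<bar> * (x - n) powr s + \<bar>\<gamma>\<bar> * (x - n) powr s"
      using xs s by (intro add_mono mult_left_mono powr_mono2) (auto simp: n_def)
    finally show ?thesis by (simp add: K_def algebra_simps)
  qed
  \<comment> \<open>Large enough for \<open>y powr s\<close> to exceed \<open>K * 2 powr s\<close>
    and for \<open>M - n \<le> y\<close>, so that at \<open>x = y + M\<close> the base
    \<open>x - n\<close> is at most \<open>2 * y\<close>.\<close>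
  define y where "y = (K * 2 powr s + 1) powr (1 / s) + (M - n)"
  have Kp: "K * 2 powr s + 1 > 0" by (simp add: K_def add_nonneg_pos)
  have Mn: "M - n \<ge> 0" by (auto simp: M_def n_def)
  have yp: "y > 0" unfolding y_def using Kp Mn
    by (metis add_pos_nonneg powr_gt_zero less_numeral_extra(3))
  have ys: "y powr s \<ge> K * 2 powr s + 1"
  proof -
    have "K * 2 powr s + 1 = ((K * 2 powr s + 1) powr (1 / s)) powr s"
      using Kp s by (simp add: powr_powr)
    also have "\<dots> \<le> y powr s"
      using s Mn by (intro powr_mono2) (auto simp: y_def)
    finally show ?thesis .
  qed
  have "y powr s * y powr s \<le> K * (y + (M - n)) powr s"
    using bound[of "y + M"] yp by (simp add: algebra_simps)
  also have "\<dots> \<le> K * (2 * y) powr s"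
  proof -
    have "M - n \<le> y" by (simp add: y_def)
    then show ?thesis
      using s Mn yp by (intro mult_left_mono powr_mono2) (auto simp: K_def)
  qed
  also have "\<dots> = (K * 2 powr s) * y powr s"
    using yp by (simp add: powr_mult)
  finally have "y powr s \<le> K * 2 powr s" using yp by simp
  with ys show False by simp
qed

text \<open>The expanded determinant of three points: each monomial has one factor from every point,
  two in one coordinate and one in the other. The six coefficients will be differences of velocity
  components.\<close>

definition tensor_form where
  "tensor_form s a b c da db dc ea eb ec x y =
     da * (spow s (x - b$1) * spow s (x - c$1) * spow s (y - a$2))
   + db * (spow s (x - c$1) * spow s (x - a$1) * spow s (y - b$2))
   + dc * (spow s (x - a$1) * spow s (x - b$1) * spow s (y - c$2))
   + ea * (spow s (y - b$2) * spow s (y - c$2) * spow s (x - a$1))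
   + eb * (spow s (y - c$2) * spow s (y - a$2) * spow s (x - b$1))
   + ec * (spow s (y - a$2) * spow s (y - b$2) * spow s (x - (c :: real^2)$1))"

text \<open>The vectors \<open>(Y\<^sub>a, Y\<^sub>b, Y\<^sub>c)\<close> span the three-dimensional space by linear independence, so each
  product of two \<open>X\<close>'s whose coefficient does not vanish is in the span of the \<open>X\<close>'s.\<close>

lemma tensor_form_coeffs_zero:
  fixes a b c :: "real^2"
  assumes s: "s > 0" "s \<noteq> 1" and lh: "l1 < h1" "l2 < h2"
    and ne: "a $ 2 \<noteq> b $ 2" "b $ 2 \<noteq> c $ 2" "a $ 2 \<noteq> c $ 2"
    and out1: "a $ 1 \<notin> {l1<..<h1}" "b $ 1 \<notin> {l1<..<h1}" "c $ 1 \<notin> {l1<..<h1}"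
    and out2: "a $ 2 \<notin> {l2<..<h2}" "b $ 2 \<notin> {l2<..<h2}" "c $ 2 \<notin> {l2<..<h2}"
    and eq: "\<And>x y. x \<in> {l1<..<h1} \<Longrightarrow> y \<in> {l2<..<h2} \<Longrightarrow> tensor_form s a b c da db dc ea eb ec x y = 0"
  shows "da = 0 \<and> db = 0 \<and> dc = 0"
proof -
  define X where "X p x = spow s (x - p$1)" for p :: "real^2" and x
  define Y where "Y p y = spow s (y - p$2)" for p :: "real^2" and y
  define P where "P v x = fst v * da * (X b x * X c x) + fst (snd v) * db * (X c x * X a x)
      + snd (snd v) * dc * (X a x * X b x)" for v :: "real \<times> real \<times> real" and x
  define T where "T = {v. \<exists>\<alpha> \<beta> \<gamma>. \<forall>x\<in>{l1<..<h1}. P v x = \<alpha> * X a x + \<beta> * X b x + \<gamma> * X c x}"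
  have sub: "subspace T"
  proof (rule subspaceI)
    show "0 \<in> T" unfolding T_def P_def by (auto intro!: exI[of _ 0])
    show "v + w \<in> T" if "v \<in> T" "w \<in> T" for v w
    proof -
      from that(1) obtain \<alpha> \<beta> \<gamma> where 1: "\<forall>x\<in>{l1<..<h1}. P v x = \<alpha> * X a x + \<beta> * X b x + \<gamma> * X c x"
        unfolding T_def by blast
      from that(2) obtain \<alpha>' \<beta>' \<gamma>' where 2: "\<forall>x\<in>{l1<..<h1}. P w x = \<alpha>' * X a x + \<beta>' * X b x + \<gamma>' * X c x"
        unfolding T_def by blast
      have "P (v + w) x = P v x + P w x" for x
        unfolding P_def fst_add snd_add by algebra
      then have "P (v + w) x = (\<alpha> + \<alpha>') * X a x + (\<beta> + \<beta>') * X b x + (\<gamma> + \<gamma>') * X c x"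
        if "x \<in> {l1<..<h1}" for x
        using 1 2 that by (simp add: algebra_simps)
      then show ?thesis unfolding T_def by blast
    qed
    show "r *\<^sub>R v \<in> T" if "v \<in> T" for r v
    proof -
      from that(1) obtain \<alpha> \<beta> \<gamma> where 1: "\<forall>x\<in>{l1<..<h1}. P v x = \<alpha> * X a x + \<beta> * X b x + \<gamma> * X c x"
        unfolding T_def by blast
      have "P (r *\<^sub>R v) x = r * P v x" for x
        by (simp add: P_def distrib_left mult.assoc)
      then have "P (r *\<^sub>R v) x = (r * \<alpha>) * X a x + (r * \<beta>) * X b x + (r * \<gamma>) * X c x" if "x \<in> {l1<..<h1}" for x
        using 1 that by (simp add: algebra_simps)
      then show ?thesis unfolding T_def by blast
    qed
  qed
  have inT: "(Y a y, Y b y, Y c y) \<in> T" if y: "y \<in> {l2<..<h2}" for y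
    unfolding T_def
  proof (intro CollectI exI ballI)
    fix x assume x: "x \<in> {l1<..<h1}"
    show "P (Y a y, Y b y, Y c y) x
      = (- ea * (Y b y * Y c y)) * X a x + (- eb * (Y c y * Y a y)) * X b x + (- ec * (Y a y * Y b y)) * X c x"
      using eq[OF x y] by (simp add: P_def tensor_form_def X_def Y_def algebra_simps)
  qed
  have "span T = UNIV"
  proof (rule ccontr)
    assume "span T \<noteq> UNIV"
    then obtain n where n: "n \<noteq> 0" "\<forall>v\<in>span T. n \<bullet> v = 0"
      using span_not_UNIV_orthogonal by blast
    have "fst n * spow s (y - a$2) + fst (snd n) * spow s (y - b$2) + snd (snd n) * spow s (y - c$2) = 0"
      if "y \<in> {l2<..<h2}" for y
      using n(2) span_base[OF inT[OF that]] by (fastforce simp: Y_def inner_prod_def)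
    then have "fst n = 0 \<and> fst (snd n) = 0 \<and> snd (snd n) = 0"
      using spow_linear_independent[OF s lh(2) ne out2] by blast
    with n(1) show False by (simp add: prod_eq_iff)
  qed
  then have UT: "T = UNIV"
    using sub span_eq_iff by blast
  have comb: "\<exists>\<alpha> \<beta> \<gamma>. \<forall>x\<in>{l1<..<h1}. P v x = \<alpha> * X a x + \<beta> * X b x + \<gamma> * X c x" for v
    using UT unfolding T_def by blast
  \<comment> \<open>The reciprocal scales the surviving product to coefficient one; permuting the
    points covers the other two coefficients.\<close>
  have "da = 0"
    using comb[of "(1 / da, 0, 0)"] spow_product_not_in_span[OF s(1) lh(1) out1]
    unfolding P_def X_def by (cases "da = 0") (simp, fastforce)
  moreover have "db = 0"
    using comb[of "(0, 1 / db, 0)"] spow_product_not_in_span[OF s(1) lh(1) out1(2,3,1)]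
    unfolding P_def X_def by (cases "db = 0") (simp, fastforce simp: add_ac)
  moreover have "dc = 0"
    using comb[of "(0, 0, 1 / dc)"] spow_product_not_in_span[OF s(1) lh(1) out1(3,1,2)]
    unfolding P_def X_def by (cases "dc = 0") (simp, fastforce simp: add_ac)
  ultimately show ?thesis by blast
qed

section \<open>The determinant in the Euclidean case\<close>

lemma quadratic_zero_on_interval:
  fixes A B C :: real
  assumes lh: "l < h" and eq: "\<And>x. x \<in> {l<..<h} \<Longrightarrow> A * x^2 + B * x + C = 0"
  shows "A = 0 \<and> B = 0 \<and> C = 0"
proof -
  define m d where "m = (l + h) / 2" and "d = (h - l) / 4"
  have d: "d > 0" using lh by (simp add: d_def)
  have in_int: "m \<in> {l<..<h}" "m + d \<in> {l<..<h}" "m - d \<in> {l<..<h}"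
    using lh by (auto simp: m_def d_def field_simps)
  note e = eq[OF in_int(1)] eq[OF in_int(2)] eq[OF in_int(3)]
  \<comment> \<open>The second difference at three equally spaced points isolates the leading
    coefficient.\<close>
  have "2 * A * d^2 = (A * (m + d)^2 + B * (m + d) + C) + (A * (m - d)^2 + B * (m - d) + C) - 2 * (A * m^2 + B * m + C)"
    by algebra
  with e d have A: "A = 0" by simp
  have "B * d = (B * (m + d) + C) - (B * m + C)" by algebra
  with e d A have B: "B = 0" by simp
  with e A show ?thesis by simp
qed

text \<open>The hypotheses force the velocities \<open>u\<close>, \<open>v\<close> of the points \<open>a\<close>, \<open>b\<close> to be those of a
  rotation about the third neighbour, which is taken as the origin.\<close>

lemma rotation_if_coeffs_zero:
  fixes a1 a2 b1 b2 u1 u2 v1 v2 :: real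
  assumes nz: "a1 \<noteq> 0" "a2 \<noteq> 0" "b1 \<noteq> 0" "b2 \<noteq> 0" "a1 \<noteq> b1" "a2 \<noteq> b2"
    and x2: "u1 * b2 = v1 * a2" and y2: "v2 * a1 = u2 * b1"
    and y: "(u1 - v1) * a1 * b1 - v2 * a1 * b2 + u2 * a2 * b1 = 0"
  shows "(a1 - b1) * (u1 - v1) + (a2 - b2) * (u2 - v2) = 0"
proof -
  \<comment> \<open>\<open>x2\<close> and \<open>y2\<close> give \<open>a\<close> and
    \<open>b\<close> common ratios \<open>\<sigma>\<close> and \<open>\<tau>\<close>; the third
    equation makes these opposite, so they form an angular velocity.\<close>
  define \<sigma> \<tau> where "\<sigma> = u1 / a2" and "\<tau> = u2 / a1"
  have u: "u1 = \<sigma> * a2" "u2 = \<tau> * a1" using nz by (auto simp: \<sigma>_def \<tau>_def)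
  have v: "v1 = \<sigma> * b2" "v2 = \<tau> * b1" using nz x2 y2 by (auto simp: \<sigma>_def \<tau>_def field_simps)
  have "a1 * b1 * (a2 - b2) * (\<sigma> + \<tau>) = 0"
    using y unfolding u v by algebra
  then have "\<tau> = - \<sigma>" using nz by (auto simp: add_eq_0_iff)
  then show ?thesis unfolding u v by algebra
qed

text \<open>With the third point at rest at the origin the cubic terms cancel. What remains is a
  quadratic polynomial without constant term; its coefficients are read off first in
  \<open>x\<close> for fixed \<open>y\<close>, then in \<open>y\<close>.\<close>

lemma rotation_if_determinant_zero:
  fixes a1 a2 b1 b2 u1 u2 v1 v2 :: real
  assumes lh: "l1 < h1" "l2 < h2"
    and nz: "a1 \<noteq> 0" "a2 \<noteq> 0" "b1 \<noteq> 0" "b2 \<noteq> 0" "a1 \<noteq> b1" "a2 \<noteq> b2"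
    and eq: "\<And>x y. x \<in> {l1<..<h1} \<Longrightarrow> y \<in> {l2<..<h2} \<Longrightarrow>
       v1 * ((x - b1) * x * (y - a2)) - u1 * (x * (x - a1) * (y - b2)) + (u1 - v1) * ((x - a1) * (x - b1) * y)
     - v2 * ((y - b2) * y * (x - a1)) + u2 * (y * (y - a2) * (x - b1)) - (u2 - v2) * ((y - a2) * (y - b2) * x) = 0"
  shows "(a1 - b1) * (u1 - v1) + (a2 - b2) * (u2 - v2) = 0"
proof -
  define A B C E F where "A = u1 * (a1 + 0) - v1 * b1 - (u1 - v1) * (a1 + b1) + v2 * b2 - u2 * a2 + (u2 - v2) * (a2 + b2)"
    and "B = u1 * b2 - v1 * a2"
    and "C = v2 * a1 - u2 * b1"
    and "E = v1 * b1 * a2 - u1 * a1 * b2 - (u2 - v2) * a2 * b2"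
    and "F = (u1 - v1) * a1 * b1 - v2 * a1 * b2 + u2 * a2 * b1"
  have P: "B * x^2 + (A * y + E) * x + (C * y^2 + F * y) = 0"
    if "x \<in> {l1<..<h1}" "y \<in> {l2<..<h2}" for x y
  proof -
    have "B * x^2 + (A * y + E) * x + (C * y^2 + F * y) =
       v1 * ((x - b1) * x * (y - a2)) - u1 * (x * (x - a1) * (y - b2)) + (u1 - v1) * ((x - a1) * (x - b1) * y)
     - v2 * ((y - b2) * y * (x - a1)) + u2 * (y * (y - a2) * (x - b1)) - (u2 - v2) * ((y - a2) * (y - b2) * x)"
      unfolding A_def B_def C_def E_def F_def by algebra
    with eq[OF that] show ?thesis by simp
  qed
  have 1: "B = 0 \<and> A * y + E = 0 \<and> C * y^2 + F * y = 0" if "y \<in> {l2<..<h2}" for y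
    using quadratic_zero_on_interval[OF lh(1), of B "A * y + E" "C * y^2 + F * y"] P that by blast
  have 2: "C = 0 \<and> F = 0 \<and> (0::real) = 0"
    by (rule quadratic_zero_on_interval[OF lh(2)]) (use 1 in simp)
  have "B = 0" using 1[of "(l2 + h2) / 2"] lh by auto
  with 2 show ?thesis
    by (intro rotation_if_coeffs_zero nz) (auto simp: B_def C_def F_def)
qed

section \<open>Plane vectors and the extension determinant\<close>

definition cross2 :: "real^2 \<Rightarrow> real^2 \<Rightarrow> real" where
  "cross2 x y = x $ 1 * y $ 2 - x $ 2 * y $ 1"

definition perp :: "real^2 \<Rightarrow> real^2" where
  "perp x = vector [- (x $ 2), x $ 1]"

lemma perp_nth [simp]: "perp x $ 1 = - (x $ 2)" "perp x $ 2 = x $ 1"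
  by (simp_all add: perp_def)

lemma inner_2: "(x :: real^2) \<bullet> y = x $ 1 * y $ 1 + x $ 2 * y $ 2"
  by (simp add: inner_vec_def sum_2)

lemma vec_eq_2_iff: "(x :: real^2) = y \<longleftrightarrow> x $ 1 = y $ 1 \<and> x $ 2 = y $ 2"
  by (simp add: vec_eq_iff forall_2)

lemma signed_power_nth [simp]: "signed_power s x $ i = spow s (x $ i)"
  by (simp add: signed_power_def spow_def)

text \<open>Stronger than distinctness: the branch points must be distinct in each coordinate
  separately.\<close>

definition coords_differ :: "real^2 \<Rightarrow> real^2 \<Rightarrow> bool" where
  "coords_differ x y \<longleftrightarrow> x $ 1 \<noteq> y $ 1 \<and> x $ 2 \<noteq> y $ 2"

lemma coords_differ_sym: "coords_differ x y \<Longrightarrow> coords_differ y x"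
  by (auto simp: coords_differ_def)

abbreviation in_box :: "real \<Rightarrow> real \<Rightarrow> real \<Rightarrow> real \<Rightarrow> real^2 \<Rightarrow> bool" where
  "in_box l1 h1 l2 h2 z \<equiv> z $ 1 \<in> {l1<..<h1} \<and> z $ 2 \<in> {l2<..<h2}"

text \<open>The determinant of the linear system for the velocity of a new point \<open>z\<close> joined to
  \<open>a\<close>, \<open>b\<close>, \<open>c\<close> and for the coefficient of a given flex \<open>u\<close>.\<close>

definition ext_det :: "real \<Rightarrow> real^2 \<Rightarrow> real^2 \<Rightarrow> real^2 \<Rightarrow> real^2 \<Rightarrow> real^2 \<Rightarrow> real^2 \<Rightarrow> real^2 \<Rightarrow> real" where
  "ext_det s z a b c ua ub uc = (let A = signed_power s (z - a); B = signed_power s (z - b); C = signed_power s (z - c)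
     in (A \<bullet> ua) * cross2 B C + (B \<bullet> ub) * cross2 C A + (C \<bullet> uc) * cross2 A B)"

text \<open>Vanishing on a whole box makes all velocity differences zero if
  \<open>s \<noteq> 1\<close>. If \<open>s = 1\<close> it leaves velocities of a rotation, whose
  differences are orthogonal to \<open>a - b\<close>. The hypotheses on \<open>ua\<close> and
  \<open>ub\<close> exclude these two outcomes.\<close>

lemma exists_ext_det_nonzero:
  fixes a b c ua ub uc :: "real^2"
  assumes s: "s > 0" and lh: "l1 < h1" "l2 < h2"
    and ne: "coords_differ a b" "coords_differ b c" "coords_differ a c"
    and out1: "a $ 1 \<notin> {l1<..<h1}" "b $ 1 \<notin> {l1<..<h1}" "c $ 1 \<notin> {l1<..<h1}"
    and out2: "a $ 2 \<notin> {l2<..<h2}" "b $ 2 \<notin> {l2<..<h2}" "c $ 2 \<notin> {l2<..<h2}"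
    and u: "ua \<noteq> ub" "s = 1 \<Longrightarrow> (a - b) \<bullet> (ua - ub) \<noteq> 0"
  shows "\<exists>z. in_box l1 h1 l2 h2 z \<and> ext_det s z a b c ua ub uc \<noteq> 0"
proof (rule ccontr)
  assume con: "\<not> ?thesis"
  have zero: "ext_det s (vector [x, y]) a b c ua ub uc = 0" if "x \<in> {l1<..<h1}" "y \<in> {l2<..<h2}" for x y
  proof -
    have "(vector [x, y] :: real^2) $ 1 \<in> {l1<..<h1}" "(vector [x, y] :: real^2) $ 2 \<in> {l2<..<h2}"
      using that by auto
    then show ?thesis using con by blast
  qed
  have expand: "tensor_form s a b c (ub$1 - uc$1) (uc$1 - ua$1) (ua$1 - ub$1)
      (uc$2 - ub$2) (ua$2 - uc$2) (ub$2 - ua$2) x y = 0" if "x \<in> {l1<..<h1}" "y \<in> {l2<..<h2}" for x y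
    using zero[OF that] by (simp add: ext_det_def cross2_def inner_2 Let_def tensor_form_def) algebra
  show False
  proof (cases "s = 1")
    case False
    have d: "ub$1 - uc$1 = 0 \<and> uc$1 - ua$1 = 0 \<and> ua$1 - ub$1 = 0"
      by (rule tensor_form_coeffs_zero[OF s False lh _ _ _ out1 out2 expand])
         (use ne in \<open>auto simp: coords_differ_def\<close>)
    \<comment> \<open>Interchanging the two coordinates swaps the two groups of coefficients, so the
      same lemma yields the other three.\<close>
    define sw where "sw x = (vector [x$2, x$1] :: real^2)" for x :: "real^2"
    have sw: "sw x $ 1 = x $ 2" "sw x $ 2 = x $ 1" for x by (auto simp: sw_def)
    have swap: "tensor_form s (sw a) (sw b) (sw c) ea eb ec da db dc y x = tensor_form s a b c da db dc ea eb ec x y"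
      for da db dc ea eb ec x y
      by (simp add: tensor_form_def sw)
    have e: "uc$2 - ub$2 = 0 \<and> ua$2 - uc$2 = 0 \<and> ub$2 - ua$2 = 0"
    proof (rule tensor_form_coeffs_zero[OF s False lh(2,1)])
      fix x y assume "x \<in> {l2<..<h2}" "y \<in> {l1<..<h1}"
      from expand[OF this(2,1)]
      show "tensor_form s (sw a) (sw b) (sw c) (uc$2 - ub$2) (ua$2 - uc$2) (ub$2 - ua$2)
          (ub$1 - uc$1) (uc$1 - ua$1) (ua$1 - ub$1) x y = 0"
        unfolding swap .
    qed (use ne out1 out2 in \<open>auto simp: coords_differ_def sw\<close>)
    have "ua$1 = ub$1" "ua$2 = ub$2" using d e by linarith+
    then show False using u(1) by (simp add: vec_eq_2_iff)
  next
    case True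
    \<comment> \<open>Positions relative to \<open>c\<close> and velocities relative to
      \<open>uc\<close>; the expanded form depends on differences only.\<close>
    have "((a$1 - c$1) - (b$1 - c$1)) * ((ua$1 - uc$1) - (ub$1 - uc$1)) + ((a$2 - c$2) - (b$2 - c$2)) * ((ua$2 - uc$2) - (ub$2 - uc$2)) = 0"
    proof (rule rotation_if_determinant_zero[of "l1 - c$1" "h1 - c$1" "l2 - c$2" "h2 - c$2"])
      fix x y assume "x \<in> {l1 - c$1<..<h1 - c$1}" "y \<in> {l2 - c$2<..<h2 - c$2}"
      then have "x + c$1 \<in> {l1<..<h1}" "y + c$2 \<in> {l2<..<h2}" by auto
      note E = expand[OF this, unfolded True tensor_form_def spow_one]
      have r: "x + c$1 - a$1 = x - (a$1 - c$1)" "x + c$1 - b$1 = x - (b$1 - c$1)" "x + c$1 - c$1 = x"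
        "y + c$2 - a$2 = y - (a$2 - c$2)" "y + c$2 - b$2 = y - (b$2 - c$2)" "y + c$2 - c$2 = y"
        "uc$1 - ua$1 = - (ua$1 - uc$1)" "ua$1 - ub$1 = (ua$1 - uc$1) - (ub$1 - uc$1)"
        "uc$2 - ub$2 = - (ub$2 - uc$2)" "ub$2 - ua$2 = (ub$2 - uc$2) - (ua$2 - uc$2)"
        by simp_all
      have gen: "v1 * ((x - b1) * x * (y - a2)) - u1 * (x * (x - a1) * (y - b2)) + (u1 - v1) * ((x - a1) * (x - b1) * y)
         - v2 * ((y - b2) * y * (x - a1)) + u2 * (y * (y - a2) * (x - b1)) - (u2 - v2) * ((y - a2) * (y - b2) * x) = 0"
        if "v1 * ((x - b1) * x * (y - a2)) + - u1 * (x * (x - a1) * (y - b2)) + (u1 - v1) * ((x - a1) * (x - b1) * y)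
         + - v2 * ((y - b2) * y * (x - a1)) + u2 * (y * (y - a2) * (x - b1)) + (v2 - u2) * ((y - a2) * (y - b2) * x) = 0"
        for a1 a2 b1 b2 u1 u2 v1 v2 :: real
        using that by algebra
      from E show
       "(ub$1 - uc$1) * ((x - (b$1 - c$1)) * x * (y - (a$2 - c$2))) - (ua$1 - uc$1) * (x * (x - (a$1 - c$1)) * (y - (b$2 - c$2)))
       + ((ua$1 - uc$1) - (ub$1 - uc$1)) * ((x - (a$1 - c$1)) * (x - (b$1 - c$1)) * y)
       - (ub$2 - uc$2) * ((y - (b$2 - c$2)) * y * (x - (a$1 - c$1))) + (ua$2 - uc$2) * (y * (y - (a$2 - c$2)) * (x - (b$1 - c$1)))
       - ((ua$2 - uc$2) - (ub$2 - uc$2)) * ((y - (a$2 - c$2)) * (y - (b$2 - c$2)) * x) = 0"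
        unfolding r by (rule gen)
    qed (use ne lh in \<open>auto simp: coords_differ_def\<close>)
    then show False using u(2)[OF True] by (simp add: inner_2)
  qed
qed

section \<open>Sparse multigraphs\<close>

definition pairs :: "'a set \<Rightarrow> 'a set set" where
  "pairs S = {e. e \<subseteq> S \<and> card e = 2}"

text \<open>A function \<open>m\<close> on two-element sets is regarded as a multigraph with edge multiplicities \<open>m e\<close>.
  Multiple edges are needed because the degree three reduction of a (2,2)-sparse simple graph
  (such as the complete graph on four vertices) may create them.\<close>

definition edge_count :: "('a set \<Rightarrow> nat) \<Rightarrow> 'a set \<Rightarrow> nat" where
  "edge_count m S = sum m (pairs S)"

text \<open>Added rather than subtracted because the counts are naturals. Induced edge sets are the
  worst case, and vertices without edges only raise the right-hand side.\<close>

definition msparse :: "nat \<Rightarrow> ('a set \<Rightarrow> nat) \<Rightarrow> bool" where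
  "msparse l m \<longleftrightarrow> (\<forall>S. finite S \<and> 2 \<le> card S \<longrightarrow> edge_count m S + l \<le> 2 * card S)"

definition supported :: "'a set \<Rightarrow> ('a set \<Rightarrow> nat) \<Rightarrow> bool" where
  "supported V m \<longleftrightarrow> (\<forall>e. e \<notin> pairs V \<longrightarrow> m e = 0)"

lemma msparseD: "msparse l m \<Longrightarrow> finite S \<Longrightarrow> 2 \<le> card S \<Longrightarrow> edge_count m S + l \<le> 2 * card S"
  by (simp add: msparse_def)

lemma finite_pairs [simp]: "finite S \<Longrightarrow> finite (pairs S)"
  by (rule finite_subset[of _ "Pow S"]) (auto simp: pairs_def)

lemma pairs_mono: "S \<subseteq> T \<Longrightarrow> pairs S \<subseteq> pairs T"
  by (auto simp: pairs_def)

lemma pairs_Int: "pairs (S \<inter> T) = pairs S \<inter> pairs T"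
  by (auto simp: pairs_def)

lemma pairsE:
  assumes "e \<in> pairs S"
  obtains v w where "e = {v, w}" "v \<noteq> w" "v \<in> S" "w \<in> S"
  using assms by (auto simp: pairs_def card_2_iff)

lemma doubleton_in_pairs [simp]: "{v, w} \<in> pairs S \<longleftrightarrow> v \<noteq> w \<and> v \<in> S \<and> w \<in> S"
  by (cases "v = w") (auto simp: pairs_def)

lemma pairs_card_le_1:
  assumes "finite S" "card S \<le> 1"
  shows "pairs S = {}"
proof (rule ccontr)
  assume "pairs S \<noteq> {}"
  then obtain e where "e \<subseteq> S" "card e = 2" by (auto simp: pairs_def)
  with card_mono[OF assms(1), of e] assms(2) show False by simp
qed

lemma edge_count_card_le_1: "finite S \<Longrightarrow> card S \<le> 1 \<Longrightarrow> edge_count m S = 0"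
  by (simp add: edge_count_def pairs_card_le_1)

lemma pairs_insert: "v \<notin> S \<Longrightarrow> pairs (insert v S) = pairs S \<union> (\<lambda>w. {v, w}) ` S"
proof (intro set_eqI iffI)
  fix e assume v: "v \<notin> S" and e: "e \<in> pairs (insert v S)"
  from e obtain a b where "e = {a, b}" "a \<noteq> b" "a \<in> insert v S" "b \<in> insert v S" by (rule pairsE)
  then show "e \<in> pairs S \<union> (\<lambda>w. {v, w}) ` S"
    by (auto simp: insert_commute)
qed (auto simp: pairs_def card_insert_if)

lemma edge_count_insert:
  assumes "finite S" "v \<notin> S"
  shows "edge_count m (insert v S) = edge_count m S + (\<Sum>w\<in>S. m {v, w})"
proof -
  have "inj_on (\<lambda>w. {v, w}) S" by (auto simp: inj_on_def doubleton_eq_iff)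
  moreover have "pairs S \<inter> (\<lambda>w. {v, w}) ` S = {}" using assms(2) by (auto simp: pairs_def)
  ultimately show ?thesis
    unfolding edge_count_def pairs_insert[OF assms(2)]
    using assms(1) by (subst sum.union_disjoint) (auto simp: sum.reindex)
qed

lemma edge_count_supermodular:
  assumes "finite S" "finite T"
  shows "edge_count m S + edge_count m T \<le> edge_count m (S \<union> T) + edge_count m (S \<inter> T)"
proof -
  have "edge_count m S + edge_count m T = sum m (pairs S \<union> pairs T) + sum m (pairs S \<inter> pairs T)"
    unfolding edge_count_def using assms by (intro sum.union_inter[symmetric]) auto
  also have "sum m (pairs S \<union> pairs T) \<le> edge_count m (S \<union> T)"
    unfolding edge_count_def using assms by (intro sum_mono2) (auto simp: pairs_def)
  finally show ?thesis by (simp add: edge_count_def pairs_Int)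
qed

lemma msparse_mono:
  assumes "msparse l m" "\<And>e. m' e \<le> m e"
  shows "msparse l m'"
  unfolding msparse_def
proof (intro allI impI)
  fix S :: "'a set" assume S: "finite S \<and> 2 \<le> card S"
  have "edge_count m' S \<le> edge_count m S"
    unfolding edge_count_def by (intro sum_mono assms(2))
  with msparseD[OF assms(1)] S show "edge_count m' S + l \<le> 2 * card S"
    by fastforce
qed

lemma handshake:
  assumes "finite V"
  shows "(\<Sum>v\<in>V. \<Sum>w\<in>V - {v}. m {v, w}) = 2 * edge_count m V"
  using assms
proof (induction V rule: finite_induct)
  case empty
  then show ?case by (simp add: edge_count_card_le_1)
next
  case (insert v S)
  have "(\<Sum>w\<in>insert v S - {x}. m {x, w}) = m {v, x} + (\<Sum>w\<in>S - {x}. m {x, w})" if "x \<in> S" for x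
  proof -
    have "insert v S - {x} = insert v (S - {x})" using that insert by auto
    then show ?thesis using insert that by (simp add: insert_commute)
  qed
  then have "(\<Sum>x\<in>S. \<Sum>w\<in>insert v S - {x}. m {x, w}) = (\<Sum>x\<in>S. m {v, x}) + 2 * edge_count m S"
    using insert by (simp add: sum.distrib)
  with insert show ?case by (simp add: edge_count_insert)
qed

text \<open>Sparsity keeps the sum of the degrees strictly below \<open>4 * card V\<close>, so the
  average degree is less than four.\<close>

lemma exists_low_degree:
  assumes "finite V" "V \<noteq> {}" "msparse l m" "l > 0"
  shows "\<exists>v\<in>V. (\<Sum>w\<in>V - {v}. m {v, w}) \<le> 3"
proof (rule ccontr)
  assume "\<not> ?thesis"
  then have "(\<Sum>v\<in>V. 4) \<le> (\<Sum>v\<in>V. \<Sum>w\<in>V - {v}. m {v, w})"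
    by (intro sum_mono) (auto simp: not_le)
  then have 1: "4 * card V \<le> 2 * edge_count m V"
    using handshake[OF assms(1), of m] by simp
  show False
  proof (cases "card V \<le> 1")
    case True
    with 1 assms edge_count_card_le_1[OF assms(1)] show False by (simp add: card_gt_0_iff)
  next
    case False
    then have "edge_count m V + l \<le> 2 * card V" using assms(1) by (intro msparseD[OF assms(3)]) auto
    with 1 assms(4) show False by simp
  qed
qed

lemma sum_SucE:
  assumes "finite A" "(\<Sum>w\<in>A. n w) = Suc k"
  obtains a where "a \<in> A" "n a > 0" "(\<Sum>w\<in>A. n w - of_bool (w = a)) = k"
proof -
  obtain a where a: "a \<in> A" "n a > 0"
    using assms by (metis bot_nat_0.not_eq_extremum nat.distinct(1) sum.neutral)
  have "(\<Sum>w\<in>A. n w) = (\<Sum>w\<in>A. (n w - of_bool (w = a)) + of_bool (w = a))"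
    using a by (intro sum.cong) auto
  also have "\<dots> = (\<Sum>w\<in>A. n w - of_bool (w = a)) + (\<Sum>w\<in>A. of_bool (w = a))"
    by (rule sum.distrib)
  also have "(\<Sum>w\<in>A. of_bool (w = a)) = (1::nat)"
    using assms(1) a by (simp add: of_bool_def)
  finally show thesis using that[OF a] assms by simp
qed

lemma sum_le_2_cover:
  assumes "finite A" "A \<noteq> {}" "(\<Sum>w\<in>A. n w) \<le> (2::nat)"
  shows "\<exists>a\<in>A. \<exists>b\<in>A. \<forall>w\<in>A. n w \<le> of_bool (w = a) + of_bool (w = b)"
proof (cases "(\<Sum>w\<in>A. n w)")
  case 0
  with assms show ?thesis by auto
next
  case (Suc k)
  then obtain a where a: "a \<in> A" "n a > 0" "(\<Sum>w\<in>A. n w - of_bool (w = a)) = k"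
    using sum_SucE[OF assms(1)] by metis
  show ?thesis
  proof (cases k)
    case 0
    with a(3) assms(1) have "\<forall>w\<in>A. n w - of_bool (w = a) = 0" by simp
    then show ?thesis using a(1) by (intro bexI[of _ a]) auto
  next
    case (Suc j)
    with a(3) obtain b where b: "b \<in> A" "(\<Sum>w\<in>A. n w - of_bool (w = a) - of_bool (w = b)) = j"
      using sum_SucE[OF assms(1), of "\<lambda>w. n w - of_bool (w = a)"] by metis
    moreover have "j = 0" using Suc assms(3) \<open>_ = Suc k\<close> by simp
    ultimately have "\<forall>w\<in>A. n w - of_bool (w = a) - of_bool (w = b) = 0" using assms(1) by simp
    then show ?thesis using a(1) b(1)
      by (intro bexI[of _ a] bexI[of _ b]) (auto simp: diff_diff_add)
  qed
qed

definition delete_vertex :: "'a \<Rightarrow> ('a set \<Rightarrow> nat) \<Rightarrow> 'a set \<Rightarrow> nat" where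
  "delete_vertex v m = (\<lambda>e. if v \<in> e then 0 else m e)"

definition add_edge :: "'a set \<Rightarrow> ('a set \<Rightarrow> nat) \<Rightarrow> 'a set \<Rightarrow> nat" where
  "add_edge e m = m(e := Suc (m e))"

lemma supported_delete_vertex: "supported V m \<Longrightarrow> supported (V - {v}) (delete_vertex v m)"
  by (auto simp: supported_def delete_vertex_def pairs_def)

lemma supported_add_edge: "supported V m \<Longrightarrow> e \<in> pairs V \<Longrightarrow> supported V (add_edge e m)"
  by (auto simp: supported_def add_edge_def)

lemma msparse_delete_vertex: "msparse l m \<Longrightarrow> msparse l (delete_vertex v m)"
  by (rule msparse_mono) (auto simp: delete_vertex_def)

lemma edge_count_add_edge:
  assumes "finite S"
  shows "edge_count (add_edge e m) S = edge_count m S + of_bool (e \<in> pairs S)"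
proof -
  have "edge_count (add_edge e m) S = (\<Sum>x\<in>pairs S. m x + of_bool (x = e))"
    unfolding edge_count_def add_edge_def by (intro sum.cong) auto
  also have "\<dots> = edge_count m S + (\<Sum>x\<in>pairs S. of_bool (x = e))"
    by (simp add: sum.distrib edge_count_def)
  finally show ?thesis using assms by (simp add: of_bool_def)
qed

text \<open>Only a tight set containing both ends can block a new edge, since no count grows by more
  than one.\<close>

lemma not_msparse_add_edgeE:
  assumes "msparse l m" "\<not> msparse l (add_edge e m)"
  obtains S where "finite S" "2 \<le> card S" "e \<in> pairs S" "edge_count m S + l = 2 * card S"
proof -
  from assms(2) obtain S where S: "finite S" "2 \<le> card S" "\<not> edge_count (add_edge e m) S + l \<le> 2 * card S"
    by (auto simp: msparse_def)
  moreover have "edge_count m S + l \<le> 2 * card S" using S by (intro msparseD[OF assms(1)])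
  ultimately show thesis
    using that[of S] edge_count_add_edge[OF S(1), of e m] by (auto split: if_splits simp: of_bool_def)
qed

text \<open>The deficiency \<open>2 * card S - edge_count m S - l\<close> is submodular and vanishes
  on \<open>S\<close> and \<open>T\<close>; being nonnegative on union and intersection, it vanishes
  on both. For \<open>l = 2\<close> a single common vertex has deficiency
  \<open>2 - 0 - 2 = 0\<close> and serves as well as two.\<close>

lemma tight_Un:
  assumes sp: "msparse l m" and fin: "finite S" "finite T"
    and tS: "edge_count m S + l = 2 * card S" and tT: "edge_count m T + l = 2 * card T"
    and c: "2 \<le> card (S \<union> T)" and int: "2 \<le> card (S \<inter> T) \<or> (l = 2 \<and> S \<inter> T \<noteq> {})"
  shows "edge_count m (S \<union> T) + l = 2 * card (S \<union> T)"
proof -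
  have "edge_count m (S \<inter> T) + l \<le> 2 * card (S \<inter> T)"
  proof (cases "2 \<le> card (S \<inter> T)")
    case True
    then show ?thesis using fin by (intro msparseD[OF sp]) auto
  next
    case False
    with int have *: "l = 2" "S \<inter> T \<noteq> {}" by auto
    then have "card (S \<inter> T) = 1" using False fin
      by (metis One_nat_def Suc_1 Suc_leI card_gt_0_iff finite_Int le_antisym not_less_eq_eq)
    then show ?thesis using * fin by (simp add: edge_count_card_le_1)
  qed
  moreover have "edge_count m (S \<union> T) + l \<le> 2 * card (S \<union> T)"
    using fin c by (intro msparseD[OF sp]) auto
  ultimately show ?thesis
    using edge_count_supermodular[OF fin, of m] card_Un_Int[OF fin] tS tT by linarith
qed

text \<open>Three tight sets meeting pairwise in single vertices, like the sides of a triangle,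
  share no edge. With \<open>n\<close> vertices in the union the edge counts add up to
  \<open>2 * (n + 3) - 9 = 2 * n - 3\<close>.\<close>

lemma tight_Un3:
  assumes sp: "msparse 3 m" and fin: "finite R" "finite S" "finite T"
    and t: "edge_count m R + 3 = 2 * card R" "edge_count m S + 3 = 2 * card S" "edge_count m T + 3 = 2 * card T"
    and int: "R \<inter> S = {x}" "S \<inter> T = {y}" "R \<inter> T = {z}" and d: "x \<noteq> y"
  shows "edge_count m (R \<union> S \<union> T) + 3 = 2 * card (R \<union> S \<union> T)"
proof -
  have disj: "pairs R \<inter> pairs S = {}" "(pairs R \<union> pairs S) \<inter> pairs T = {}"
    unfolding Int_Un_distrib2 pairs_Int[symmetric] int by (simp_all add: pairs_card_le_1)
  have "edge_count m R + edge_count m S + edge_count m T = sum m (pairs R \<union> pairs S \<union> pairs T)"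
    unfolding edge_count_def using fin disj by (simp add: sum.union_disjoint)
  also have "\<dots> \<le> edge_count m (R \<union> S \<union> T)"
    unfolding edge_count_def using fin by (intro sum_mono2) (auto simp: pairs_def)
  finally have 1: "edge_count m R + edge_count m S + edge_count m T \<le> edge_count m (R \<union> S \<union> T)" .
  have mem: "x \<in> R \<inter> S" "y \<in> S \<inter> T" "z \<in> R \<inter> T" unfolding int by simp_all
  have "z \<noteq> y"
  proof
    assume "z = y"
    with mem have "y \<in> R \<inter> S" by simp
    with d show False unfolding int by simp
  qed
  moreover have "(R \<union> S) \<inter> T = {z, y}" unfolding Int_Un_distrib2 int by (simp add: insert_commute)
  ultimately have "card ((R \<union> S) \<inter> T) = 2" by simp
  then have 2: "card (R \<union> S \<union> T) + 2 = card (R \<union> S) + card T"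
    using card_Un_Int[OF finite_UnI[OF fin(1,2)] fin(3)] by linarith
  have "card (R \<inter> S) = 1" by (simp add: int)
  then have 3: "card (R \<union> S) + 1 = card R + card S"
    using card_Un_Int[OF fin(1,2)] by linarith
  have "card {x, y} \<le> card (R \<union> S \<union> T)" using fin mem by (intro card_mono) auto
  then have "edge_count m (R \<union> S \<union> T) + 3 \<le> 2 * card (R \<union> S \<union> T)"
    using fin d by (intro msparseD[OF sp]) auto
  with 1 2 3 t show ?thesis by linarith
qed

text \<open>A pair of neighbours that cannot be joined lies in a tight set avoiding
  \<open>v\<close>. If all pairs are blocked, such sets unite to a tight set containing every
  neighbour; adding \<open>v\<close> then contributes three edges but raises the bound by two only.
  The third neighbour \<open>c\<close> may equal \<open>a\<close> or \<open>b\<close>.\<close>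

lemma degree_three_reduction:
  assumes fin: "finite V" and v: "v \<in> V" and sup: "supported V m" and sp: "msparse l m"
    and l: "l = 2 \<or> l = 3" and deg: "(\<Sum>w\<in>V - {v}. m {v, w}) = 3"
  shows "\<exists>a\<in>V - {v}. \<exists>b\<in>V - {v}. \<exists>c\<in>V - {v}. a \<noteq> b \<and>
    (\<forall>w\<in>V - {v}. m {v, w} = of_bool (w = a) + of_bool (w = b) + of_bool (w = c)) \<and>
    msparse l (add_edge {a, b} (delete_vertex v m))"
proof -
  define W where "W = V - {v}"
  define n where "n w = m {v, w}" for w
  define m' where "m' = delete_vertex v m"
  have fW: "finite W" and vW: "v \<notin> W" using fin by (auto simp: W_def)
  have sp': "msparse l m'" unfolding m'_def using sp by (rule msparse_delete_vertex)
  have n2: "n w \<le> 2" if "w \<in> W" for w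
  proof -
    have "v \<noteq> w" using that vW by auto
    then have "edge_count m {v, w} = m {v, w}"
      using edge_count_insert[of "{w}" v m] by (simp add: edge_count_card_le_1)
    moreover have "edge_count m {v, w} + l \<le> 2 * card {v, w}"
      using sp[unfolded msparse_def, rule_format, of "{v, w}"] \<open>v \<noteq> w\<close> by simp
    moreover have "card {v, w} = 2" using \<open>v \<noteq> w\<close> by simp
    ultimately show ?thesis using l unfolding n_def by linarith
  qed
  have deg': "(\<Sum>w\<in>W. n w) = Suc 2" using deg by (simp add: W_def n_def)
  have no_tight: False if S: "finite S" "v \<notin> S" "S \<noteq> {}" "edge_count m' S + l = 2 * card S" "{w\<in>W. n w > 0} \<subseteq> S" for S
  proof -
    have "edge_count m S = edge_count m' S"
      unfolding edge_count_def m'_def delete_vertex_def using S(2) by (intro sum.cong) (auto simp: pairs_def)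
    moreover have "(\<Sum>w\<in>W. n w) \<le> (\<Sum>w\<in>S. m {v, w})"
    proof -
      have "(\<Sum>w\<in>W. n w) = (\<Sum>w\<in>{w\<in>W. n w > 0}. n w)"
        using fW by (intro sum.mono_neutral_right) auto
      also have "\<dots> \<le> (\<Sum>w\<in>S. n w)" using S by (intro sum_mono2) auto
      finally show ?thesis by (simp add: n_def)
    qed
    moreover have "edge_count m (insert v S) + l \<le> 2 * card (insert v S)"
    proof -
      have "2 \<le> card (insert v S)" using S by (simp add: Suc_le_eq card_gt_0_iff)
      then show ?thesis using S(1) by (intro msparseD[OF sp]) auto
    qed
    ultimately show False
      using S deg' edge_count_insert[OF S(1,2), of m] by simp
  qed
  have blocked: "\<exists>S. finite S \<and> v \<notin> S \<and> {a, b} \<subseteq> S \<and> edge_count m' S + l = 2 * card S"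
    if ab: "a \<in> W" "b \<in> W" "a \<noteq> b" and ns: "\<not> msparse l (add_edge {a, b} m')" for a b
  proof -
    obtain S where S: "finite S" "{a, b} \<in> pairs S" "edge_count m' S + l = 2 * card S"
      using not_msparse_add_edgeE[OF sp' ns] by metis
    \<comment> \<open>In \<open>m'\<close> the vertex \<open>v\<close> is isolated, so removing it
      from a tight set would lower the bound by two and violate sparsity.\<close>
    have "v \<notin> S"
    proof
      assume vS: "v \<in> S"
      have *: "{a, b} \<subseteq> S - {v}" using S(2) ab vW by auto
      have "card {a, b} \<le> card (S - {v})" using * S(1) by (intro card_mono) auto
      then have "edge_count m' (S - {v}) + l \<le> 2 * card (S - {v})"
        using S(1) ab(3) by (intro msparseD[OF sp']) auto
      moreover have "edge_count m' S = edge_count m' (S - {v})"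
        using edge_count_insert[of "S - {v}" v m'] S(1) vS
        by (simp add: insert_absorb m'_def delete_vertex_def)
      moreover have "card S = Suc (card (S - {v}))" using S(1) vS by (simp add: card_Suc_Diff1 del: card_Diff_insert card_Diff_singleton)
      ultimately show False using S(3) by simp
    qed
    with S show ?thesis by auto
  qed
  from fW deg' obtain a where a: "a \<in> W" "n a > 0" "(\<Sum>w\<in>W. n w - of_bool (w = a)) = 2"
    by (rule sum_SucE)
  from fW a(3)[unfolded numeral_2_eq_2] obtain b where b: "b \<in> W" "n b - of_bool (b = a) > 0"
      "(\<Sum>w\<in>W. n w - of_bool (w = a) - of_bool (w = b)) = Suc 0"
    by (rule sum_SucE)
  from fW b(3) obtain c where c: "c \<in> W" "n c - of_bool (c = a) - of_bool (c = b) > 0"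
      "(\<Sum>w\<in>W. n w - of_bool (w = a) - of_bool (w = b) - of_bool (w = c)) = 0"
    by (rule sum_SucE)
  have neq: "n w = of_bool (w = a) + of_bool (w = b) + of_bool (w = c)" if "w \<in> W" for w
  proof -
    have "n w - of_bool (w = a) - of_bool (w = b) - of_bool (w = c) = 0" using c(3) fW that by simp
    then show ?thesis using a(2) b(2) c(2)
      by (cases "w = a"; cases "w = b"; cases "w = c") auto
  qed
  have N: "{w \<in> W. n w > 0} = {a, b, c}" using neq a b c by auto
  have "\<exists>x y z. {x, y, z} \<subseteq> W \<and> x \<noteq> y \<and> (\<forall>w\<in>W. n w = of_bool (w = x) + of_bool (w = y) + of_bool (w = z)) \<and>
      msparse l (add_edge {x, y} m')"
  proof (rule ccontr)
    assume con: "\<not> ?thesis"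
    have all_blocked: "\<exists>S. finite S \<and> v \<notin> S \<and> {x, y} \<subseteq> S \<and> edge_count m' S + l = 2 * card S"
      if "x \<noteq> y" "{x, y, z} \<subseteq> W" "\<forall>w\<in>W. n w = of_bool (w = x) + of_bool (w = y) + of_bool (w = z)" for x y z
    proof (rule blocked)
      show "\<not> msparse l (add_edge {x, y} m')"
      proof
        assume "msparse l (add_edge {x, y} m')"
        with that have "\<exists>x y z. {x, y, z} \<subseteq> W \<and> x \<noteq> y \<and>
          (\<forall>w\<in>W. n w = of_bool (w = x) + of_bool (w = y) + of_bool (w = z)) \<and> msparse l (add_edge {x, y} m')"
          by (intro exI[of _ x] exI[of _ y] exI[of _ z] conjI)
        with con show False by (rule notE)
      qed
    qed (use that in auto)
    show False
    proof (cases "a = b \<or> b = c \<or> a = c")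
      case True
      \<comment> \<open>Multiplicities are at most two, so a repetition leaves exactly two distinct
        neighbours, and one blocking set contains both.\<close>
      have "\<not> (a = b \<and> b = c)" using neq[OF a(1)] n2[OF a(1)] by auto
      have "\<exists>x y z. x \<noteq> y \<and> {x, y, z} = {a, b, c} \<and> z \<in> {x, y} \<and>
        (\<forall>w\<in>W. n w = of_bool (w = x) + of_bool (w = y) + of_bool (w = z))"
        using True
      proof (elim disjE)
        assume "a = b"
        then show ?thesis using neq \<open>\<not> (a = b \<and> b = c)\<close> by (intro exI[of _ a] exI[of _ c]) auto
      next
        assume "b = c"
        then show ?thesis using neq \<open>\<not> (a = b \<and> b = c)\<close> by (intro exI[of _ a] exI[of _ b] exI[of _ c]) auto
      next
        assume "a = c"
        then show ?thesis using neq \<open>\<not> (a = b \<and> b = c)\<close> by (intro exI[of _ a] exI[of _ b] exI[of _ c]) auto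
      qed
      then obtain x y z where xyz: "x \<noteq> y" "{x, y, z} = {a, b, c}" "z \<in> {x, y}"
        "\<forall>w\<in>W. n w = of_bool (w = x) + of_bool (w = y) + of_bool (w = z)" by blast
      have "{x, y, z} \<subseteq> W" using xyz(2) a(1) b(1) c(1) by simp
      from all_blocked[OF xyz(1) this xyz(4)] obtain S where S: "finite S" "v \<notin> S" "{x, y} \<subseteq> S"
        "edge_count m' S + l = 2 * card S" by blast
      show False by (rule no_tight[OF S(1,2) _ S(4)]) (use S(3) N xyz(2,3) in auto)
    next
      case False
      have "\<exists>S. finite S \<and> v \<notin> S \<and> {a, b} \<subseteq> S \<and> edge_count m' S + l = 2 * card S"
        by (rule all_blocked[of _ _ c]) (use False neq a b c in auto)
      then obtain R where R: "finite R" "v \<notin> R" "{a, b} \<subseteq> R" "edge_count m' R + l = 2 * card R" by blast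
      have "\<exists>S. finite S \<and> v \<notin> S \<and> {b, c} \<subseteq> S \<and> edge_count m' S + l = 2 * card S"
        by (rule all_blocked[of _ _ a]) (use False neq a b c in auto)
      then obtain S where S: "finite S" "v \<notin> S" "{b, c} \<subseteq> S" "edge_count m' S + l = 2 * card S" by blast
      have "\<exists>S. finite S \<and> v \<notin> S \<and> {a, c} \<subseteq> S \<and> edge_count m' S + l = 2 * card S"
        by (rule all_blocked[of _ _ b]) (use False neq a b c in auto)
      then obtain T where T: "finite T" "v \<notin> T" "{a, c} \<subseteq> T" "edge_count m' T + l = 2 * card T" by blast
      \<comment> \<open>A larger overlap, or any overlap if \<open>l = 2\<close>, would make the
        union a tight set containing all three neighbours. What remains is \<open>l = 3\<close> with
        single-vertex intersections, the triangle configuration.\<close>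
      have un: "card (P \<inter> Q) = 1 \<and> l = 3"
        if P: "finite P" "v \<notin> P" "edge_count m' P + l = 2 * card P"
          and Q: "finite Q" "v \<notin> Q" "edge_count m' Q + l = 2 * card Q"
          and ne: "P \<inter> Q \<noteq> {}" and sub: "{a, b, c} \<subseteq> P \<union> Q" for P Q
      proof (rule ccontr)
        assume n: "\<not> (card (P \<inter> Q) = 1 \<and> l = 3)"
        have "card (P \<inter> Q) \<noteq> 0" using ne P Q by auto
        then have 1: "2 \<le> card (P \<inter> Q) \<or> (l = 2 \<and> P \<inter> Q \<noteq> {})" using n l ne by linarith
        have "card {a, b, c} \<le> card (P \<union> Q)" using P Q sub by (intro card_mono) auto
        then have "2 \<le> card (P \<union> Q)" using False by simp
        from tight_Un[OF sp' P(1) Q(1) P(3) Q(3) this 1] no_tight[of "P \<union> Q"] show False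
          using P Q sub N by auto
      qed
      have RS: "card (R \<inter> S) = 1 \<and> l = 3" and ST: "card (S \<inter> T) = 1 \<and> l = 3" and RT: "card (R \<inter> T) = 1 \<and> l = 3"
        using R S T by (intro un; auto)+
      have single: "A = {x}" if "card A = 1" "x \<in> A" for A and x :: 'a
        using that by (metis card_1_singletonE singletonD)
      have i: "R \<inter> S = {b}" "S \<inter> T = {c}" "R \<inter> T = {a}"
        using RS ST RT R(3) S(3) T(3) by (intro single; auto)+
      have "edge_count m' (R \<union> S \<union> T) + 3 = 2 * card (R \<union> S \<union> T)"
        by (rule tight_Un3[OF _ _ _ _ _ _ _ i]) (use sp' R S T RS False in auto)
      then show False
        by (intro no_tight[of "R \<union> S \<union> T"]) (use R S T RS N in auto)
    qed
  qed
  then obtain x y z where xyz: "{x, y, z} \<subseteq> W" "x \<noteq> y"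
    "\<forall>w\<in>W. n w = of_bool (w = x) + of_bool (w = y) + of_bool (w = z)"
    "msparse l (add_edge {x, y} m')" by blast
  show ?thesis
    unfolding W_def[symmetric] m'_def[symmetric] n_def[symmetric]
    using xyz by (intro bexI[of _ x] bexI[of _ y] bexI[of _ z] conjI) auto
qed

section \<open>Henneberg moves\<close>

definition edge_dir :: "real \<Rightarrow> nat \<Rightarrow> real^2 \<Rightarrow> real^2" where
  "edge_dir q k z = (if k = 0 then signed_power (q - 1) z else perp (signed_power (q - 1) z))"

abbreviation edge_rate :: "real \<Rightarrow> nat \<Rightarrow> ('a \<Rightarrow> real^2) \<Rightarrow> ('a \<Rightarrow> real^2) \<Rightarrow> 'a \<Rightarrow> 'a \<Rightarrow> real" where
  "edge_rate q k p u v w \<equiv> edge_dir q k (p v - p w) \<bullet> (u v - u w)"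

text \<open>The first copy of an edge
  constrains the relative velocity in the direction given by the rigidity matrix, a second copy
  constrains it in the perpendicular direction, so that a double edge ties its end points together.\<close>

definition solvable :: "real \<Rightarrow> ('a \<Rightarrow> real^2) \<Rightarrow> ('a set \<Rightarrow> nat) \<Rightarrow> bool" where
  "solvable q p m \<longleftrightarrow> (\<forall>c :: 'a set \<Rightarrow> nat \<Rightarrow> real. \<exists>u :: 'a \<Rightarrow> real^2. \<forall>v w k.
     v \<noteq> w \<and> k < m {v, w} \<longrightarrow> edge_rate q k p u v w = c {v, w} k)"

lemma perp_minus: "perp (- x) = - perp x"
  by (simp add: vec_eq_2_iff)

lemma edge_dir_minus: "edge_dir q k (- z) = - edge_dir q k z"
  by (simp add: edge_dir_def signed_power_minus perp_minus)

lemma edge_dir_commute: "edge_dir q k (x - y) \<bullet> (a - b) = edge_dir q k (y - x) \<bullet> (b - a)"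
proof -
  have "edge_dir q k (x - y) = - edge_dir q k (y - x)"
    using edge_dir_minus[of q k "y - x"] by simp
  then show ?thesis by (simp add: inner_diff_right)
qed

lemma solvable_mono:
  assumes "solvable q p m" "\<And>e. m' e \<le> m e"
  shows "solvable q p m'"
  unfolding solvable_def
proof
  fix c :: "'a set \<Rightarrow> nat \<Rightarrow> real"
  obtain u where "\<forall>v w k. v \<noteq> w \<and> k < m {v, w} \<longrightarrow> edge_rate q k p u v w = c {v, w} k"
    using assms(1) unfolding solvable_def by blast
  then show "\<exists>u. \<forall>v w k. v \<noteq> w \<and> k < m' {v, w} \<longrightarrow> edge_rate q k p u v w = c {v, w} k"
    using assms(2) order.strict_trans2 by (intro exI[of _ u]) blast
qed

lemma supported_pairE:
  assumes "supported V m" "k < m {v, w}"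
  shows "v \<in> V" "w \<in> V" "v \<noteq> w"
  using assms unfolding supported_def by (metis doubleton_in_pairs less_nat_zero_code)+

lemma solvable_cong:
  assumes "supported V m" "\<And>v. v \<in> V \<Longrightarrow> p v = p' v" "solvable q p m"
  shows "solvable q p' m"
  unfolding solvable_def
proof
  fix c :: "'a set \<Rightarrow> nat \<Rightarrow> real"
  obtain u where u: "\<forall>v w k. v \<noteq> w \<and> k < m {v, w} \<longrightarrow> edge_rate q k p u v w = c {v, w} k"
    using assms(3) unfolding solvable_def by blast
  show "\<exists>u. \<forall>v w k. v \<noteq> w \<and> k < m {v, w} \<longrightarrow> edge_rate q k p' u v w = c {v, w} k"
  proof (intro exI allI impI)
    fix v w k assume *: "v \<noteq> w \<and> k < m {v, w}"
    then have "v \<in> V" "w \<in> V" using supported_pairE[OF assms(1)] by blast+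
    then have "p v = p' v" "p w = p' w" using assms(2) by blast+
    moreover have "edge_rate q k p u v w = c {v, w} k" using u * by blast
    ultimately show "edge_rate q k p' u v w = c {v, w} k" by simp
  qed
qed

lemma delete_vertex_pair: "x \<noteq> v \<Longrightarrow> y \<noteq> v \<Longrightarrow> delete_vertex v m {x, y} = m {x, y}"
  by (auto simp: delete_vertex_def)

lemma cross2_solve:
  assumes "cross2 d e \<noteq> 0"
  shows "\<exists>w. d \<bullet> w = r \<and> e \<bullet> w = s"
proof (intro exI conjI)
  let ?w = "(1 / cross2 d e) *\<^sub>R vector [r * e$2 - s * d$2, s * d$1 - r * e$1] :: real^2"
  show "d \<bullet> ?w = r" "e \<bullet> ?w = s"
    using assms by (simp_all add: inner_2 field_simps) (simp_all add: cross2_def algebra_simps)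
qed

text \<open>Three equations for the two components of \<open>w\<close> and for \<open>t\<close>; up
  to sign the hypothesis says that their determinant is nonzero. \<open>t\<close> is chosen to make
  the right-hand sides satisfy the linear dependency of \<open>A\<close>, \<open>B\<close>,
  \<open>C\<close>, after which two of the equations determine \<open>w\<close>.\<close>

lemma ext_solve:
  assumes D: "ga * cross2 B C + gb * cross2 C A + gc * cross2 A B \<noteq> 0"
  shows "\<exists>w t. A \<bullet> w - t * ga = ra \<and> B \<bullet> w - t * gb = rb \<and> C \<bullet> w - t * gc = rc"
proof -
  define D where "D = ga * cross2 B C + gb * cross2 C A + gc * cross2 A B"
  define t where "t = - (ra * cross2 B C + rb * cross2 C A + rc * cross2 A B) / D"
  have "t * D = - (ra * cross2 B C + rb * cross2 C A + rc * cross2 A B)"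
    using D by (simp add: t_def D_def)
  then have tD: "(ra + t * ga) * cross2 B C + (rb + t * gb) * cross2 C A + (rc + t * gc) * cross2 A B = 0"
    by (simp add: D_def algebra_simps)
  have *: "\<exists>w. A \<bullet> w = x \<and> B \<bullet> w = y \<and> C \<bullet> w = z"
    if that1: "x * cross2 B C + y * cross2 C A + z * cross2 A B = 0" and that2: "cross2 B C \<noteq> 0"
    for A B C :: "real^2" and x y z
  proof -
    obtain w where w: "B \<bullet> w = y" "C \<bullet> w = z" using cross2_solve[OF that2] by blast
    \<comment> \<open>The Cramer relation between three vectors of the plane.\<close>
    have "(A \<bullet> w) * cross2 B C + (B \<bullet> w) * cross2 C A + (C \<bullet> w) * cross2 A B = 0"
      by (simp add: cross2_def inner_2 algebra_simps)
    with that1 have "(A \<bullet> w) * cross2 B C = x * cross2 B C" unfolding w by linarith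
    with that2 w show ?thesis by auto
  qed
  have "\<exists>w. A \<bullet> w = ra + t * ga \<and> B \<bullet> w = rb + t * gb \<and> C \<bullet> w = rc + t * gc"
  proof -
    consider "cross2 B C \<noteq> 0" | "cross2 C A \<noteq> 0" | "cross2 A B \<noteq> 0" using D by force
    then show ?thesis
    proof cases
      case 1
      then show ?thesis using *[OF tD] by blast
    next
      case 2
      then show ?thesis
        using *[of "rb + t * gb" C A "rc + t * gc" B "ra + t * ga"] tD by (simp add: add_ac) blast
    next
      case 3
      then show ?thesis
        using *[of "rc + t * gc" A B "ra + t * ga" C "rb + t * gb"] tD by (simp add: add_ac) blast
    qed
  qed
  then obtain w where "A \<bullet> w = ra + t * ga \<and> B \<bullet> w = rb + t * gb \<and> C \<bullet> w = rc + t * gc" by blast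
  then show ?thesis by (intro exI[of _ w] exI[of _ t]) simp
qed

lemma solvable_extendI:
  assumes "\<And>c. \<exists>u w. (\<forall>x y k. x \<noteq> y \<and> x \<noteq> v \<and> y \<noteq> v \<and> k < m {x, y} \<longrightarrow>
        edge_rate q k p u x y = c {x, y} k) \<and>
      (\<forall>y k. y \<noteq> v \<and> k < m {v, y} \<longrightarrow> edge_dir q k (z - p y) \<bullet> (w - u y) = c {v, y} k)"
  shows "solvable q (p(v := z)) m"
  unfolding solvable_def
proof
  fix c :: "'a set \<Rightarrow> nat \<Rightarrow> real"
  obtain u w where u: "\<And>x y k. x \<noteq> y \<Longrightarrow> x \<noteq> v \<Longrightarrow> y \<noteq> v \<Longrightarrow> k < m {x, y} \<Longrightarrow>
        edge_rate q k p u x y = c {x, y} k"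
      and w: "\<And>y k. y \<noteq> v \<Longrightarrow> k < m {v, y} \<Longrightarrow> edge_dir q k (z - p y) \<bullet> (w - u y) = c {v, y} k"
    using assms[of c] by blast
  show "\<exists>u. \<forall>x y k. x \<noteq> y \<and> k < m {x, y} \<longrightarrow>
      edge_dir q k ((p(v := z)) x - (p(v := z)) y) \<bullet> (u x - u y) = c {x, y} k"
  proof (intro exI[of _ "u(v := w)"] allI impI)
    fix x y k assume xy: "x \<noteq> y \<and> k < m {x, y}"
    consider "x \<noteq> v" "y \<noteq> v" | "x = v" "y \<noteq> v" | "y = v" "x \<noteq> v" using xy by blast
    then show "edge_dir q k ((p(v := z)) x - (p(v := z)) y) \<bullet> ((u(v := w)) x - (u(v := w)) y) = c {x, y} k"
    proof cases
      case 1
      then show ?thesis using u xy by simp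
    next
      case 2
      then show ?thesis using w xy by simp
    next
      case 3
      then have "edge_dir q k (z - p x) \<bullet> (w - u x) = c {v, x} k" using w xy by (simp add: insert_commute)
      then show ?thesis using 3 edge_dir_commute[of q k "p x" z "u x" w] by (simp add: insert_commute)
    qed
  qed
qed

text \<open>Two constraints in independent directions determine the velocity of the new vertex. They
  are labelled by neighbour and copy, so \<open>a = b\<close> with different copies covers a double
  edge.\<close>

lemma solvable_extend_2:
  assumes sol: "solvable q p (delete_vertex v m)"
    and cov: "\<And>w k. w \<noteq> v \<Longrightarrow> k < m {v, w} \<Longrightarrow> (w, k) \<in> {(a, i), (b, j)}"
    and cr: "cross2 (edge_dir q i (z - p a)) (edge_dir q j (z - p b)) \<noteq> 0"
  shows "solvable q (p(v := z)) m"
proof (rule solvable_extendI)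
  fix c :: "'a set \<Rightarrow> nat \<Rightarrow> real"
  obtain u where u: "\<And>x y k. x \<noteq> y \<Longrightarrow> k < delete_vertex v m {x, y} \<Longrightarrow>
      edge_rate q k p u x y = c {x, y} k"
    using sol unfolding solvable_def by blast
  obtain w where w: "edge_dir q i (z - p a) \<bullet> w = c {v, a} i + edge_dir q i (z - p a) \<bullet> u a"
      "edge_dir q j (z - p b) \<bullet> w = c {v, b} j + edge_dir q j (z - p b) \<bullet> u b"
    using cross2_solve[OF cr] by blast
  show "\<exists>u w. (\<forall>x y k. x \<noteq> y \<and> x \<noteq> v \<and> y \<noteq> v \<and> k < m {x, y} \<longrightarrow>
        edge_rate q k p u x y = c {x, y} k) \<and>
      (\<forall>y k. y \<noteq> v \<and> k < m {v, y} \<longrightarrow> edge_dir q k (z - p y) \<bullet> (w - u y) = c {v, y} k)"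
  proof (intro exI[of _ u] exI[of _ w] conjI allI impI)
    fix x y k assume "x \<noteq> y \<and> x \<noteq> v \<and> y \<noteq> v \<and> k < m {x, y}"
    then show "edge_rate q k p u x y = c {x, y} k"
      using u[of x y k] by (simp add: delete_vertex_pair)
  next
    fix y k assume "y \<noteq> v \<and> k < m {v, y}"
    then have "(y, k) = (a, i) \<or> (y, k) = (b, j)" using cov by blast
    then show "edge_dir q k (z - p y) \<bullet> (w - u y) = c {v, y} k"
      using w by (auto simp: inner_diff_right)
  qed
qed

text \<open>Three constraints exceed the two velocity components by one; a multiple of the flex
  \<open>f\<close>, which leaves the old constraints alone, supplies the missing unknown.\<close>

lemma solvable_extend_3:
  assumes sol: "solvable q p (delete_vertex v m)"
    and flex: "\<And>x y k. x \<noteq> y \<Longrightarrow> k < delete_vertex v m {x, y} \<Longrightarrow> edge_rate q k p f x y = 0"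
    and cov: "\<And>w k. w \<noteq> v \<Longrightarrow> k < m {v, w} \<Longrightarrow> (w, k) \<in> {(a, i), (b, j), (d, h)}"
    and A: "A = edge_dir q i (z - p a)" and B: "B = edge_dir q j (z - p b)" and C: "C = edge_dir q h (z - p d)"
    and D: "(A \<bullet> f a) * cross2 B C + (B \<bullet> f b) * cross2 C A + (C \<bullet> f d) * cross2 A B \<noteq> 0"
  shows "solvable q (p(v := z)) m"
proof (rule solvable_extendI)
  fix c :: "'a set \<Rightarrow> nat \<Rightarrow> real"
  obtain u where u: "\<And>x y k. x \<noteq> y \<Longrightarrow> k < delete_vertex v m {x, y} \<Longrightarrow>
      edge_rate q k p u x y = c {x, y} k"
    using sol unfolding solvable_def by blast
  obtain w t where w: "A \<bullet> w - t * (A \<bullet> f a) = c {v, a} i + A \<bullet> u a"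
      "B \<bullet> w - t * (B \<bullet> f b) = c {v, b} j + B \<bullet> u b" "C \<bullet> w - t * (C \<bullet> f d) = c {v, d} h + C \<bullet> u d"
    using ext_solve[OF D] by blast
  show "\<exists>u w. (\<forall>x y k. x \<noteq> y \<and> x \<noteq> v \<and> y \<noteq> v \<and> k < m {x, y} \<longrightarrow>
        edge_rate q k p u x y = c {x, y} k) \<and>
      (\<forall>y k. y \<noteq> v \<and> k < m {v, y} \<longrightarrow> edge_dir q k (z - p y) \<bullet> (w - u y) = c {v, y} k)"
  proof (intro exI[of _ "\<lambda>x. u x + t *\<^sub>R f x"] exI[of _ w] conjI allI impI)
    fix x y k assume *: "x \<noteq> y \<and> x \<noteq> v \<and> y \<noteq> v \<and> k < m {x, y}"
    then have k: "k < delete_vertex v m {x, y}" by (simp add: delete_vertex_pair)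
    have dif: "u x + t *\<^sub>R f x - (u y + t *\<^sub>R f y) = (u x - u y) + t *\<^sub>R (f x - f y)"
      by (simp add: algebra_simps)
    show "edge_dir q k (p x - p y) \<bullet> (u x + t *\<^sub>R f x - (u y + t *\<^sub>R f y)) = c {x, y} k"
      using u[OF _ k] flex[OF _ k] * by (simp only: dif inner_add_right inner_scaleR_right) simp
  next
    fix y k assume "y \<noteq> v \<and> k < m {v, y}"
    then have "(y, k) = (a, i) \<or> (y, k) = (b, j) \<or> (y, k) = (d, h)" using cov by blast
    then show "edge_dir q k (z - p y) \<bullet> (w - (u y + t *\<^sub>R f y)) = c {v, y} k"
      using w unfolding A B C by (auto simp: inner_diff_right inner_add_right)
  qed
qed

text \<open>The right-hand side is 1 at the new copy and 0 elsewhere. That copy has index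
  \<open>m {a, b}\<close>, since copies are numbered from zero.\<close>

lemma solvable_add_edge_flex:
  assumes "solvable q p (add_edge {a, b} m)" "a \<noteq> b"
  obtains f where "\<And>x y k. x \<noteq> y \<Longrightarrow> k < m {x, y} \<Longrightarrow> edge_rate q k p f x y = 0"
    "edge_dir q (m {a, b}) (p a - p b) \<bullet> (f a - f b) = 1"
proof -
  obtain f where f: "\<And>v w k. v \<noteq> w \<Longrightarrow> k < add_edge {a, b} m {v, w} \<Longrightarrow>
     edge_rate q k p f v w = of_bool ({v, w} = {a, b} \<and> k = m {a, b})"
    using assms(1)[unfolded solvable_def, rule_format, of "\<lambda>e k. of_bool (e = {a, b} \<and> k = m {a, b})"] by blast
  show thesis
  proof (rule that)
    show "edge_dir q (m {a, b}) (p a - p b) \<bullet> (f a - f b) = 1"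
      using f[of a b "m {a, b}"] assms(2) by (simp add: add_edge_def)
    fix x y k assume *: "x \<noteq> y" "k < m {x, y}"
    then have "k < add_edge {a, b} m {x, y}" by (auto simp: add_edge_def)
    from f[OF *(1) this] show "edge_rate q k p f x y = 0"
      using * by (auto simp: of_bool_def split: if_splits)
  qed
qed

section \<open>Positions for a new vertex\<close>

lemma interval_avoiding_finite:
  fixes l h :: real
  assumes "finite A" "l < h"
  shows "\<exists>h'. l < h' \<and> h' \<le> h \<and> A \<inter> {l<..<h'} = {}"
proof -
  define h' where "h' = Min (insert h (A \<inter> {l<..}))"
  have fin: "finite (insert h (A \<inter> {l<..}))" using assms by simp
  have "h' \<in> insert h (A \<inter> {l<..})" unfolding h'_def by (rule Min_in[OF fin]) simp
  then have "l < h'" using assms by auto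
  moreover have "h' \<le> h" unfolding h'_def by (rule Min_le[OF fin]) simp
  moreover have "x \<notin> {l<..<h'}" if "x \<in> A" for x
    using Min_le[OF fin, of x] that unfolding h'_def by auto
  ultimately show ?thesis by blast
qed

text \<open>On such a box every coordinate difference to a point of \<open>P\<close> has constant
  sign and is nonzero.\<close>

lemma box_avoiding_coords:
  fixes t :: "real^2"
  assumes "finite P" "e > 0"
  obtains l1 h1 l2 h2 where "l1 < h1" "l2 < h2"
    "\<And>x. x \<in> P \<Longrightarrow> x $ 1 \<notin> {l1<..<h1} \<and> x $ 2 \<notin> {l2<..<h2}"
    "\<And>z. z $ 1 \<in> {l1<..<h1} \<Longrightarrow> z $ 2 \<in> {l2<..<h2} \<Longrightarrow> dist z t < e"
proof -
  obtain h1 where h1: "t$1 < h1" "h1 \<le> t$1 + e / 2" "(\<lambda>x. x $ 1) ` P \<inter> {t$1<..<h1} = {}"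
    using interval_avoiding_finite[of "(\<lambda>x. x $ 1) ` P" "t$1" "t$1 + e/2"] assms by auto
  obtain h2 where h2: "t$2 < h2" "h2 \<le> t$2 + e / 2" "(\<lambda>x. x $ 2) ` P \<inter> {t$2<..<h2} = {}"
    using interval_avoiding_finite[of "(\<lambda>x. x $ 2) ` P" "t$2" "t$2 + e/2"] assms by auto
  show thesis
  proof (rule that[OF h1(1) h2(1)])
    fix x assume "x \<in> P"
    then show "x $ 1 \<notin> {t$1<..<h1} \<and> x $ 2 \<notin> {t$2<..<h2}" using h1(3) h2(3) by blast
  next
    fix z :: "real^2" assume z: "z $ 1 \<in> {t$1<..<h1}" "z $ 2 \<in> {t$2<..<h2}"
    have "dist z t \<le> (\<Sum>i\<in>UNIV. \<bar>(z - t) $ i\<bar>)" unfolding dist_norm by (rule norm_le_l1_cart)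
    also have "\<dots> < e" using z h1(2) h2(2) by (auto simp: sum_2)
    finally show "dist z t < e" .
  qed
qed

lemma exists_inner_nonzero:
  fixes b d :: "real^2"
  assumes s: "s > 0" and lh: "l1 < h1" "l2 < h2" and d: "d \<noteq> 0"
  shows "\<exists>z. in_box l1 h1 l2 h2 z \<and> signed_power s (z - b) \<bullet> d \<noteq> 0"
proof (rule ccontr)
  assume con: "\<not> ?thesis"
  have zero: "spow s (x - b$1) * d$1 + spow s (y - b$2) * d$2 = 0"
    if "x \<in> {l1<..<h1}" "y \<in> {l2<..<h2}" for x y
  proof -
    have "(vector [x, y] :: real^2) $ 1 \<in> {l1<..<h1}" "(vector [x, y] :: real^2) $ 2 \<in> {l2<..<h2}"
      using that by auto
    then have "signed_power s (vector [x, y] - b) \<bullet> d = 0" using con by blast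
    then show ?thesis by (simp add: inner_2)
  qed
  obtain x1 x2 where x: "x1 \<in> {l1<..<h1}" "x2 \<in> {l1<..<h1}" "x1 < x2"
    using dense[OF lh(1)] by (metis dense greaterThanLessThan_iff order.strict_trans)
  obtain y1 y2 where y: "y1 \<in> {l2<..<h2}" "y2 \<in> {l2<..<h2}" "y1 < y2"
    using dense[OF lh(2)] by (metis dense greaterThanLessThan_iff order.strict_trans)
  have "spow s (x1 - b$1) * d$1 = spow s (x2 - b$1) * d$1"
    using zero[OF x(1) y(1)] zero[OF x(2) y(1)] by linarith
  then have "d$1 = 0" using x(3) by (auto simp: spow_eq_iff[OF s])
  moreover have "spow s (y1 - b$2) * d$2 = spow s (y2 - b$2) * d$2"
    using zero[OF x(1) y(1)] zero[OF x(1) y(2)] by linarith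
  then have "d$2 = 0" using y(3) by (auto simp: spow_eq_iff[OF s])
  ultimately show False using d by (simp add: vec_eq_2_iff)
qed

text \<open>\<open>spow\<close> is multiplicative and injective, so a vanishing cross product of the
  signed powers says that \<open>z\<close>, \<open>a\<close>, \<open>b\<close> are collinear, which
  cannot hold throughout a box.\<close>

lemma exists_cross2_nonzero:
  fixes a b :: "real^2"
  assumes s: "s > 0" and lh: "l1 < h1" "l2 < h2" and ab: "coords_differ a b"
  shows "\<exists>z. in_box l1 h1 l2 h2 z \<and>
    cross2 (signed_power s (z - a)) (signed_power s (z - b)) \<noteq> 0"
proof (rule ccontr)
  assume con: "\<not> ?thesis"
  have zero: "(x - a$1) * (y - b$2) = (y - a$2) * (x - b$1)"
    if "x \<in> {l1<..<h1}" "y \<in> {l2<..<h2}" for x y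
  proof -
    have "(vector [x, y] :: real^2) $ 1 \<in> {l1<..<h1}" "(vector [x, y] :: real^2) $ 2 \<in> {l2<..<h2}"
      using that by auto
    then have "cross2 (signed_power s (vector [x, y] - a)) (signed_power s (vector [x, y] - b)) = 0" using con by blast
    then have "spow s ((x - a$1) * (y - b$2)) = spow s ((y - a$2) * (x - b$1))"
      by (simp add: cross2_def spow_mult)
    then show ?thesis by (simp add: spow_eq_iff[OF s])
  qed
  obtain x where x: "x \<in> {l1<..<h1}" using dense[OF lh(1)] by auto
  obtain y1 y2 where y: "y1 \<in> {l2<..<h2}" "y2 \<in> {l2<..<h2}" "y1 < y2"
    using dense[OF lh(2)] by (metis dense greaterThanLessThan_iff order.strict_trans)
  have "(a$1 - b$1) * (y1 - y2) = 0"
    using zero[OF x y(1)] zero[OF x y(2)] by (simp add: algebra_simps)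
  then show False using ab y(3) by (simp add: coords_differ_def)
qed

text \<open>The count on two vertices: at most a simple edge for \<open>l = 3\<close>, a double edge
  for \<open>l = 2\<close>.\<close>

lemma msparse_multiplicity:
  assumes "msparse l m" "a \<noteq> b"
  shows "m {a, b} + l \<le> 4"
proof -
  have "edge_count m {a, b} = m {a, b}"
    using edge_count_insert[of "{b}" a m] assms(2) by (simp add: edge_count_card_le_1)
  then show ?thesis using msparseD[OF assms(1), of "{a, b}"] assms(2) by simp
qed

abbreviation general_on :: "'a set \<Rightarrow> ('a \<Rightarrow> real^2) \<Rightarrow> bool" where
  "general_on V p \<equiv> \<forall>v\<in>V. \<forall>w\<in>V. v \<noteq> w \<longrightarrow> coords_differ (p v) (p w)"

text \<open>Induction on the number of vertices, with general position carried along because the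
  determinant lemmas require it of the earlier points. Old vertices keep their positions when one is
  added, so closeness is preserved.\<close>

lemma exists_solvable_near:
  fixes p :: "'a \<Rightarrow> real^2"
  assumes q: "1 < q" and l: "l = (if q = 2 then 3 else 2)" and e: "e > 0"
    and "finite V" "supported V m" "msparse l m"
  shows "\<exists>p'. (\<forall>v. dist (p' v) (p v) < e) \<and> solvable q p' m \<and>
    (general_on V p')"
  using assms(4-6)
proof (induction "card V" arbitrary: V m)
  case 0
  then have "V = {}" by simp
  with 0 have "m e = 0" for e by (auto simp: supported_def pairs_def)
  then have "solvable q p m" by (simp add: solvable_def)
  with \<open>V = {}\<close> e show ?case by (intro exI[of _ p]) auto
next
  case (Suc n)
  have l0: "l > 0" "l = 2 \<or> l = 3" by (simp_all add: l)
  have s0: "q - 1 > 0" using q by simp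
  have "V \<noteq> {}" using Suc by auto
  then obtain v where v: "v \<in> V" "(\<Sum>w\<in>V - {v}. m {v, w}) \<le> 3"
    using exists_low_degree[OF Suc.prems(1) _ Suc.prems(3) l0(1)] by blast
  define W where "W = V - {v}"
  have W: "finite W" "n = card W" "v \<notin> W" "V = insert v W"
    using Suc.hyps(2) Suc.prems(1) v(1) by (auto simp: W_def)
  have mv: "w \<in> W" if "w \<noteq> v" "k < m {v, w}" for w k
    using supported_pairE[OF Suc.prems(2) that(2)] that(1) by (auto simp: W_def)
  have supW: "supported W (delete_vertex v m)"
    unfolding W_def by (rule supported_delete_vertex[OF Suc.prems(2)])
  \<comment> \<open>Reduces the induction step to finding a position in an arbitrary box that avoids
    the coordinates of the earlier points.\<close>
  have main: ?case
    if p': "\<forall>v. dist (p' v) (p v) < e" "general_on W p'"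
      and ex: "\<And>l1 h1 l2 h2. l1 < h1 \<Longrightarrow> l2 < h2 \<Longrightarrow>
        (\<And>x. x \<in> W \<Longrightarrow> p' x $ 1 \<notin> {l1<..<h1} \<and> p' x $ 2 \<notin> {l2<..<h2}) \<Longrightarrow>
        \<exists>z. in_box l1 h1 l2 h2 z \<and> solvable q (p'(v := z)) m" for p'
  proof -
    have "finite (p' ` W)" using W(1) by simp
    then obtain l1 h1 l2 h2 where b: "l1 < h1" "l2 < h2"
      "\<And>x. x \<in> p' ` W \<Longrightarrow> x $ 1 \<notin> {l1<..<h1} \<and> x $ 2 \<notin> {l2<..<h2}"
      "\<And>z. z $ 1 \<in> {l1<..<h1} \<Longrightarrow> z $ 2 \<in> {l2<..<h2} \<Longrightarrow> dist z (p v) < e"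
      using box_avoiding_coords[OF _ e, of "p' ` W" "p v"] by metis
    have b3: "p' x $ 1 \<notin> {l1<..<h1} \<and> p' x $ 2 \<notin> {l2<..<h2}" if "x \<in> W" for x using b(3) that by blast
    obtain z where z: "z $ 1 \<in> {l1<..<h1}" "z $ 2 \<in> {l2<..<h2}" "solvable q (p'(v := z)) m"
      using ex[OF b(1,2) b3] by blast
    have zW: "coords_differ z (p' x)" if "x \<in> W" for x
      using b3[OF that] z(1,2) by (auto simp: coords_differ_def)
    show ?thesis
    proof (intro exI[of _ "p'(v := z)"] conjI allI ballI impI)
      show "solvable q (p'(v := z)) m" by (rule z)
      show "dist ((p'(v := z)) x) (p x) < e" for x
        using p'(1) b(4)[OF z(1,2)] by simp
      fix x y assume "x \<in> V" "y \<in> V" "x \<noteq> y"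
      then show "coords_differ ((p'(v := z)) x) ((p'(v := z)) y)"
        using zW p'(2) W(3,4) by (auto intro: coords_differ_sym)
    qed
  qed
  show ?case
  proof (cases "(\<Sum>w\<in>V - {v}. m {v, w}) \<le> 2")
    case True
    obtain p' where p': "\<forall>v. dist (p' v) (p v) < e" "solvable q p' (delete_vertex v m)"
        "general_on W p'"
      using Suc.hyps(1)[OF W(2,1) supW msparse_delete_vertex[OF Suc.prems(3)]] by blast
    show ?thesis
    proof (rule main[OF p'(1,3)])
      fix l1 h1 l2 h2 :: real
      assume lh: "l1 < h1" "l2 < h2"
        and out: "\<And>x. x \<in> W \<Longrightarrow> p' x $ 1 \<notin> {l1<..<h1} \<and> p' x $ 2 \<notin> {l2<..<h2}"
      show "\<exists>z. in_box l1 h1 l2 h2 z \<and> solvable q (p'(v := z)) m"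
      proof (cases "W = {}")
        case True
        have "m e = 0" for e
          using Suc.prems(2) W(4) True pairs_card_le_1[of "{v}"] by (auto simp: supported_def)
        then have "solvable q p'' m" for p'' by (simp add: solvable_def)
        then show ?thesis
          using lh by (intro exI[of _ "vector [(l1 + h1) / 2, (l2 + h2) / 2]"]) auto
      next
        case False
        then obtain a b where ab: "a \<in> W" "b \<in> W"
          and cov: "\<And>w. w \<in> W \<Longrightarrow> m {v, w} \<le> of_bool (w = a) + of_bool (w = b)"
          using sum_le_2_cover[OF W(1) False, of "\<lambda>w. m {v, w}"] True by (auto simp: W_def)
        show ?thesis
        proof (cases "a = b")
          case True
          obtain z where z: "z $ 1 \<in> {l1<..<h1}" "z $ 2 \<in> {l2<..<h2}"
              "signed_power (q - 1) (z - p' a) \<bullet> axis 1 1 \<noteq> 0"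
            using exists_inner_nonzero[OF s0 lh, of "axis 1 1" "p' a"] by (auto simp: axis_eq_0_iff)
          define d where "d = signed_power (q - 1) (z - p' a)"
          have "d \<noteq> 0" using z(3) by (auto simp: d_def)
          then have "d $ 1 * d $ 1 + d $ 2 * d $ 2 \<noteq> 0"
            by (metis inner_2 inner_eq_zero_iff)
          then have "cross2 (edge_dir q 0 (z - p' a)) (edge_dir q 1 (z - p' a)) \<noteq> 0"
            by (simp add: edge_dir_def cross2_def flip: d_def)
          moreover have "(w, k) \<in> {(a, 0), (a, 1)}" if "w \<noteq> v" "k < m {v, w}" for w k
            using cov[OF mv[OF that]] that(2) True by (auto simp: of_bool_def split: if_splits)
          ultimately show ?thesis using z(1,2) solvable_extend_2[OF p'(2)] by blast
        next
          case False
          then have "coords_differ (p' a) (p' b)" using ab p'(3) by blast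
          then obtain z where z: "z $ 1 \<in> {l1<..<h1}" "z $ 2 \<in> {l2<..<h2}"
              "cross2 (signed_power (q - 1) (z - p' a)) (signed_power (q - 1) (z - p' b)) \<noteq> 0"
            using exists_cross2_nonzero[OF s0 lh] by blast
          have "cross2 (edge_dir q 0 (z - p' a)) (edge_dir q 0 (z - p' b)) \<noteq> 0"
            using z(3) by (simp add: edge_dir_def)
          moreover have "(w, k) \<in> {(a, 0), (b, 0)}" if "w \<noteq> v" "k < m {v, w}" for w k
            using cov[OF mv[OF that]] that(2) False by (auto simp: of_bool_def split: if_splits)
          ultimately show ?thesis using z(1,2) solvable_extend_2[OF p'(2)] by blast
        qed
      qed
    qed
  next
    case False
    with v(2) have "(\<Sum>w\<in>V - {v}. m {v, w}) = 3" by simp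
    from degree_three_reduction[OF Suc.prems(1) v(1) Suc.prems(2,3) l0(2) this, folded W_def]
    obtain a b c where abc: "a \<in> W" "b \<in> W" "c \<in> W" "a \<noteq> b"
      "\<And>w. w \<in> W \<Longrightarrow> m {v, w} = of_bool (w = a) + of_bool (w = b) + of_bool (w = c)"
      "msparse l (add_edge {a, b} (delete_vertex v m))" by blast
    define m0 where "m0 = delete_vertex v m"
    have "supported W (add_edge {a, b} m0)"
      unfolding m0_def by (rule supported_add_edge[OF supW]) (use abc in auto)
    from Suc.hyps(1)[OF W(2,1) this abc(6)[folded m0_def]]
    obtain p' where p': "\<forall>v. dist (p' v) (p v) < e" "solvable q p' (add_edge {a, b} m0)"
        "general_on W p'"
      by blast
    have sol0: "solvable q p' (delete_vertex v m)"
      unfolding m0_def[symmetric] by (rule solvable_mono[OF p'(2)]) (simp add: add_edge_def)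
    obtain f where f: "\<And>x y k. x \<noteq> y \<Longrightarrow> k < delete_vertex v m {x, y} \<Longrightarrow>
          edge_rate q k p' f x y = 0"
        "edge_dir q (m0 {a, b}) (p' a - p' b) \<bullet> (f a - f b) = 1"
      using solvable_add_edge_flex[OF p'(2) abc(4)] m0_def by metis
    have fab: "f a \<noteq> f b" using f(2) by auto
    \<comment> \<open>For \<open>q = 2\<close> double edges are excluded, so the added edge is a
      first copy and \<open>f\<close> changes the distance of \<open>a\<close> and \<open>b\<close>
      to first order. For other \<open>q\<close> it may be a second copy, and \<open>fab\<close>
      suffices.\<close>
    have stretch: "(p' a - p' b) \<bullet> (f a - f b) \<noteq> 0" if "q - 1 = 1"
    proof -
      have "l = 3" using that l by simp
      then have "m0 {a, b} = 0"
        using msparse_multiplicity[OF abc(6) abc(4)] by (simp add: add_edge_def m0_def)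
      moreover have "signed_power 1 x = x" for x :: "real^2" by (simp add: vec_eq_2_iff)
      ultimately show ?thesis using f(2) that by (simp add: edge_dir_def)
    qed
    \<comment> \<open>A double edge to \<open>x\<close>: its directions \<open>A\<close> and
      \<open>perp A\<close> are orthogonal, and the determinant factors as
      \<open>(A \<bullet> A) * (B \<bullet> (f y - f x))\<close>.\<close>
    have double: ?thesis
      if xy: "x \<in> W" "y \<in> W" "x \<noteq> y" "f x \<noteq> f y"
        and n: "\<And>w. w \<in> W \<Longrightarrow> m {v, w} = 2 * of_bool (w = x) + of_bool (w = y)" for x y
    proof (rule main[OF p'(1,3)])
      fix l1 h1 l2 h2 :: real
      assume lh: "l1 < h1" "l2 < h2"
        and out: "\<And>x. x \<in> W \<Longrightarrow> p' x $ 1 \<notin> {l1<..<h1} \<and> p' x $ 2 \<notin> {l2<..<h2}"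
      obtain z where z: "z $ 1 \<in> {l1<..<h1}" "z $ 2 \<in> {l2<..<h2}"
          "signed_power (q - 1) (z - p' y) \<bullet> (f y - f x) \<noteq> 0"
        using exists_inner_nonzero[OF s0 lh, of "f y - f x" "p' y"] xy(4) by auto
      define A where "A = signed_power (q - 1) (z - p' x)"
      define B where "B = signed_power (q - 1) (z - p' y)"
      have "A $ 1 \<noteq> 0" using out[OF xy(1)] z(1) by (auto simp: A_def)
      have "A \<noteq> 0" using \<open>A $ 1 \<noteq> 0\<close> by auto
      have "(A \<bullet> f x) * cross2 (perp A) B + (perp A \<bullet> f x) * cross2 B A + (B \<bullet> f y) * cross2 A (perp A)
        = (A \<bullet> A) * (B \<bullet> (f y - f x))"
        by (simp add: inner_2 cross2_def algebra_simps)
      then have D: "(A \<bullet> f x) * cross2 (perp A) B + (perp A \<bullet> f x) * cross2 B A + (B \<bullet> f y) * cross2 A (perp A) \<noteq> 0"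
        using \<open>A \<noteq> 0\<close> z(3) by (simp add: B_def)
      have cov: "(w, k) \<in> {(x, 0), (x, 1), (y, 0)}" if "w \<noteq> v" "k < m {v, w}" for w k
        using n[OF mv[OF that]] that(2) xy(3) by (auto simp: of_bool_def split: if_splits)
      have "solvable q (p'(v := z)) m"
        by (rule solvable_extend_3[OF sol0 f(1) cov _ _ _ D]) (simp_all add: A_def B_def edge_dir_def)
      with z show "\<exists>z. in_box l1 h1 l2 h2 z \<and> solvable q (p'(v := z)) m" by blast
    qed
    show ?thesis
    proof (cases "c = a \<or> c = b")
      case True
      then show ?thesis
      proof
        assume "c = a"
        then show ?thesis using abc fab by (intro double[of a b]) auto
      next
        assume "c = b"
        then show ?thesis using abc fab by (intro double[of b a]) auto
      qed
    next
      case False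
      show ?thesis
      proof (rule main[OF p'(1,3)])
        fix l1 h1 l2 h2 :: real
        assume lh: "l1 < h1" "l2 < h2"
          and out: "\<And>x. x \<in> W \<Longrightarrow> p' x $ 1 \<notin> {l1<..<h1} \<and> p' x $ 2 \<notin> {l2<..<h2}"
        have "\<exists>z. in_box l1 h1 l2 h2 z \<and>
            ext_det (q - 1) z (p' a) (p' b) (p' c) (f a) (f b) (f c) \<noteq> 0"
          by (rule exists_ext_det_nonzero[OF s0 lh _ _ _ _ _ _ _ _ _ fab stretch])
             (use out abc False p'(3) in auto)
        then obtain z where z: "z $ 1 \<in> {l1<..<h1}" "z $ 2 \<in> {l2<..<h2}"
          and D: "ext_det (q - 1) z (p' a) (p' b) (p' c) (f a) (f b) (f c) \<noteq> 0" by blast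
        have cov: "(w, k) \<in> {(a, 0), (b, 0), (c, 0)}" if "w \<noteq> v" "k < m {v, w}" for w k
          using abc(5)[OF mv[OF that]] that(2) abc(4) False by (auto simp: of_bool_def split: if_splits)
        have "solvable q (p'(v := z)) m"
          by (rule solvable_extend_3[OF sol0 f(1) cov refl refl refl])
             (use D in \<open>simp_all add: ext_det_def edge_dir_def Let_def\<close>)
        with z show "\<exists>z. in_box l1 h1 l2 h2 z \<and> solvable q (p'(v := z)) m" by blast
      qed
    qed
  qed
qed

section \<open>Rows of the rigidity matrix\<close>

interpretation row_functional: vector_space_pair
  "\<lambda>c (f :: 'c \<Rightarrow> real) x. c * f x" "(*) :: real \<Rightarrow> real \<Rightarrow> real"
  by unfold_locales

definition functional :: "(('c \<Rightarrow> real) \<Rightarrow> real) \<Rightarrow> bool" where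
  "functional h \<longleftrightarrow> (\<forall>f g. h (f + g) = h f + h g) \<and> (\<forall>c f. h (\<lambda>x. c * f x) = c * h f)"

lemma functional_zero: "functional h \<Longrightarrow> h 0 = 0"
  by (metis add.right_neutral add_left_cancel functional_def)

lemma functional_vanishes_on_span:
  assumes "functional h" "\<And>b. b \<in> B \<Longrightarrow> h b = 0" "x \<in> row_space.span B"
  shows "h x = 0"
proof -
  have "row_space.subspace {r. h r = 0}"
    using assms(1) functional_zero[OF assms(1)]
    by (auto intro!: row_space.subspaceI simp: functional_def)
  then have "row_space.span B \<subseteq> {r. h r = 0}"
    using assms(2) by (intro row_space.span_minimal) auto
  with assms(3) show ?thesis by blast
qed

lemma functional_extend:
  assumes "row_space.independent B"
  shows "\<exists>h. functional h \<and> (\<forall>b\<in>B. h b = c b)"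
proof -
  obtain h where h: "Vector_Spaces.linear (\<lambda>c (f :: 'a \<Rightarrow> real) x. c * f x) (*) h" "\<forall>b\<in>B. h b = c b"
    using row_functional.linear_independent_extend[OF assms] by blast
  interpret h: Vector_Spaces.linear "\<lambda>c (f :: 'a \<Rightarrow> real) x. c * f x" "(*)" h by (rule h(1))
  have "functional h" unfolding functional_def by (simp add: h.add h.scale)
  with h(2) show ?thesis by blast
qed

text \<open>Purely algebraic, by extending a basis, hence valid for the infinitely many rows of an
  infinite graph.\<close>

lemma functional_separation:
  assumes "r \<notin> row_space.span B"
  shows "\<exists>h. functional h \<and> h r = 1 \<and> (\<forall>b\<in>B. h b = 0)"
proof -
  obtain C where C: "C \<subseteq> B" "row_space.independent C" "B \<subseteq> row_space.span C"
    using row_space.maximal_independent_subset by blast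
  then have r: "r \<notin> row_space.span C"
    using assms row_space.span_mono by blast
  then have "row_space.independent (insert r C)"
    using C(2) by (intro row_space.independent_insertI)
  from functional_extend[OF this, of "\<lambda>b. if b = r then 1 else 0"]
  obtain h where h: "functional h" "\<forall>b\<in>insert r C. h b = (if b = r then 1 else 0)"
    by blast
  have "h c = 0" if "c \<in> C" for c
    using h(2) that r row_space.span_base by fastforce
  then have "h b = 0" if "b \<in> B" for b
    using functional_vanishes_on_span[OF h(1)] C(3) that by blast
  with h show ?thesis by auto
qed

lemma independent_family_dual:
  assumes "\<And>i. i \<in> I \<Longrightarrow> \<exists>h. functional h \<and> h (R i) \<noteq> 0 \<and> (\<forall>j\<in>I. j \<noteq> i \<longrightarrow> h (R j) = 0)"
  shows "inj_on R I \<and> row_space.independent (R ` I)"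
proof
  show "inj_on R I"
    using assms by (intro inj_onI) metis
  show "row_space.independent (R ` I)"
    unfolding row_space.dependent_def
  proof safe
    fix i assume i: "i \<in> I" and sp: "R i \<in> row_space.span (R ` I - {R i})"
    obtain h where h: "functional h" "h (R i) \<noteq> 0" "\<forall>j\<in>I. j \<noteq> i \<longrightarrow> h (R j) = 0"
      using assms[OF i] by blast
    have "h (R i) = 0"
      by (rule functional_vanishes_on_span[OF h(1) _ sp]) (use h(3) in auto)
    with h(2) show False by simp
  qed
qed

lemma independent_span_eq:
  assumes "finite B" "row_space.independent A" "A \<subseteq> row_space.span B" "card B \<le> card A"
  shows "B \<subseteq> row_space.span A"
proof (rule ccontr)
  assume "\<not> ?thesis"
  then obtain b where b: "b \<in> B" "b \<notin> row_space.span A" by blast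
  have "row_space.independent (insert b A)"
    using b(2) assms(2) by (rule row_space.independent_insertI)
  moreover have "insert b A \<subseteq> row_space.span B"
    using assms(3) b(1) row_space.span_base by blast
  ultimately have "finite (insert b A) \<and> card (insert b A) \<le> card B"
    by (rule row_space.independent_span_bound[OF assms(1)])
  moreover have "b \<notin> A" using b(2) row_space.span_base by blast
  ultimately show False using assms(4) by auto
qed

definition pairing :: "'a set \<Rightarrow> ('a \<times> 2 \<Rightarrow> real) \<Rightarrow> ('a \<Rightarrow> real^2) \<Rightarrow> real" where
  "pairing S r u = (\<Sum>x\<in>S. \<Sum>i\<in>UNIV. r (x, i) * u x $ i)"

definition row_on :: "'a set \<Rightarrow> ('a \<times> 2 \<Rightarrow> real) \<Rightarrow> bool" where
  "row_on S r \<longleftrightarrow> (\<forall>x i. x \<notin> S \<longrightarrow> r (x, i) = 0)"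

definition unit_row :: "'a \<times> 2 \<Rightarrow> 'a \<times> 2 \<Rightarrow> real" where
  "unit_row y = (\<lambda>x. of_bool (x = y))"

definition dir_row :: "'a \<Rightarrow> 'a \<Rightarrow> real^2 \<Rightarrow> 'a \<times> 2 \<Rightarrow> real" where
  "dir_row v w d = (\<lambda>(x, i). if x = v then d $ i else if x = w then - (d $ i) else 0)"

lemma functional_pairing: "functional (\<lambda>r. pairing S r u)"
  by (simp add: functional_def pairing_def distrib_right sum.distrib sum_distrib_left mult.assoc)

text \<open>The velocities are read off on unit rows without reference to a finite vertex set, so
  one functional yields a single motion of the entire graph.\<close>

definition functional_flex :: "(('a \<times> 2 \<Rightarrow> real) \<Rightarrow> real) \<Rightarrow> 'a \<Rightarrow> real^2" where
  "functional_flex h x = (\<chi> i. h (unit_row (x, i)))"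

lemma functional_eq_pairing:
  assumes h: "functional h" and S: "finite S" and r: "row_on S r"
  shows "h r = pairing S r (functional_flex h)"
proof -
  have "h (\<lambda>y. if y \<in> A then r y else 0) = (\<Sum>y\<in>A. r y * h (unit_row y))" if "finite A" for A
    using that
  proof (induction A rule: finite_induct)
    case empty
    then show ?case using functional_zero[OF h] by (simp add: zero_fun_def)
  next
    case (insert z A)
    have "(\<lambda>y. if y \<in> insert z A then r y else 0) = (\<lambda>y. if y \<in> A then r y else 0) + (\<lambda>y. r z * unit_row z y)"
      using insert(2) by (auto simp: fun_eq_iff unit_row_def)
    then have "h (\<lambda>y. if y \<in> insert z A then r y else 0) = h (\<lambda>y. if y \<in> A then r y else 0) + r z * h (unit_row z)"
      using h by (simp only: functional_def)
    then show ?case using insert by simp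
  qed
  from this[of "S \<times> UNIV"] S have "h (\<lambda>y. if y \<in> S \<times> UNIV then r y else 0) = (\<Sum>y\<in>S \<times> UNIV. r y * h (unit_row y))"
    by simp
  also have "(\<lambda>y. if y \<in> S \<times> UNIV then r y else 0) = r"
    using r by (auto simp: row_on_def fun_eq_iff)
  finally show ?thesis
    by (simp add: pairing_def functional_flex_def sum.cartesian_product')
qed

lemma pairing_dir_row:
  assumes "finite S" "v \<in> S" "w \<in> S" "v \<noteq> w"
  shows "pairing S (dir_row v w d) u = d \<bullet> (u v - u w)"
proof -
  have "pairing S (dir_row v w d) u = (\<Sum>x\<in>S. (if x = v then d \<bullet> u v else 0) - (if x = w then d \<bullet> u w else 0))"
    unfolding pairing_def using assms(4)
    by (intro sum.cong) (auto simp: dir_row_def inner_2 sum_2)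
  also have "\<dots> = d \<bullet> u v - d \<bullet> u w"
    using assms by (simp add: sum_subtractf)
  finally show ?thesis by (simp add: inner_diff_right)
qed

lemma row_on_dir_row: "v \<in> S \<Longrightarrow> w \<in> S \<Longrightarrow> row_on S (dir_row v w d)"
  by (auto simp: row_on_def dir_row_def)

lemma dir_row_commute: "v \<noteq> w \<Longrightarrow> dir_row v w (- d) = dir_row w v d"
  by (auto simp: dir_row_def fun_eq_iff)

text \<open>An edge is an unordered pair; the choice of its orientation is immaterial because
  \<open>edge_dir\<close> is odd.\<close>

definition edge_row :: "real \<Rightarrow> ('a \<Rightarrow> real^2) \<Rightarrow> 'a set \<Rightarrow> nat \<Rightarrow> 'a \<times> 2 \<Rightarrow> real" where
  "edge_row q p e k = (SOME r. \<exists>v w. e = {v, w} \<and> v \<noteq> w \<and> r = dir_row v w (edge_dir q k (p v - p w)))"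

abbreviation edge_rows :: "real \<Rightarrow> ('a \<Rightarrow> real^2) \<Rightarrow> 'a set set \<Rightarrow> ('a \<times> 2 \<Rightarrow> real) set" where
  "edge_rows q p F \<equiv> (\<lambda>e. edge_row q p e 0) ` F"

lemma edge_row_eq:
  assumes "v \<noteq> w"
  shows "edge_row q p {v, w} k = dir_row v w (edge_dir q k (p v - p w))"
proof -
  have sym: "dir_row w v (edge_dir q k (p w - p v)) = dir_row v w (edge_dir q k (p v - p w))"
    using dir_row_commute[OF assms, of "edge_dir q k (p w - p v)"] edge_dir_minus[of q k "p w - p v"] by simp
  define P where "P r \<longleftrightarrow> (\<exists>x y. {v, w} = {x, y} \<and> x \<noteq> y \<and> r = dir_row x y (edge_dir q k (p x - p y)))" for r
  have "P (dir_row v w (edge_dir q k (p v - p w)))" using assms unfolding P_def by blast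
  then have "P (SOME r. P r)" by (rule someI[of P])
  moreover have "edge_row q p {v, w} k = (SOME r. P r)" by (simp add: edge_row_def P_def)
  ultimately obtain x y where xy: "{v, w} = {x, y}" "edge_row q p {v, w} k = dir_row x y (edge_dir q k (p x - p y))"
    unfolding P_def by metis
  from xy(1) have "x = v \<and> y = w \<or> x = w \<and> y = v" by (auto simp: doubleton_eq_iff)
  then show ?thesis using sym xy(2) by auto
qed

lemma rigidity_row_eq:
  assumes "v \<noteq> w"
  shows "rigidity_row q p v w = edge_row q p {v, w} 0"
  unfolding edge_row_eq[OF assms] rigidity_row_def dir_row_def edge_dir_def by simp

lemma rigidity_rows_eq:
  assumes "edges G \<subseteq> pairs V"
  shows "{rigidity_row q p v w | v w. {v, w} \<in> edges G} = edge_rows q p (edges G)"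
proof (rule set_eqI)
  fix r
  have ne: "v \<noteq> w" if "{v, w} \<in> edges G" for v w
    using subsetD[OF assms that] by simp
  have "r = rigidity_row q p v w \<and> {v, w} \<in> edges G \<longleftrightarrow> r = edge_row q p {v, w} 0 \<and> {v, w} \<in> edges G" for v w
    using ne[of v w] rigidity_row_eq[of v w q p] by auto
  then have "r \<in> {rigidity_row q p v w | v w. {v, w} \<in> edges G} \<longleftrightarrow>
      (\<exists>v w. r = edge_row q p {v, w} 0 \<and> {v, w} \<in> edges G)"
    by (simp only: mem_Collect_eq)
  also have "\<dots> \<longleftrightarrow> (\<exists>e\<in>edges G. r = edge_row q p e 0)"
  proof
    assume "\<exists>e\<in>edges G. r = edge_row q p e 0"
    then obtain e where e: "e \<in> edges G" "r = edge_row q p e 0" by blast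
    from subsetD[OF assms e(1)] obtain v w where "e = {v, w}" by (rule pairsE)
    with e show "\<exists>v w. r = edge_row q p {v, w} 0 \<and> {v, w} \<in> edges G" by blast
  qed blast
  finally show "r \<in> {rigidity_row q p v w | v w. {v, w} \<in> edges G} \<longleftrightarrow> r \<in> edge_rows q p (edges G)"
    by (simp add: image_iff)
qed

lemma pairing_edge_row:
  assumes "finite S" "v \<in> S" "w \<in> S" "v \<noteq> w"
  shows "pairing S (edge_row q p {v, w} k) u = edge_rate q k p u v w"
  by (simp add: edge_row_eq[OF assms(4)] pairing_dir_row[OF assms])

lemma row_on_edge_row: "e \<in> pairs S \<Longrightarrow> row_on S (edge_row q p e k)"
  by (erule pairsE) (simp add: edge_row_eq row_on_dir_row)

section \<open>Trivial motions and their annihilator\<close>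

definition tight_const :: "real \<Rightarrow> nat" where
  "tight_const q = (if q = 2 then 3 else 2)"

text \<open>Translations, and for \<open>q = 2\<close> also rotations; \<open>tight_const q\<close>
  counts the free parameters.\<close>

definition trivial_on :: "real \<Rightarrow> ('a \<Rightarrow> real^2) \<Rightarrow> 'a set \<Rightarrow> ('a \<Rightarrow> real^2) \<Rightarrow> bool" where
  "trivial_on q p S u \<longleftrightarrow> (\<exists>a b. (q \<noteq> 2 \<longrightarrow> a = 0) \<and> (\<forall>v\<in>S. u v = a *\<^sub>R perp (p v) + b))"

lemma perp_diff: "perp (x - y) = perp x - perp y"
  by (simp add: vec_eq_2_iff)

lemma perp_eq_0_iff [simp]: "perp x = 0 \<longleftrightarrow> x = 0"
  by (auto simp: vec_eq_2_iff)

lemma perp_0 [simp]: "perp 0 = 0"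
  by simp

lemma inner_perp_self [simp]: "x \<bullet> perp x = 0"
  by (simp add: inner_2)

lemma signed_power_1 [simp]: "signed_power 1 (x :: real^2) = x"
  by (simp add: vec_eq_2_iff)

lemma trivial_on_kills_edge_row:
  assumes "finite S" "v \<in> S" "w \<in> S" "v \<noteq> w" "trivial_on q p S u"
  shows "pairing S (edge_row q p {v, w} 0) u = 0"
proof -
  from assms(5) obtain a b where ab: "q \<noteq> 2 \<longrightarrow> a = 0" "\<forall>v\<in>S. u v = a *\<^sub>R perp (p v) + b"
    unfolding trivial_on_def by blast
  have "u v - u w = a *\<^sub>R perp (p v - p w)"
    using ab(2) assms(2,3) by (simp add: perp_diff algebra_simps)
  then show ?thesis
    using ab(1) by (auto simp: pairing_edge_row[OF assms(1-4)] edge_dir_def)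
qed

text \<open>A basis of the annihilator of the trivial motions: a motion of \<open>S\<close> is trivial iff all its
  values are determined, in the obvious linear way, by the value at \<open>s0\<close> and, if \<open>q = 2\<close>, by
  one coordinate of the value at a second point \<open>s1\<close>.\<close>

lemma exists_trivial_annihilator_basis:
  fixes p :: "'a \<Rightarrow> real^2"
  assumes S: "finite S" and s0: "s0 \<in> S" and s1: "q = 2 \<Longrightarrow> s1 \<in> S \<and> p s1 \<noteq> p s0"
  obtains B where "finite B" "card B + tight_const q = 2 * card S" "row_space.independent B"
    "\<And>b. b \<in> B \<Longrightarrow> row_on S b"
    "\<And>u. (\<forall>b\<in>B. pairing S b u = 0) \<longleftrightarrow> trivial_on q p S u"
proof -
  \<comment> \<open>For \<open>q = 2\<close>, one coordinate of \<open>s1\<close> in which a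
    rotation about \<open>s0\<close> is visible. It serves as a parameter of the motion and is left
    out of the index set \<open>I\<close>.\<close>
  define X :: "('a \<times> 2) set" where "X = (if q = 2 then {(s1, SOME j. perp (p s1 - p s0) $ j \<noteq> 0)} else {})"
  define j where "j = (SOME j. perp (p s1 - p s0) $ j \<noteq> 0)"
  \<comment> \<open>A rotation moves coordinate \<open>y\<close>, relative to \<open>s0\<close>, by
    \<open>\<kappa> y\<close> times what it moves coordinate \<open>j\<close> of
    \<open>s1\<close>.\<close>
  define \<kappa> where "\<kappa> y = (if q = 2 then perp (p (fst y) - p s0) $ snd y / perp (p s1 - p s0) $ j else 0)" for y
  define I where "I = (S - {s0}) \<times> UNIV - X"
  define b where "b y = (\<lambda>z. unit_row y z - unit_row (s0, snd y) z - \<kappa> y * (unit_row (s1, j) z - unit_row (s0, j) z))" for y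
  have j: "perp (p s1 - p s0) $ j \<noteq> 0" if "q = 2"
  proof -
    have "perp (p s1 - p s0) \<noteq> 0" using s1[OF that] by simp
    then have "\<exists>j. perp (p s1 - p s0) $ j \<noteq> 0" by (simp add: vec_eq_iff)
    then show ?thesis unfolding j_def by (rule someI_ex)
  qed
  have X: "X = (if q = 2 then {(s1, j)} else {})" by (simp add: X_def j_def)
  have s10: "s1 \<noteq> s0" if "q = 2" using s1[OF that] by auto
  have finI: "finite I" using S by (simp add: I_def)
  have cardI: "card I + tight_const q = 2 * card S"
  proof -
    have XI: "X \<subseteq> (S - {s0}) \<times> UNIV" using s1 s10 by (auto simp: X)
    have "card I = card ((S - {s0}) \<times> (UNIV :: 2 set)) - card X"
      unfolding I_def by (rule card_Diff_subset[OF _ XI]) (simp add: X)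
    moreover have "card ((S - {s0}) \<times> (UNIV :: 2 set)) = (card S - 1) * 2"
      using S s0 by (simp add: card_cartesian_product)
    moreover have "card X = (if q = 2 then 1 else 0)" by (simp add: X)
    moreover have "card S \<ge> 1" using S s0 by (metis One_nat_def Suc_leI card_gt_0_iff empty_iff)
    moreover have "card S \<ge> 2" if "q = 2"
    proof -
      have "{s0, s1} \<subseteq> S" using s0 s1[OF that] by blast
      from card_mono[OF S this] s10[OF that] show ?thesis by simp
    qed
    ultimately show ?thesis by (auto simp: tight_const_def)
  qed
  have pair_unit: "pairing S (unit_row y) u = u (fst y) $ snd y" if "fst y \<in> S" for y u
  proof -
    have "(\<Sum>i\<in>UNIV. unit_row y (x, i) * u x $ i) = (if x = fst y then u x $ snd y else 0)" for x
    proof -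
      have "(\<Sum>i\<in>UNIV. unit_row y (x, i) * u x $ i)
          = (\<Sum>i\<in>UNIV. if i = snd y then (if x = fst y then u x $ snd y else 0) else 0)"
        by (intro sum.cong) (auto simp: unit_row_def prod_eq_iff)
      then show ?thesis by simp
    qed
    then have "pairing S (unit_row y) u = (\<Sum>x\<in>S. if x = fst y then u x $ snd y else 0)"
      by (simp add: pairing_def)
    then show ?thesis using S that by simp
  qed
  have pair_lin: "pairing S (\<lambda>z. f z - g z - c * (k z - k' z)) u
      = pairing S f u - pairing S g u - c * (pairing S k u - pairing S k' u)" for f g k k' c u
    by (simp add: pairing_def left_diff_distrib right_diff_distrib sum_subtractf sum_distrib_left mult.assoc)
  have pair_b: "pairing S (b y) u = u (fst y) $ snd y - u s0 $ snd y - \<kappa> y * (u s1 $ j - u s0 $ j)"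
    if "y \<in> I" for y u
  proof (cases "q = 2")
    case True
    have "fst y \<in> S" "s1 \<in> S" using that s1[OF True] by (auto simp: I_def)
    then show ?thesis using s0 by (simp only: b_def pair_lin) (simp add: pair_unit)
  next
    case False
    then have "b y = (\<lambda>z. unit_row y z - unit_row (s0, snd y) z - 0 * (unit_row y z - unit_row y z))"
      by (simp add: b_def \<kappa>_def)
    with False that s0 show ?thesis by (simp only: pair_lin) (auto simp: pair_unit I_def \<kappa>_def)
  qed
  have "inj_on b I \<and> row_space.independent (b ` I)"
  proof (rule independent_family_dual)
    fix y assume y: "y \<in> I"
    \<comment> \<open>A unit velocity in the single coordinate \<open>y\<close>; it vanishes at the
      parameters, so its pairings with the rows \<open>b z\<close> are Kronecker deltas.\<close>
    define u where "u x = (if x = fst y then axis (snd y) 1 else 0 :: real^2)" for x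
    have u0: "u s0 = 0" using y by (auto simp: u_def I_def)
    have u1: "\<kappa> z * u s1 $ j = 0" for z
      using y by (cases "q = 2") (auto simp: u_def I_def X \<kappa>_def axis_def prod_eq_iff)
    have "pairing S (b z) u = of_bool (z = y)" if "z \<in> I" for z
      unfolding pair_b[OF that] using u0 u1[of z] by (auto simp: u_def axis_def prod_eq_iff algebra_simps)
    then show "\<exists>h. functional h \<and> h (b y) \<noteq> 0 \<and> (\<forall>z\<in>I. z \<noteq> y \<longrightarrow> h (b z) = 0)"
      using y by (intro exI[of _ "\<lambda>r. pairing S r u"]) (auto simp: functional_pairing)
  qed
  then have inj: "inj_on b I" and ind: "row_space.independent (b ` I)" by auto
  show thesis
  proof (rule that[of "b ` I"])
    show "finite (b ` I)" using finI by simp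
    show "card (b ` I) + tight_const q = 2 * card S" using cardI card_image[OF inj] by simp
    show "row_space.independent (b ` I)" by (rule ind)
    show "row_on S r" if "r \<in> b ` I" for r
      using that s0 s1 by (cases "q = 2") (auto simp: row_on_def b_def unit_row_def I_def \<kappa>_def)
    show "(\<forall>r\<in>b ` I. pairing S r u = 0) \<longleftrightarrow> trivial_on q p S u" for u
    proof
      assume "\<forall>r\<in>b ` I. pairing S r u = 0"
      then have k: "u (fst y) $ snd y = u s0 $ snd y + \<kappa> y * (u s1 $ j - u s0 $ j)" if "y \<in> I" for y
        using pair_b[OF that, of u] that by auto
      define a where "a = (if q = 2 then (u s1 $ j - u s0 $ j) / perp (p s1 - p s0) $ j else 0)"
      have "u v $ i = u s0 $ i + a * perp (p v - p s0) $ i" if vS: "v \<in> S" for v i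
      proof -
        consider "v = s0" | "(v, i) \<in> X" "v \<noteq> s0" | "(v, i) \<in> I" using vS by (auto simp: I_def)
        then show ?thesis
        proof cases
          case 1
          then show ?thesis by simp
        next
          case 2
          have "q = 2" "v = s1" "i = j" using 2(1) by (auto simp: X split: if_splits)
          then show ?thesis using j by (simp add: a_def)
        next
          case 3
          from k[OF this] show ?thesis by (simp add: \<kappa>_def a_def)
        qed
      qed
      then have "u v = a *\<^sub>R perp (p v) + (u s0 - a *\<^sub>R perp (p s0))" if "v \<in> S" for v
        using that by (simp add: vec_eq_iff perp_diff algebra_simps)
      moreover have "q \<noteq> 2 \<longrightarrow> a = 0" by (simp add: a_def)
      ultimately show "trivial_on q p S u" unfolding trivial_on_def by blast
    next
      assume "trivial_on q p S u"
      then obtain a c where ac: "q \<noteq> 2 \<longrightarrow> a = 0" "\<forall>v\<in>S. u v = a *\<^sub>R perp (p v) + c"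
        unfolding trivial_on_def by blast
      have dif: "u v $ i - u s0 $ i = a * perp (p v - p s0) $ i" if "v \<in> S" for v i
        using ac(2) that s0 by (simp add: perp_diff algebra_simps)
      show "\<forall>r\<in>b ` I. pairing S r u = 0"
      proof safe
        fix v i assume vi: "(v, i) \<in> I"
        then have "v \<in> S" by (simp add: I_def)
        show "pairing S (b (v, i)) u = 0"
        proof (cases "q = 2")
          case True
          then show ?thesis using dif[OF \<open>v \<in> S\<close>, of i] dif[of s1 j] s1 j by (simp add: pair_b[OF vi] \<kappa>_def)
        next
          case False
          then show ?thesis using dif[OF \<open>v \<in> S\<close>, of i] ac(1) by (simp add: pair_b[OF vi] \<kappa>_def)
        qed
      qed
    qed
  qed
qed

text \<open>A row outside the span could be separated from \<open>B\<close> by a functional, that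
  is, by a motion; this motion would be trivial and yet not annihilated by the row.\<close>

lemma edge_row_in_annihilator_span:
  assumes S: "finite S" and B: "\<And>b. b \<in> B \<Longrightarrow> row_on S b"
    and triv: "\<And>u. (\<forall>b\<in>B. pairing S b u = 0) \<Longrightarrow> trivial_on q p S u" and e: "e \<in> pairs S"
  shows "edge_row q p e 0 \<in> row_space.span B"
proof (rule ccontr)
  assume "\<not> ?thesis"
  then obtain h where h: "functional h" "h (edge_row q p e 0) = 1" "\<forall>b\<in>B. h b = 0"
    using functional_separation by blast
  have "trivial_on q p S (functional_flex h)"
    using h(3) B functional_eq_pairing[OF h(1) S] by (intro triv) simp
  then have "pairing S (edge_row q p e 0) (functional_flex h) = 0"
    using e trivial_on_kills_edge_row[OF S] by (auto elim!: pairsE)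
  then show False
    using h(2) functional_eq_pairing[OF h(1) S row_on_edge_row[OF e]] by simp
qed

section \<open>Independence and sparsity of edge sets\<close>

definition edge_indicator :: "'a set set \<Rightarrow> 'a set \<Rightarrow> nat" where
  "edge_indicator F = (\<lambda>e. of_bool (e \<in> F))"

lemma supported_edge_indicator: "F \<subseteq> pairs S \<Longrightarrow> supported S (edge_indicator F)"
  by (auto simp: supported_def edge_indicator_def)

lemma edge_count_edge_indicator:
  assumes "finite S"
  shows "edge_count (edge_indicator F) S = card (F \<inter> pairs S)"
proof -
  have "edge_count (edge_indicator F) S = (\<Sum>e\<in>pairs S. if e \<in> F then 1 else 0)"
    unfolding edge_count_def edge_indicator_def by (intro sum.cong) auto
  also have "\<dots> = card (pairs S \<inter> F)"
    using assms by (simp add: sum.If_cases Int_def)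
  finally show ?thesis by (simp add: Int_commute)
qed

lemma solvable_if_independent_rows:
  fixes p :: "'a \<Rightarrow> real^2"
  assumes S: "finite S" and sup: "supported S m"
    and I: "I = {(e, k). e \<in> pairs S \<and> k < m e}"
    and inj: "inj_on (\<lambda>(e, k). edge_row q p e k) I"
    and ind: "row_space.independent ((\<lambda>(e, k). edge_row q p e k) ` I)"
  shows "solvable q p m"
  unfolding solvable_def
proof
  fix c :: "'a set \<Rightarrow> nat \<Rightarrow> real"
  let ?R = "\<lambda>(e, k). edge_row q p e k"
  obtain h where h: "functional h" "\<forall>r\<in>?R ` I. h r = case_prod c (the_inv_into I ?R r)"
    using functional_extend[OF ind, of "\<lambda>r. case_prod c (the_inv_into I ?R r)"] by blast
  show "\<exists>u. \<forall>v w k. v \<noteq> w \<and> k < m {v, w} \<longrightarrow> edge_rate q k p u v w = c {v, w} k"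
  proof (intro exI[of _ "functional_flex h"] allI impI)
    fix v w k assume vw: "v \<noteq> w \<and> k < m {v, w}"
    have vwS: "v \<in> S" "w \<in> S" using supported_pairE[OF sup] vw by blast+
    then have e: "{v, w} \<in> pairs S" "({v, w}, k) \<in> I" using vw by (auto simp: I)
    have "h (edge_row q p {v, w} k) = c {v, w} k"
      using bspec[OF h(2) imageI[OF e(2)]] the_inv_into_f_f[OF inj e(2)] by simp
    moreover have "h (edge_row q p {v, w} k) = pairing S (edge_row q p {v, w} k) (functional_flex h)"
      by (rule functional_eq_pairing[OF h(1) S row_on_edge_row[OF e(1)]])
    ultimately show "edge_dir q k (p v - p w) \<bullet> (functional_flex h v - functional_flex h w) = c {v, w} k"
      using vw by (simp add: pairing_edge_row[OF S vwS])
  qed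
qed

text \<open>Solutions for unit right-hand sides form a dual family; conversely a functional may be
  prescribed on independent rows. Injectivity is listed separately because the image set does not
  show repeated rows.\<close>

lemma solvable_edge_indicator_iff:
  fixes p :: "'a \<Rightarrow> real^2"
  assumes S: "finite S" and F: "F \<subseteq> pairs S"
  shows "solvable q p (edge_indicator F) \<longleftrightarrow>
    inj_on (\<lambda>e. edge_row q p e 0) F \<and> row_space.independent (edge_rows q p F)"
proof
  assume sol: "solvable q p (edge_indicator F)"
  show "inj_on (\<lambda>e. edge_row q p e 0) F \<and> row_space.independent (edge_rows q p F)"
  proof (rule independent_family_dual)
    fix e assume "e \<in> F"
    obtain u :: "'a \<Rightarrow> real^2" where u: "\<And>v w k. v \<noteq> w \<Longrightarrow> k < edge_indicator F {v, w} \<Longrightarrow>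
        edge_rate q k p u v w = of_bool ({v, w} = e)"
      using sol[unfolded solvable_def, rule_format, of "\<lambda>f k. of_bool (f = e)"] by blast
    have "pairing S (edge_row q p f 0) u = of_bool (f = e)" if f: "f \<in> F" for f
    proof -
      from subsetD[OF F f] obtain v w where vw: "f = {v, w}" "v \<noteq> w" "v \<in> S" "w \<in> S" by (rule pairsE)
      have "0 < edge_indicator F {v, w}" using f vw(1) by (simp add: edge_indicator_def)
      from u[OF vw(2) this] show ?thesis
        unfolding vw(1) by (simp add: pairing_edge_row[OF S vw(3,4,2)])
    qed
    then show "\<exists>h. functional h \<and> h (edge_row q p e 0) \<noteq> 0 \<and> (\<forall>f\<in>F. f \<noteq> e \<longrightarrow> h (edge_row q p f 0) = 0)"
      using \<open>e \<in> F\<close> by (intro exI[of _ "\<lambda>r. pairing S r u"] conjI functional_pairing) auto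
  qed
next
  assume "inj_on (\<lambda>e. edge_row q p e 0) F \<and> row_space.independent (edge_rows q p F)"
  moreover define I where "I = (\<lambda>e. (e, 0 :: nat)) ` F"
  ultimately have "inj_on (\<lambda>(e, k). edge_row q p e k) I" "row_space.independent ((\<lambda>(e, k). edge_row q p e k) ` I)"
    by (simp_all add: inj_on_def image_image)
  moreover have "I = {(e, k). e \<in> pairs S \<and> k < edge_indicator F e}"
    using F by (auto simp: I_def edge_indicator_def of_bool_def split: if_splits)
  ultimately show "solvable q p (edge_indicator F)"
    using solvable_if_independent_rows[OF S supported_edge_indicator[OF F]] by blast
qed

definition flex_on :: "real \<Rightarrow> ('a \<Rightarrow> real^2) \<Rightarrow> 'a set set \<Rightarrow> ('a \<Rightarrow> real^2) \<Rightarrow> bool" where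
  "flex_on q p F u \<longleftrightarrow> (\<forall>v w. {v, w} \<in> F \<longrightarrow> signed_power (q - 1) (p v - p w) \<bullet> (u v - u w) = 0)"

lemma flex_on_iff_pairing:
  assumes S: "finite S" and F: "F \<subseteq> pairs S"
  shows "flex_on q p F u \<longleftrightarrow> (\<forall>e\<in>F. pairing S (edge_row q p e 0) u = 0)"
proof
  assume fl: "flex_on q p F u"
  show "\<forall>e\<in>F. pairing S (edge_row q p e 0) u = 0"
  proof
    fix e assume e: "e \<in> F"
    from subsetD[OF F e] obtain v w where vw: "e = {v, w}" "v \<noteq> w" "v \<in> S" "w \<in> S" by (rule pairsE)
    show "pairing S (edge_row q p e 0) u = 0"
      using fl e unfolding vw(1) flex_on_def pairing_edge_row[OF S vw(3,4,2)] by (simp add: edge_dir_def)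
  qed
next
  assume *: "\<forall>e\<in>F. pairing S (edge_row q p e 0) u = 0"
  show "flex_on q p F u"
    unfolding flex_on_def
  proof (intro allI impI)
    fix v w assume e: "{v, w} \<in> F"
    then have vw: "v \<in> S" "w \<in> S" "v \<noteq> w" using subsetD[OF F e] by auto
    from * e have "pairing S (edge_row q p {v, w} 0) u = 0" by blast
    then show "signed_power (q - 1) (p v - p w) \<bullet> (u v - u w) = 0"
      by (simp add: pairing_edge_row[OF S vw] edge_dir_def)
  qed
qed

abbreviation sparse_edges :: "real \<Rightarrow> 'a set set \<Rightarrow> bool" where
  "sparse_edges q F \<equiv> msparse (tight_const q) (edge_indicator F)"

text \<open>The rows of edges inside \<open>T\<close> lie in the annihilator of the trivial motions,
  of dimension \<open>2 * card T - tight_const q\<close>. Since \<open>p\<close> need not be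
  injective, an edge inside \<open>T\<close> supplies the two distinct points on which this
  dimension rests for \<open>q = 2\<close>.\<close>

lemma solvable_imp_msparse:
  fixes p :: "'a \<Rightarrow> real^2"
  assumes S: "finite S" and F: "F \<subseteq> pairs S" and ne: "\<And>v w. {v, w} \<in> F \<Longrightarrow> p v \<noteq> p w"
    and sol: "solvable q p (edge_indicator F)"
  shows "sparse_edges q F"
  unfolding msparse_def
proof (intro allI impI)
  fix T :: "'a set" assume T: "finite T \<and> 2 \<le> card T"
  let ?FT = "F \<inter> pairs T"
  show "edge_count (edge_indicator F) T + tight_const q \<le> 2 * card T"
  proof (cases "?FT = {}")
    case True
    then show ?thesis using T by (simp add: edge_count_edge_indicator tight_const_def)
  next
    case False
    then obtain e where "e \<in> F" "e \<in> pairs T" by blast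
    then obtain s0 s1 where s: "{s0, s1} \<in> F" "s0 \<in> T" "s1 \<in> T" by (auto elim: pairsE)
    have fT: "finite T" using T by simp
    obtain B where B: "finite B" "card B + tight_const q = 2 * card T" "\<And>b. b \<in> B \<Longrightarrow> row_on T b"
      "\<And>u. (\<forall>b\<in>B. pairing T b u = 0) \<longleftrightarrow> trivial_on q p T u"
      using exists_trivial_annihilator_basis[OF fT s(2), of q s1 p] s(3) ne[OF s(1)] by metis
    have sub: "edge_rows q p ?FT \<subseteq> row_space.span B"
      by (intro image_subsetI edge_row_in_annihilator_span[OF fT B(3) B(4)[THEN iffD1]]) auto
    have inj: "inj_on (\<lambda>e. edge_row q p e 0) F" and ind: "row_space.independent (edge_rows q p F)"
      using sol solvable_edge_indicator_iff[OF S F] by auto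
    have "row_space.independent (edge_rows q p ?FT)"
      by (rule row_space.independent_mono[OF ind]) auto
    from row_space.independent_span_bound[OF B(1) this sub]
    have "card ?FT \<le> card B"
      using card_image[OF inj_on_subset[OF inj, of ?FT]] by simp
    then show ?thesis using B(2) T by (simp add: edge_count_edge_indicator)
  qed
qed

lemma second_point:
  assumes "finite S" "s0 \<in> S" "inj_on p S" "2 \<le> card S"
  shows "\<exists>s1. s1 \<in> S \<and> p s1 \<noteq> p s0"
proof -
  have "\<not> S \<subseteq> {s0}"
    using assms(4) card_mono[of "{s0}" S] by auto
  then obtain s1 where "s1 \<in> S" "s1 \<noteq> s0" by blast
  with assms(2,3) show ?thesis by (auto dest: inj_onD)
qed

text \<open>The edge rows are independent and as many as the dimension of the annihilator that
  contains them, so they span it.\<close>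

lemma tight_imp_rigid:
  fixes p :: "'a \<Rightarrow> real^2"
  assumes S: "finite S" and inj: "inj_on p S" and F: "F \<subseteq> pairs S" and sol: "solvable q p (edge_indicator F)"
    and t: "card F + tight_const q = 2 * card S" and fl: "flex_on q p F u"
  shows "trivial_on q p S u"
proof -
  have "S \<noteq> {}" using t by (auto simp: tight_const_def split: if_splits)
  then obtain s0 where s0: "s0 \<in> S" by blast
  have "2 \<le> card S" if "q = 2" using t that by (simp add: tight_const_def)
  then have "\<exists>s1. q = 2 \<longrightarrow> s1 \<in> S \<and> p s1 \<noteq> p s0"
    using second_point[OF S s0 inj] by blast
  then obtain s1 where s1: "q = 2 \<Longrightarrow> s1 \<in> S \<and> p s1 \<noteq> p s0" by blast
  obtain B where B: "finite B" "card B + tight_const q = 2 * card S" "\<And>b. b \<in> B \<Longrightarrow> row_on S b"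
      "\<And>u. (\<forall>b\<in>B. pairing S b u = 0) \<longleftrightarrow> trivial_on q p S u"
    using exists_trivial_annihilator_basis[OF S s0 s1] by metis
  let ?R = "edge_rows q p F"
  have sub: "?R \<subseteq> row_space.span B"
    using F by (intro image_subsetI edge_row_in_annihilator_span[OF S B(3) B(4)[THEN iffD1]]) auto
  have "card ?R = card F" and ind: "row_space.independent ?R"
    using sol solvable_edge_indicator_iff[OF S F] by (auto simp: card_image)
  then have BR: "B \<subseteq> row_space.span ?R"
    using t B(2) by (intro independent_span_eq[OF B(1) ind sub]) simp
  have "pairing S r u = 0" if "r \<in> ?R" for r
    using fl that flex_on_iff_pairing[OF S F] by blast
  then have "pairing S b u = 0" if "b \<in> B" for b
    using functional_vanishes_on_span[OF functional_pairing] BR that by blast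
  then show ?thesis using B(4) by blast
qed

text \<open>Rigidity puts the whole annihilator of the trivial motions into the span of the edge
  rows.\<close>

lemma rigid_imp_card_ge:
  fixes p :: "'a \<Rightarrow> real^2"
  assumes S: "finite S" "2 \<le> card S" and inj: "inj_on p S" and F: "F \<subseteq> pairs S"
    and rig: "\<And>u. flex_on q p F u \<Longrightarrow> trivial_on q p S u"
  shows "2 * card S \<le> card F + tight_const q"
proof -
  obtain s0 where s0: "s0 \<in> S" using S by fastforce
  obtain s1 where s1: "s1 \<in> S \<and> p s1 \<noteq> p s0" using second_point[OF S(1) s0 inj S(2)] by blast
  obtain B where B: "finite B" "card B + tight_const q = 2 * card S" "row_space.independent B"
      "\<And>b. b \<in> B \<Longrightarrow> row_on S b" "\<And>u. (\<forall>b\<in>B. pairing S b u = 0) \<longleftrightarrow> trivial_on q p S u"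
    using exists_trivial_annihilator_basis[OF S(1) s0 s1, where q = q] by metis
  let ?R = "edge_rows q p F"
  have finF: "finite F" using F S(1) finite_subset finite_pairs by blast
  have "B \<subseteq> row_space.span ?R"
  proof
    fix b assume b: "b \<in> B"
    show "b \<in> row_space.span ?R"
    proof (rule ccontr)
      assume "b \<notin> row_space.span ?R"
      then obtain h where h: "functional h" "h b = 1" "\<forall>r\<in>?R. h r = 0"
        using functional_separation by blast
      have "pairing S (edge_row q p e 0) (functional_flex h) = 0" if "e \<in> F" for e
        using h(3) that F functional_eq_pairing[OF h(1) S(1) row_on_edge_row[of e S q p 0]] by auto
      then have "trivial_on q p S (functional_flex h)"
        by (intro rig) (simp add: flex_on_iff_pairing[OF S(1) F])
      then have "pairing S b (functional_flex h) = 0" using B(5) b by blast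
      then show False using h(2) functional_eq_pairing[OF h(1) S(1) B(4)[OF b]] by simp
    qed
  qed
  then have "card B \<le> card ?R"
    using row_space.independent_span_bound[OF _ B(3)] finF by blast
  also have "\<dots> \<le> card F" by (rule card_image_le[OF finF])
  finally show ?thesis using B(2) by simp
qed

lemma edge_row_in_span_of_maximal:
  fixes p :: "'a \<Rightarrow> real^2"
  assumes S: "finite S" and E: "E \<subseteq> pairs S" and F: "F \<subseteq> E" and sol: "solvable q p (edge_indicator F)"
    and max: "\<And>e. e \<in> E \<Longrightarrow> e \<notin> F \<Longrightarrow> \<not> solvable q p (edge_indicator (insert e F))"
    and e: "e \<in> E"
  shows "edge_row q p e 0 \<in> row_space.span (edge_rows q p F)"
proof (cases "e \<in> F")
  case True
  then show ?thesis by (intro row_space.span_base) blast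
next
  case False
  show ?thesis
  proof (rule ccontr)
    assume n: "\<not> ?thesis"
    have FS: "F \<subseteq> pairs S" "insert e F \<subseteq> pairs S" using E F e by auto
    have ind: "inj_on (\<lambda>e. edge_row q p e 0) F" "row_space.independent (edge_rows q p F)"
      using sol solvable_edge_indicator_iff[OF S FS(1)] by auto
    have "edge_row q p e 0 \<notin> edge_rows q p F"
      using n row_space.span_base[of "edge_row q p e 0" "edge_rows q p F"] by (rule contrapos_nn)
    then have "inj_on (\<lambda>e. edge_row q p e 0) (insert e F)"
      using ind(1) False by simp
    moreover have "row_space.independent (edge_rows q p (insert e F))"
      using row_space.independent_insertI[OF n ind(2)] by simp
    ultimately have "solvable q p (edge_indicator (insert e F))"
      using solvable_edge_indicator_iff[OF S FS(2)] by blast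
    with max[OF e False] show False by blast
  qed
qed

section \<open>Generic placements\<close>

lemma sum_fun_apply: "(\<Sum>a\<in>A. f a :: 'b \<Rightarrow> 'c :: comm_monoid_add) x = (\<Sum>a\<in>A. f a x)"
  by (induction A rule: infinite_finite_induct) auto

lemma independent_family_if_no_relation:
  fixes R :: "'i \<Rightarrow> 'c \<Rightarrow> real"
  assumes I: "finite I" and no: "\<And>c. (\<Sum>j\<in>I. (\<lambda>x. c j * R j x)) = 0 \<Longrightarrow> \<forall>j\<in>I. c j = 0"
  shows "inj_on R I \<and> row_space.independent (R ` I)"
proof
  show inj: "inj_on R I"
  proof (rule inj_onI, rule ccontr)
    fix i j assume ij: "i \<in> I" "j \<in> I" "R i = R j" "i \<noteq> j"
    define c where "c k = (if k = i then 1 else if k = j then -1 else 0 :: real)" for k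
    have "(\<Sum>k\<in>I. c k * R k x) = (\<Sum>k\<in>I. (if k = i then R i x else 0) + (if k = j then - R i x else 0))" for x
      using ij by (intro sum.cong) (auto simp: c_def)
    also have "\<dots> x = 0" for x
      using I ij by (simp add: sum.distrib)
    finally have "(\<Sum>k\<in>I. (\<lambda>x. c k * R k x)) = 0"
      by (simp add: fun_eq_iff sum_fun_apply)
    from no[OF this] ij show False by (auto simp: c_def)
  qed
  show "row_space.independent (R ` I)"
  proof
    assume "row_space.dependent (R ` I)"
    then obtain u v where uv: "v \<in> R ` I" "u v \<noteq> 0" "(\<Sum>v\<in>R ` I. (\<lambda>x. u v * v x)) = 0"
      using I row_space.dependent_finite[of "R ` I"] by auto
    then have "(\<Sum>j\<in>I. (\<lambda>x. u (R j) * R j x)) = 0"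
      by (simp add: sum.reindex[OF inj])
    from no[of "\<lambda>j. u (R j)", OF this] uv(1,2) show False by auto
  qed
qed

text \<open>By diagonal dominance in the column of a coefficient of maximal absolute value.\<close>

lemma independent_family_near_dual:
  fixes R :: "'i \<Rightarrow> 'a \<times> 2 \<Rightarrow> real"
  assumes I: "finite I"
    and near: "\<And>i j. i \<in> I \<Longrightarrow> j \<in> I \<Longrightarrow> \<bar>pairing S (R j) (u i) - of_bool (j = i)\<bar> < 1 / (2 * real (card I))"
  shows "inj_on R I \<and> row_space.independent (R ` I)"
proof (rule independent_family_if_no_relation[OF I])
  fix c :: "'i \<Rightarrow> real" assume c: "(\<Sum>j\<in>I. (\<lambda>x. c j * R j x)) = 0"
  show "\<forall>j\<in>I. c j = 0"
  proof (rule ccontr)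
    assume nz: "\<not> ?thesis"
    then have ne: "I \<noteq> {}" by auto
    define M where "M = Max ((\<lambda>j. \<bar>c j\<bar>) ` I)"
    have "M \<in> (\<lambda>j. \<bar>c j\<bar>) ` I" unfolding M_def using I ne by (intro Max_in) auto
    then obtain i where i: "i \<in> I" "M = \<bar>c i\<bar>" by auto
    have le: "\<bar>c j\<bar> \<le> M" if "j \<in> I" for j unfolding M_def using I that by (intro Max_ge) auto
    have Mpos: "M > 0"
      using nz le by (metis abs_le_zero_iff le_less_trans not_le)
    have cI: "card I > 0" using I ne by (simp add: card_gt_0_iff)
    have lin: "pairing S (\<Sum>j\<in>J. (\<lambda>x. c j * R j x)) (u i) = (\<Sum>j\<in>J. c j * pairing S (R j) (u i))"
      if "finite J" for J
      using that
    proof (induction J rule: finite_induct)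
      case empty
      then show ?case by (simp add: pairing_def)
    next
      case (insert j J)
      have "pairing S ((\<lambda>x. c j * R j x) + (\<Sum>j\<in>J. (\<lambda>x. c j * R j x))) (u i)
        = c j * pairing S (R j) (u i) + pairing S (\<Sum>j\<in>J. (\<lambda>x. c j * R j x)) (u i)"
        using functional_pairing[of S "u i"] by (simp add: functional_def)
      then show ?case
        unfolding sum.insert[OF insert(1,2)] insert(3) .
    qed
    have "(\<Sum>j\<in>I. c j * pairing S (R j) (u i)) = 0"
      using lin[OF I] by (simp add: c) (simp add: pairing_def)
    moreover have "(\<Sum>j\<in>I. c j * pairing S (R j) (u i))
        = (\<Sum>j\<in>I. c j * of_bool (j = i)) + (\<Sum>j\<in>I. c j * (pairing S (R j) (u i) - of_bool (j = i)))"
      by (simp add: sum.distrib[symmetric] algebra_simps)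
    moreover have "(\<Sum>j\<in>I. c j * of_bool (j = i)) = c i"
    proof -
      have "(\<Sum>j\<in>I. c j * of_bool (j = i)) = (\<Sum>j\<in>I. if j = i then c j else 0)"
        by (intro sum.cong) auto
      then show ?thesis using I i(1) by simp
    qed
    ultimately have "M = \<bar>\<Sum>j\<in>I. c j * (pairing S (R j) (u i) - of_bool (j = i))\<bar>"
      using i(2) by linarith
    also have "\<dots> \<le> (\<Sum>j\<in>I. \<bar>c j * (pairing S (R j) (u i) - of_bool (j = i))\<bar>)"
      by (rule sum_abs)
    also have "\<dots> \<le> (\<Sum>j\<in>I. M * (1 / (2 * real (card I))))"
    proof (rule sum_mono)
      fix j assume j: "j \<in> I"
      show "\<bar>c j * (pairing S (R j) (u i) - of_bool (j = i))\<bar> \<le> M * (1 / (2 * real (card I)))"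
        unfolding abs_mult using le[OF j] less_imp_le[OF near[OF i(1) j]] Mpos by (intro mult_mono) auto
    qed
    also have "\<dots> = M / 2" using cI by simp
    finally show False using Mpos by simp
  qed
qed

section \<open>Openness and density of independence\<close>

lemma continuous_on_spow:
  assumes "s > 0" "continuous_on A f"
  shows "continuous_on A (\<lambda>x. spow s (f x))"
proof -
  have "spow s y = max y 0 powr s - max (- y) 0 powr s" for y
    by (cases y "0 :: real" rule: linorder_cases) (auto simp: spow_def max_def)
  then show ?thesis
    using assms by (auto intro!: continuous_intros continuous_on_powr')
qed

lemma continuous_on_edge_dir_nth:
  assumes "q > 1" "continuous_on A f"
  shows "continuous_on A (\<lambda>x. edge_dir q k (f x) $ i)"
proof -
  have c: "continuous_on A (\<lambda>x. spow (q - 1) (f x $ j))" for j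
    using assms by (intro continuous_on_spow continuous_intros) auto
  consider "i = 1" | "i = 2" using exhaust_2 by blast
  then show ?thesis
    by cases (cases "k = 0"; simp add: edge_dir_def c continuous_on_minus)+
qed

text \<open>Solutions at \<open>f0\<close> for the unit right-hand sides are kept as test motions.
  Their pairings with the rows form a matrix that depends continuously on the placement and is the
  identity at \<open>f0\<close>; nearby it is close enough to the identity for diagonal
  dominance.\<close>

lemma open_solvable:
  fixes m :: "'a set \<Rightarrow> nat" and idx :: "'a \<Rightarrow> nat"
  assumes q: "q > 1" and V: "finite V" and sup: "supported V m"
  shows "open {f :: nat \<Rightarrow> real^2. solvable q (\<lambda>v. f (idx v)) m}"
proof (subst open_subopen, safe)
  fix f0 :: "nat \<Rightarrow> real^2" assume sol: "solvable q (\<lambda>v. f0 (idx v)) m"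
  define I where "I = {(e, k). e \<in> pairs V \<and> k < m e}"
  have "I \<subseteq> Sigma (pairs V) (\<lambda>e. {..<m e})" by (auto simp: I_def)
  then have finI: "finite I" using V by (auto intro: finite_subset)
  have "\<exists>u :: 'a \<Rightarrow> real^2. \<forall>v w k. v \<noteq> w \<and> k < m {v, w} \<longrightarrow>
      edge_dir q k (f0 (idx v) - f0 (idx w)) \<bullet> (u v - u w) = of_bool (({v, w}, k) = i)" for i
    using sol[unfolded solvable_def, rule_format, of "\<lambda>e k. of_bool ((e, k) = i)"] by simp
  then obtain u :: "'a set \<times> nat \<Rightarrow> 'a \<Rightarrow> real^2" where u: "\<And>i v w k. v \<noteq> w \<Longrightarrow> k < m {v, w} \<Longrightarrow>
      edge_dir q k (f0 (idx v) - f0 (idx w)) \<bullet> (u i v - u i w) = of_bool (({v, w}, k) = i)"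
    by metis
  define A where "A f j i = pairing V (edge_row q (\<lambda>v. f (idx v)) (fst j) (snd j)) (u i)" for f j i
  define U where "U = (\<Inter>j\<in>I. \<Inter>i\<in>I. {f. \<bar>A f j i - of_bool (j = i)\<bar> < 1 / (2 * real (card I))})"
  have Aeq: "A f ({v, w}, k) i = edge_dir q k (f (idx v) - f (idx w)) \<bullet> (u i v - u i w)"
    if "{v, w} \<in> pairs V" for f v w k i
    using that V by (simp add: A_def pairing_edge_row)
  have contA: "continuous_on UNIV (\<lambda>f. A f j i)" if "j \<in> I" for i j
  proof -
    from that obtain e k where j: "j = (e, k)" "e \<in> pairs V" by (auto simp: I_def)
    from j(2) obtain v w where e: "e = {v, w}" by (rule pairsE)
    have "continuous_on UNIV (\<lambda>f :: nat \<Rightarrow> real^2. f (idx v) - f (idx w))"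
      by (intro continuous_intros continuous_on_product_coordinates)
    then show ?thesis
      using j(2) unfolding j(1) e
      by (simp add: Aeq inner_2) (intro continuous_on_add continuous_on_mult continuous_on_const
          continuous_on_edge_dir_nth[OF q])
  qed
  have "open U"
    unfolding U_def
    by (intro open_INT ballI finI open_Collect_less continuous_intros contA)
  moreover have "f0 \<in> U"
  proof -
    have "A f0 j i = of_bool (j = i)" if ji: "j \<in> I" "i \<in> I" for j i
    proof -
      from ji(1) obtain e k where j: "j = (e, k)" "e \<in> pairs V" "k < m e" by (auto simp: I_def)
      from j(2) obtain v w where e: "e = {v, w}" "v \<noteq> w" by (rule pairsE)
      show ?thesis using Aeq[of v w f0 k i] u[of v w k i] j e by simp
    qed
    moreover have "card I > 0" if "j \<in> I" for j using that finI by (auto simp: card_gt_0_iff)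
    ultimately show ?thesis by (auto simp: U_def)
  qed
  moreover have "U \<subseteq> {f. solvable q (\<lambda>v. f (idx v)) m}"
  proof safe
    fix f assume "f \<in> U"
    then have "inj_on (\<lambda>(e, k). edge_row q (\<lambda>v. f (idx v)) e k) I \<and>
        row_space.independent ((\<lambda>(e, k). edge_row q (\<lambda>v. f (idx v)) e k) ` I)"
      by (intro independent_family_near_dual[OF finI, where S = V and u = u])
         (auto simp: U_def A_def case_prod_beta)
    then show "solvable q (\<lambda>v. f (idx v)) m"
      using solvable_if_independent_rows[OF V sup I_def] by blast
  qed
  ultimately show "\<exists>T. open T \<and> f0 \<in> T \<and> T \<subseteq> {f. solvable q (\<lambda>v. f (idx v)) m}" by blast
qed

lemma dist_fun_le_uniform:
  fixes f g :: "nat \<Rightarrow> 'b :: metric_space"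
  assumes "\<And>n. dist (f n) (g n) \<le> d"
  shows "dist f g \<le> 2 * d"
proof -
  have s: "summable (\<lambda>n. (1/2 :: real) ^ n)" by (simp add: summable_geometric_iff)
  have "dist f g = (\<Sum>n. (1/2)^n * min (dist (f (from_nat n)) (g (from_nat n))) 1)"
    by (rule dist_fun_def)
  also have "\<dots> \<le> (\<Sum>n. (1/2)^n * d)"
  proof (rule suminf_le)
    show "summable (\<lambda>n. (1/2)^n * d)" using s by (rule summable_mult2)
    show "summable (\<lambda>n. (1/2)^n * min (dist (f (from_nat n)) (g (from_nat n))) 1)"
      by (rule summable_comparison_test'[OF s]) auto
    show "(1/2)^n * min (dist (f (from_nat n)) (g (from_nat n))) 1 \<le> (1/2)^n * d" for n
      using assms[of "from_nat n"] by (intro mult_left_mono) auto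
  qed
  also have "\<dots> = 2 * d" using suminf_mult2[OF s, of d] suminf_geometric[of "1/2 :: real"] by simp
  finally show ?thesis .
qed

text \<open>The approximation is uniform over all vertices, and \<open>from_nat_into V\<close>
  transports it to sequences. The bound \<open>e / 3\<close> absorbs the factor 2 from the weights
  of the product metric.\<close>

lemma dense_solvable:
  fixes m :: "'a set \<Rightarrow> nat"
  assumes q: "q > 1" and W: "finite W" "W \<subseteq> V" and sup: "supported W m" and sp: "msparse (tight_const q) m"
    and V: "countable V" "infinite V"
  shows "closure {f :: nat \<Rightarrow> real^2. solvable q (\<lambda>v. f (to_nat_on V v)) m} = UNIV"
proof -
  have "f \<in> closure {f :: nat \<Rightarrow> real^2. solvable q (\<lambda>v. f (to_nat_on V v)) m}" for f
    unfolding closure_approachable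
  proof (intro allI impI)
    fix e :: real assume e: "e > 0"
    have "\<exists>p'. (\<forall>v. dist (p' v) (f (to_nat_on V v)) < e / 3) \<and> solvable q p' m \<and>
        (general_on W p')"
      by (rule exists_solvable_near[OF q _ _ W(1) sup sp]) (use e in \<open>auto simp: tight_const_def\<close>)
    then obtain p' where p': "\<And>v. dist (p' v) (f (to_nat_on V v)) < e / 3" "solvable q p' m" by blast
    define g where "g n = p' (from_nat_into V n)" for n
    have "dist (g n) (f n) \<le> e / 3" for n
      using p'(1)[of "from_nat_into V n"] V by (simp add: g_def less_imp_le)
    then have "dist g f \<le> 2 * (e / 3)" by (rule dist_fun_le_uniform)
    then have "dist g f < e" using e by simp
    moreover have "solvable q (\<lambda>v. g (to_nat_on V v)) m"
      by (rule solvable_cong[OF sup _ p'(2)]) (use W(2) V in \<open>auto simp: g_def\<close>)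
    ultimately show "\<exists>g\<in>{f. solvable q (\<lambda>v. f (to_nat_on V v)) m}. dist g f < e" by blast
  qed
  then show ?thesis by blast
qed

lemma finite_pairs_element: "e \<in> pairs V \<Longrightarrow> finite e"
  by (auto elim: pairsE)

text \<open>The summand \<open>D\<close> allows an edge of \<open>F\<close> to be doubled, which is needed when \<open>q \<noteq> 2\<close> for pairs of
  vertices that are already joined.\<close>

definition ample :: "real \<Rightarrow> 'a set \<Rightarrow> ('a \<Rightarrow> real^2) \<Rightarrow> bool" where
  "ample q V p \<longleftrightarrow> (\<forall>F D. finite F \<longrightarrow> finite D \<longrightarrow> F \<subseteq> pairs V \<longrightarrow> D \<subseteq> pairs V \<longrightarrow>
     msparse (tight_const q) (\<lambda>e. edge_indicator F e + edge_indicator D e) \<longrightarrow>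
     solvable q p (\<lambda>e. edge_indicator F e + edge_indicator D e))"

text \<open>Placements of \<open>V\<close> are coded by sequences because the type \<open>'a\<close>
  itself may be uncountable, whereas sequences of plane points form a complete metric space.\<close>

lemma exists_ample:
  fixes V :: "'a set"
  assumes q: "q > 1" and V: "countable V" "infinite V"
  shows "\<exists>p :: 'a \<Rightarrow> real^2. ample q V p"
proof -
  let ?m = "\<lambda>F D e :: 'a set. edge_indicator F e + edge_indicator D e"
  let ?A = "\<lambda>m. {f :: nat \<Rightarrow> real^2. solvable q (\<lambda>v. f (to_nat_on V v)) m}"
  define \<F> where "\<F> = {F. finite F \<and> F \<subseteq> pairs V}"
  have "pairs V \<subseteq> {A. finite A \<and> A \<subseteq> V}"
    using finite_pairs_element by (auto simp: pairs_def)
  then have "countable (pairs V)"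
    using countable_Collect_finite_subset[OF V(1)] countable_subset by blast
  then have cF: "countable \<F>" unfolding \<F>_def by (rule countable_Collect_finite_subset)
  define M where "M = {m \<in> (\<lambda>(F, D). ?m F D) ` (\<F> \<times> \<F>). msparse (tight_const q) m}"
  have cM: "countable (?A ` M)"
    unfolding M_def using cF by (intro countable_image countable_subset[OF Collect_subset] countable_SIGMA)
  have props: "open (?A m) \<and> closure (?A m) = UNIV" if "m \<in> M" for m
  proof -
    from that obtain F D where FD: "finite F" "F \<subseteq> pairs V" "finite D" "D \<subseteq> pairs V" "m = ?m F D"
      and sp: "msparse (tight_const q) m" by (auto simp: M_def \<F>_def)
    define W where "W = \<Union>F \<union> \<Union>D"
    have W: "finite W" "W \<subseteq> V"
      using FD finite_pairs_element unfolding W_def by (blast, auto simp: pairs_def)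
    have "F \<subseteq> pairs W" "D \<subseteq> pairs W" using FD by (auto simp: pairs_def W_def)
    then have sup: "supported W m"
      unfolding FD(5) by (auto simp: supported_def edge_indicator_def)
    show ?thesis using open_solvable[OF q W(1) sup] dense_solvable[OF q W sup sp V] by blast
  qed
  have "(euclidean closure_of \<Inter>(?A ` M)) = topspace (euclidean :: (nat \<Rightarrow> real^2) topology)"
    by (rule Baire_category) (use cM props completely_metrizable_space_euclidean in auto)
  then have "\<Inter>(?A ` M) \<noteq> {}"
    by (metis UNIV_not_empty closure_of_empty topspace_euclidean)
  then obtain f where "\<And>m. m \<in> M \<Longrightarrow> solvable q (\<lambda>v. f (to_nat_on V v)) m" by auto
  then have "ample q V (\<lambda>v. f (to_nat_on V v))"
    unfolding ample_def M_def \<F>_def by (auto simp: image_iff)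
  then show ?thesis by blast
qed

section \<open>Sparse graphs and regularity\<close>

lemma simple_graph_iff: "simple_graph G \<longleftrightarrow> edges G \<subseteq> pairs (verts G)"
  by (auto simp: simple_graph_def pairs_def)

text \<open>A subgraph has at most the edges induced on its vertices. A set with fewer than two
  vertices in \<open>G\<close> contains no edge, and then \<open>l \<le> 4\<close> gives the
  bound.\<close>

lemma sparse_iff_msparse:
  assumes G: "simple_graph G" and l: "l \<le> 4"
  shows "sparse 2 l G \<longleftrightarrow> msparse l (edge_indicator (edges G))"
proof
  assume sp: "sparse 2 l G"
  show "msparse l (edge_indicator (edges G))"
    unfolding msparse_def
  proof (intro allI impI)
    fix S :: "'a set" assume S: "finite S \<and> 2 \<le> card S"
    define S' where "S' = S \<inter> verts G"
    have E: "edges G \<inter> pairs S = edges G \<inter> pairs S'"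
      using G unfolding simple_graph_iff S'_def pairs_Int by blast
    have cS: "card S' \<le> card S" using S unfolding S'_def by (intro card_mono) auto
    have "card (edges G \<inter> pairs S') + l \<le> 2 * card S"
    proof (cases "2 \<le> card S'")
      case True
      have "finite_subgraph (S', edges G \<inter> pairs S') G"
        using S by (auto simp: finite_subgraph_def subgraph_def simple_graph_iff S'_def)
      then have "int (card (edges G \<inter> pairs S')) \<le> int 2 * int (card S') - int l"
        using sp True unfolding sparse_def by fastforce
      then show ?thesis using cS by linarith
    next
      case False
      then have "pairs S' = {}" using S by (intro pairs_card_le_1) (auto simp: S'_def)
      then show ?thesis using S l by simp
    qed
    then show "edge_count (edge_indicator (edges G)) S + l \<le> 2 * card S"
      using S E by (simp add: edge_count_edge_indicator)
  qed
next
  assume sp: "msparse l (edge_indicator (edges G))"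
  show "sparse 2 l G"
    unfolding sparse_def
  proof (intro allI impI)
    fix H assume H: "finite_subgraph H G \<and> 2 \<le> card (verts H)"
    then have fin: "finite (verts H)" and E: "edges H \<subseteq> edges G \<inter> pairs (verts H)"
      by (auto simp: finite_subgraph_def subgraph_def simple_graph_iff)
    have "card (edges H) \<le> card (edges G \<inter> pairs (verts H))"
      using fin E by (intro card_mono) auto
    moreover have "card (edges G \<inter> pairs (verts H)) + l \<le> 2 * card (verts H)"
      using msparseD[OF sp fin] H fin by (simp add: edge_count_edge_indicator)
    ultimately show "int (card (edges H)) \<le> int 2 * int (card (verts H)) - int l" by linarith
  qed
qed

lemma tight_const_le_4: "tight_const q \<le> 4"
  by (simp add: tight_const_def)

lemma solvable_imp_card_le_rank:
  fixes p :: "'a \<Rightarrow> real^2"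
  assumes S: "finite S" and E: "edges H \<subseteq> pairs S" and F: "F \<subseteq> edges H"
    and sol: "solvable q p (edge_indicator F)"
  shows "card F \<le> rigidity_rank q H p"
proof -
  let ?R = "\<lambda>e. edge_row q p e 0"
  have FS: "F \<subseteq> pairs S" using E F by blast
  have finE: "finite (edges H)" using finite_subset[OF E finite_pairs[OF S]] .
  obtain B where B: "B \<subseteq> ?R ` edges H" "row_space.independent B" "?R ` edges H \<subseteq> row_space.span B"
      "card B = row_space.dim (?R ` edges H)"
    using row_space.basis_exists[of "?R ` edges H"] by metis
  have finB: "finite B" using B(1) finE finite_subset by blast
  have "inj_on ?R F" and ind: "row_space.independent (?R ` F)"
    using sol solvable_edge_indicator_iff[OF S FS] by auto
  then have "card F = card (?R ` F)" by (simp add: card_image)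
  also have "?R ` F \<subseteq> row_space.span B" using B(3) F by blast
  then have "card (?R ` F) \<le> card B"
    using row_space.independent_span_bound[OF finB ind] by blast
  finally show ?thesis unfolding rigidity_rank_def rigidity_rows_eq[OF E] B(4) .
qed

lemma exists_solvable_of_card_rank:
  fixes p :: "'a \<Rightarrow> real^2"
  assumes S: "finite S" and E: "edges H \<subseteq> pairs S"
  obtains F where "F \<subseteq> edges H" "solvable q p (edge_indicator F)" "card F = rigidity_rank q H p"
proof -
  let ?R = "\<lambda>e. edge_row q p e 0"
  obtain B where B: "B \<subseteq> ?R ` edges H" "row_space.independent B"
      "card B = row_space.dim (?R ` edges H)"
    using row_space.basis_exists[of "?R ` edges H"] by metis
  then obtain F where F: "F \<subseteq> edges H" "inj_on ?R F" "B = ?R ` F"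
    using subset_image_inj[of B ?R "edges H"] by blast
  have "F \<subseteq> pairs S" using F(1) E by blast
  then have "solvable q p (edge_indicator F)"
    using solvable_edge_indicator_iff[OF S] F(2,3) B(2) by blast
  moreover have "card F = rigidity_rank q H p"
    unfolding rigidity_rank_def rigidity_rows_eq[OF E] using B(3) F(2,3) by (simp add: card_image)
  ultimately show thesis using that F(1) by blast
qed

text \<open>A row basis at another placement \<open>x\<close> is sparse by the dimension count,
  hence independent at \<open>p\<close>, so the rank at \<open>x\<close> is no larger.\<close>

lemma regular_if_sparse_solvable:
  fixes p :: "'a \<Rightarrow> real^2"
  assumes S: "finite S" and E: "edges H \<subseteq> pairs S" and p: "p \<in> placements H"
    and sol: "\<And>F. F \<subseteq> edges H \<Longrightarrow> sparse_edges q F \<Longrightarrow> solvable q p (edge_indicator F)"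
  shows "regular q H p"
  unfolding regular_def
proof (intro conjI ballI p)
  fix x :: "'a \<Rightarrow> real^2" assume x: "x \<in> placements H"
  obtain F where F: "F \<subseteq> edges H" "solvable q x (edge_indicator F)" "card F = rigidity_rank q H x"
    using exists_solvable_of_card_rank[OF S E] by metis
  have "sparse_edges q F"
    by (rule solvable_imp_msparse[OF S _ _ F(2)]) (use F(1) E x in \<open>auto simp: placements_def\<close>)
  from solvable_imp_card_le_rank[OF S E F(1) sol[OF F(1) this]]
  show "rigidity_rank q H x \<le> rigidity_rank q H p" using F(3) by simp
qed

text \<open>Regularity compares \<open>p\<close> with one auxiliary placement where all rows are
  independent; this carries independence over to every generic placement. The ball of radius 1
  around 0 is an arbitrary choice.\<close>

lemma regular_sparse_imp_solvable:
  fixes p :: "'a \<Rightarrow> real^2"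
  assumes q: "q > 1" and S: "finite S" and E: "edges H \<subseteq> pairs S"
    and reg: "regular q H p" and sp: "sparse_edges q (edges H)"
  shows "solvable q p (edge_indicator (edges H))"
proof -
  have "\<exists>x. (\<forall>v. dist (x v) (0 :: real^2) < 1) \<and> solvable q x (edge_indicator (edges H)) \<and>
    (general_on S x)"
    using exists_solvable_near[OF q _ _ S supported_edge_indicator[OF E] sp, of 1 "\<lambda>_. 0"]
    by (simp add: tight_const_def)
  then obtain x :: "'a \<Rightarrow> real^2" where x: "solvable q x (edge_indicator (edges H))"
    "\<And>v w. v \<in> S \<Longrightarrow> w \<in> S \<Longrightarrow> v \<noteq> w \<Longrightarrow> coords_differ (x v) (x w)" by blast
  have "x v \<noteq> x w" if "{v, w} \<in> edges H" for v w
    using subsetD[OF E that] x(2)[of v w] by (auto simp: coords_differ_def)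
  then have "x \<in> placements H" by (simp add: placements_def)
  then have "rigidity_rank q H x \<le> rigidity_rank q H p" using reg by (auto simp: regular_def)
  then have le: "card (edges H) \<le> rigidity_rank q H p"
    using solvable_imp_card_le_rank[OF S E order_refl x(1)] by simp
  obtain F where F: "F \<subseteq> edges H" "solvable q p (edge_indicator F)" "card F = rigidity_rank q H p"
    using exists_solvable_of_card_rank[OF S E] by metis
  have "finite (edges H)" using finite_subset[OF E finite_pairs[OF S]] .
  then have "F = edges H" using F(1,3) le by (intro card_seteq) auto
  with F(2) show ?thesis by simp
qed

lemma ampleD:
  assumes "ample q V p" "finite F" "F \<subseteq> pairs V" "sparse_edges q F"
  shows "solvable q p (edge_indicator F)"
proof -
  have "(\<lambda>e. edge_indicator F e + edge_indicator {} e) = edge_indicator F"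
    by (simp add: edge_indicator_def)
  then show ?thesis
    using assms(1)[unfolded ample_def, rule_format, of F "{}"] assms(2-4) by simp
qed

lemma msparse_few_edges:
  assumes "\<And>S. finite S \<Longrightarrow> 2 \<le> card S \<Longrightarrow> card (F \<inter> pairs S) + l \<le> 2 * card S"
  shows "msparse l (edge_indicator F)"
  unfolding msparse_def using assms by (auto simp: edge_count_edge_indicator)

lemma ample_inj_on:
  assumes am: "ample q V p"
  shows "inj_on p V"
proof (rule inj_onI, rule ccontr)
  fix v w assume vw: "v \<in> V" "w \<in> V" "p v = p w" "v \<noteq> w"
  have "msparse (tight_const q) (edge_indicator {{v, w}})"
  proof (rule msparse_few_edges)
    fix S :: "'a set" assume "finite S" "2 \<le> card S"
    moreover have "card ({{v, w}} \<inter> pairs S) \<le> card {{v, w}}" by (intro card_mono) auto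
    ultimately show "card ({{v, w}} \<inter> pairs S) + tight_const q \<le> 2 * card S"
      by (simp add: tight_const_def)
  qed
  then have "solvable q p (edge_indicator {{v, w}})"
    using vw by (intro ampleD[OF am]) auto
  from this[unfolded solvable_def, rule_format, of "\<lambda>_ _. 1"] vw
  have "edge_dir q 0 (p v - p w) \<noteq> 0"
    by (metis edge_indicator_def inner_zero_left insertI1 of_bool_eq(2) zero_less_one zero_neq_one)
  moreover have "edge_dir q 0 0 = 0" by (simp add: edge_dir_def vec_eq_2_iff)
  ultimately show False using vw(3) by simp
qed

lemma finite_genericI:
  fixes p :: "'a \<Rightarrow> real^2"
  assumes q: "q > 1" and am: "ample q V p" and S: "finite (verts H)" "verts H \<subseteq> V"
  shows "finite_generic q H p"
  unfolding finite_generic_def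
proof (intro conjI allI impI)
  have inj: "inj_on p (verts H)"
    using ample_inj_on[OF am] S(2) by (rule inj_on_subset)
  have ne: "p v \<noteq> p w" if "{v, w} \<in> pairs (verts H)" for v w
    using that inj by (auto dest: inj_onD)
  have cE: "edges (complete_graph (verts H)) = pairs (verts H)" "verts (complete_graph (verts H)) = verts H"
    by (simp_all add: complete_graph_def pairs_def)
  show "p \<in> placements (complete_graph (verts H))"
    using ne by (simp add: placements_def cE)
  fix K assume K: "subgraph K (complete_graph (verts H))"
  then have EK: "edges K \<subseteq> pairs (verts H)" by (simp add: subgraph_def cE)
  show "regular q K p"
  proof (rule regular_if_sparse_solvable[OF S(1) EK])
    show "p \<in> placements K" using ne EK by (auto simp: placements_def)
    fix F assume F: "F \<subseteq> edges K" "sparse_edges q F"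
    have "F \<subseteq> pairs (verts H)" using F(1) EK by blast
    then show "solvable q p (edge_indicator F)"
      using F(2) S pairs_mono[OF S(2)] finite_subset[OF _ finite_pairs[OF S(1)]]
      by (intro ampleD[OF am]) auto
  qed
qed

lemma ample_imp_generic:
  fixes p :: "'a \<Rightarrow> real^2"
  assumes q: "q > 1" and am: "ample q (verts G) p" and G: "simple_graph G"
  shows "generic q G p"
  unfolding generic_def
proof (intro conjI allI impI)
  have "p v \<noteq> p w" if "{v, w} \<in> edges G" for v w
  proof -
    have "{v, w} \<in> pairs (verts G)" using subsetD[OF G[unfolded simple_graph_iff] that] .
    then show ?thesis using ample_inj_on[OF am] by (auto dest: inj_onD)
  qed
  then show "p \<in> placements G" by (simp add: placements_def)
  show "finite_generic q H p" if "finite_subgraph H G" for H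
    using that by (intro finite_genericI[OF q am]) (auto simp: finite_subgraph_def subgraph_def)
qed

lemma generic_tight_imp_rigid:
  fixes p :: "'a \<Rightarrow> real^2"
  assumes q: "q > 1" and gen: "generic q G p" and H: "finite_subgraph H G" and t: "tight 2 (tight_const q) H"
    and fl: "flex_on q p (edges H) u"
  shows "trivial_on q p (verts H) u" "inj_on p (verts H)"
proof -
  have S: "finite (verts H)" and E: "edges H \<subseteq> pairs (verts H)" and sH: "simple_graph H"
    using H by (auto simp: finite_subgraph_def subgraph_def simple_graph_iff)
  have fg: "finite_generic q H p" using gen H unfolding generic_def by blast
  have c: "{v, w} \<in> edges (complete_graph (verts H))" if "v \<in> verts H" "w \<in> verts H" "v \<noteq> w" for v w
    using that by (auto simp: complete_graph_def)
  show inj: "inj_on p (verts H)"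
    using fg c by (auto simp: finite_generic_def placements_def inj_on_def)
  have "subgraph H (complete_graph (verts H))"
    using sH by (auto simp: subgraph_def complete_graph_def simple_graph_def)
  then have reg: "regular q H p" using fg unfolding finite_generic_def by blast
  have "sparse_edges q (edges H)"
    using t sparse_iff_msparse[OF sH tight_const_le_4] by (simp add: tight_def)
  from regular_sparse_imp_solvable[OF q S E reg this]
  have sol: "solvable q p (edge_indicator (edges H))" .
  have "card (edges H) + tight_const q = 2 * card (verts H)"
    using t by (simp add: tight_def)
  from tight_imp_rigid[OF S inj E sol this fl] show "trivial_on q p (verts H) u" .
qed

section \<open>Flexes and rigid motions\<close>

lemma has_real_derivative_abs_powr:
  assumes q: "q > 1"
  shows "((\<lambda>x. \<bar>x\<bar> powr q) has_real_derivative q * spow (q - 1) x) (at x)"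
proof (cases "x = 0")
  case False
  have eq: "spow (q - 1) x = spow q x * sgn x / x"
    using False by (cases "x > 0") (auto simp: spow_def powr_diff)
  have "((\<lambda>y. spow q y * sgn x) has_real_derivative q * spow q x / x * sgn x) (at x)"
    by (rule DERIV_cmult_right[OF has_real_derivative_spow[OF False]])
  then have "((\<lambda>x. \<bar>x\<bar> powr q) has_real_derivative q * spow q x / x * sgn x) (at x)"
    by (rule has_field_derivative_transform_within_open[where S = "{y. sgn x * y > 0}"])
       (use False in \<open>auto simp: spow_def sgn_if zero_less_mult_iff split: if_splits
         intro!: open_Collect_less continuous_intros\<close>)
  then show ?thesis by (simp add: eq mult.assoc)
next
  case True
  have "continuous_on UNIV (\<lambda>h. spow (q - 1) h)"
    using q by (intro continuous_on_spow continuous_on_id) simp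
  then have "isCont (\<lambda>h. spow (q - 1) h) 0"
    using continuous_on_eq_continuous_at[OF open_UNIV] by blast
  from isContD[OF this] have "((\<lambda>h. spow (q - 1) h) \<longlongrightarrow> 0) (at 0)" by simp
  moreover have "(\<bar>0 + h\<bar> powr q - \<bar>0\<bar> powr q) / h = spow (q - 1) h" for h :: real
    using q by (cases h "0 :: real" rule: linorder_cases) (auto simp: spow_def powr_diff)
  ultimately show ?thesis unfolding True DERIV_def by simp
qed

text \<open>The gradient of the norm is a positive multiple of the signed power; the factor stays
  existential since only the vanishing of the derivative is of interest.\<close>

lemma has_real_derivative_lq_norm:
  fixes z :: "real \<Rightarrow> real^2"
  assumes q: "q > 1" and z: "(z has_vector_derivative z') (at t)" and nz: "z t \<noteq> 0"
  shows "\<exists>c>0. ((\<lambda>t. lq_norm q (z t)) has_real_derivative c * (signed_power (q - 1) (z t) \<bullet> z')) (at t)"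
proof -
  define S where "S t = (\<Sum>i\<in>UNIV. \<bar>z t $ i\<bar> powr q)" for t
  have zi: "((\<lambda>t. z t $ i) has_real_derivative z' $ i) (at t)" for i
    using bounded_linear.has_vector_derivative[OF bounded_linear_vec_nth z, of i]
    by (simp add: has_real_derivative_iff_has_vector_derivative)
  have "((\<lambda>t. \<bar>z t $ i\<bar> powr q) has_real_derivative q * spow (q - 1) (z t $ i) * z' $ i) (at t)" for i
    by (rule DERIV_chain2[OF has_real_derivative_abs_powr[OF q] zi])
  then have "(S has_real_derivative (\<Sum>i\<in>UNIV. q * spow (q - 1) (z t $ i) * z' $ i)) (at t)"
    unfolding S_def by (intro DERIV_sum)
  then have dS: "(S has_real_derivative q * (signed_power (q - 1) (z t) \<bullet> z')) (at t)"
    by (simp add: inner_2 sum_2 algebra_simps)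
  obtain i where "z t $ i \<noteq> 0" using nz by (auto simp: vec_eq_iff)
  then have "0 < \<bar>z t $ i\<bar> powr q" by simp
  also have "\<dots> \<le> S t" unfolding S_def by (rule member_le_sum) auto
  finally have Spos: "S t > 0" .
  have "((\<lambda>t. S t powr (1 / q)) has_real_derivative
      (1 / q) * S t powr (1 / q - of_nat 1) * (q * (signed_power (q - 1) (z t) \<bullet> z'))) (at t)"
    by (rule DERIV_fun_powr[OF dS Spos])
  moreover have "(\<lambda>t. lq_norm q (z t)) = (\<lambda>t. S t powr (1 / q))"
    by (simp add: lq_norm_def S_def)
  ultimately show ?thesis
    using q Spos by (intro exI[of _ "S t powr (1 / q - 1)"]) (simp add: field_simps)
qed

lemma infinitesimal_flex_iff:
  fixes p u :: "'a \<Rightarrow> real^2"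
  assumes q: "q > 1" and p: "p \<in> placements G"
  shows "infinitesimal_flex q G p u \<longleftrightarrow> flex_on q p (edges G) u"
proof -
  have "((\<lambda>t. lq_norm q ((p v + t *\<^sub>R u v) - (p w + t *\<^sub>R u w)) - lq_norm q (p v - p w)) \<in> o[at 0](\<lambda>t. t))
     \<longleftrightarrow> signed_power (q - 1) (p v - p w) \<bullet> (u v - u w) = 0" if e: "{v, w} \<in> edges G" for v w
  proof -
    define z where "z t = (p v + t *\<^sub>R u v) - (p w + t *\<^sub>R u w)" for t
    have z0: "z 0 = p v - p w" by (simp add: z_def)
    have "z 0 \<noteq> 0" using p e by (auto simp: placements_def z0)
    moreover have "(z has_vector_derivative (u v - u w)) (at 0)"
      unfolding z_def by (auto intro!: derivative_eq_intros)
    ultimately obtain c where c: "c > 0"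
      "((\<lambda>t. lq_norm q (z t)) has_real_derivative c * (signed_power (q - 1) (z 0) \<bullet> (u v - u w))) (at 0)"
      using has_real_derivative_lq_norm[OF q] by blast
    then have lim: "(\<lambda>t. (lq_norm q (z t) - lq_norm q (z 0)) / t) \<midarrow>0\<rightarrow> c * (signed_power (q - 1) (z 0) \<bullet> (u v - u w))"
      by (simp add: DERIV_def)
    have "(\<lambda>t. lq_norm q (z t) - lq_norm q (z 0)) \<in> o[at 0](\<lambda>t. t) \<longleftrightarrow>
      (\<lambda>t. (lq_norm q (z t) - lq_norm q (z 0)) / t) \<midarrow>0\<rightarrow> 0"
      by (auto dest: smalloD_tendsto intro!: smalloI_tendsto simp: eventually_at_filter)
    also have "\<dots> \<longleftrightarrow> c * (signed_power (q - 1) (z 0) \<bullet> (u v - u w)) = 0"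
      using lim LIM_unique by force
    finally show ?thesis using c(1) by (simp add: z0 flip: z_def)
  qed
  then show ?thesis by (simp add: infinitesimal_flex_def flex_on_def)
qed

lemma norm_rotation:
  fixes x :: "real^2"
  shows "norm (cos \<theta> *\<^sub>R x + sin \<theta> *\<^sub>R perp x) = norm x"
proof -
  have "(cos \<theta> * x1 - sin \<theta> * x2)\<^sup>2 + (cos \<theta> * x2 + sin \<theta> * x1)\<^sup>2 = x1\<^sup>2 + x2\<^sup>2" for x1 x2 :: real
    using sin_cos_squared_add[of \<theta>] by algebra
  then show ?thesis
    by (simp add: norm_eq_sqrt_inner inner_2 power2_eq_square[symmetric])
qed

lemma trivial_on_imp_trivial_flex:
  fixes p u :: "'a \<Rightarrow> real^2"
  assumes tr: "trivial_on q p (verts G) u"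
  shows "trivial_flex q G p u"
proof -
  from tr obtain a b where ab: "q \<noteq> 2 \<Longrightarrow> a = 0" "\<forall>v\<in>verts G. u v = a *\<^sub>R perp (p v) + b"
    unfolding trivial_on_def by blast
  \<comment> \<open>Rotation by the angle \<open>a * t\<close> followed by a translation; for
    \<open>q \<noteq> 2\<close> the angle is zero and a pure translation remains.\<close>
  define \<Gamma> where "\<Gamma> x t = cos (a * t) *\<^sub>R x + sin (a * t) *\<^sub>R perp x + t *\<^sub>R b" for x t
  have "lq_norm q (\<Gamma> x t - \<Gamma> y t) = lq_norm q (x - y)" for x y t
  proof (cases "q = 2")
    case True
    have "\<Gamma> x t - \<Gamma> y t = cos (a * t) *\<^sub>R (x - y) + sin (a * t) *\<^sub>R perp (x - y)"
      by (simp add: \<Gamma>_def perp_diff algebra_simps)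
    then show ?thesis using True by (simp add: lq_norm_2 norm_rotation)
  next
    case False
    then show ?thesis by (simp add: \<Gamma>_def ab(1))
  qed
  moreover have "continuous_on {-1..1} (\<Gamma> x)" for x
    unfolding \<Gamma>_def by (intro continuous_intros)
  moreover have "(\<Gamma> x has_vector_derivative a *\<^sub>R perp x + b) (at 0)" for x
    unfolding \<Gamma>_def by (auto intro!: derivative_eq_intros)
  ultimately have "infinitesimal_rigid_motion q (\<lambda>x. a *\<^sub>R perp x + b)"
    unfolding infinitesimal_rigid_motion_def continuous_rigid_motion_def
    by (intro exI[of _ \<Gamma>]) (auto simp: \<Gamma>_def)
  then show ?thesis
    unfolding trivial_flex_def using ab(2) by blast
qed

lemma infinitesimal_rigid_motion_orthogonal:
  fixes \<gamma> :: "real^2 \<Rightarrow> real^2"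
  assumes q: "q > 1" and \<gamma>: "infinitesimal_rigid_motion q \<gamma>"
  shows "signed_power (q - 1) (x - y) \<bullet> (\<gamma> x - \<gamma> y) = 0"
proof (cases "x = y")
  case True
  then show ?thesis by simp
next
  case False
  obtain \<Gamma> where \<Gamma>: "continuous_rigid_motion q \<Gamma>" "\<And>x. (\<Gamma> x has_vector_derivative \<gamma> x) (at 0)"
    using \<gamma> unfolding infinitesimal_rigid_motion_def by blast
  have \<Gamma>0: "\<Gamma> x 0 = x" for x using \<Gamma>(1) by (simp add: continuous_rigid_motion_def)
  have "((\<lambda>t. \<Gamma> x t - \<Gamma> y t) has_vector_derivative (\<gamma> x - \<gamma> y)) (at 0)"
    by (intro has_vector_derivative_diff \<Gamma>)
  then obtain c where c: "c > 0"
    "((\<lambda>t. lq_norm q (\<Gamma> x t - \<Gamma> y t)) has_real_derivative c * (signed_power (q - 1) (x - y) \<bullet> (\<gamma> x - \<gamma> y))) (at 0)"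
    using has_real_derivative_lq_norm[OF q, of "\<lambda>t. \<Gamma> x t - \<Gamma> y t" "\<gamma> x - \<gamma> y" 0] False by (auto simp: \<Gamma>0)
  have "((\<lambda>t. lq_norm q (x - y)) has_real_derivative c * (signed_power (q - 1) (x - y) \<bullet> (\<gamma> x - \<gamma> y))) (at 0)"
    by (rule has_field_derivative_transform_within_open[OF c(2), where S = "{-1<..<1}"])
       (use \<Gamma>(1) in \<open>auto simp: continuous_rigid_motion_def\<close>)
  from DERIV_unique[OF this DERIV_const] c(1) show ?thesis by simp
qed

text \<open>Horizontal and vertical pairs of points show that \<open>\<gamma> (x\<^sub>1, x\<^sub>2) = (f x\<^sub>2, g x\<^sub>1)\<close>; the remaining
  pairs give \<open>f (x + h) - f x = c * spow (q - 1) h\<close>, which is additive in \<open>h\<close> only if \<open>c = 0\<close>.\<close>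

lemma infinitesimal_rigid_motion_constant:
  fixes \<gamma> :: "real^2 \<Rightarrow> real^2"
  assumes q: "q > 1" "q \<noteq> 2" and \<gamma>: "infinitesimal_rigid_motion q \<gamma>"
  shows "\<gamma> x = \<gamma> y"
proof -
  define s where "s = q - 1"
  define V where "V x1 x2 = (vector [x1, x2] :: real^2)" for x1 x2
  have V: "V x1 x2 $ 1 = x1" "V x1 x2 $ 2 = x2" "V (x $ 1) (x $ 2) = x" for x1 x2 x
    by (simp_all add: V_def vec_eq_2_iff)
  have orth: "spow s (x1 - y1) * (\<gamma> (V x1 x2) $ 1 - \<gamma> (V y1 y2) $ 1)
      + spow s (x2 - y2) * (\<gamma> (V x1 x2) $ 2 - \<gamma> (V y1 y2) $ 2) = 0" for x1 x2 y1 y2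
    using infinitesimal_rigid_motion_orthogonal[OF q(1) \<gamma>, of "V x1 x2" "V y1 y2"]
    by (simp add: inner_2 V s_def)
  define f where "f x2 = \<gamma> (V 0 x2) $ 1" for x2
  define g where "g x1 = \<gamma> (V x1 0) $ 2" for x1
  have f: "\<gamma> (V x1 x2) $ 1 = f x2" for x1 x2
    using orth[of x1 0 x2 x2] by (cases "x1 = 0") (auto simp: f_def)
  have g: "\<gamma> (V x1 x2) $ 2 = g x1" for x1 x2
    using orth[of x1 x1 x2 0] by (cases "x2 = 0") (auto simp: g_def)
  have fg: "spow s a * (f (x2 + b) - f x2) + spow s b * (g (x1 + a) - g x1) = 0" for a b x1 x2
    using orth[of "x1 + a" x1 "x2 + b" x2] by (simp add: f g)
  define c where "c = - (g 1 - g 0)"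
  have fc: "f (x + b) - f x = c * spow s b" for x b
    using fg[of 1 x b 0] by (simp add: c_def algebra_simps)
  have "c * spow s 2 = f 2 - f 0" using fc[of 0 2] by simp
  also have "\<dots> = c * 2" using fc[of 0 1] fc[of 1 1] by simp
  finally have "c * spow s 2 = c * 2" .
  moreover have "spow s 2 \<noteq> 2"
  proof
    assume "spow s 2 = 2"
    then have "2 powr s = 2 powr (1 :: real)" by (simp add: spow_def)
    then have "s = 1" using powr_inj[of 2 s 1] by (simp del: powr_one)
    then show False using q(2) by (simp add: s_def)
  qed
  ultimately have c0: "c = 0" by simp
  have fconst: "f x = f 0" for x using fc[of 0 x] c0 by simp
  have "g (x1 + a) = g x1" for x1 a
    using fg[of a 0 1 x1] fconst[of 1] by simp
  from this[of 0] have gconst: "g x = g 0" for x by simp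
  have "\<gamma> (V x1 x2) = \<gamma> (V y1 y2)" for x1 x2 y1 y2
    by (simp add: vec_eq_2_iff f g fconst[of x2] fconst[of y2] gconst[of x1] gconst[of y1])
  from this[of "x $ 1" "x $ 2" "y $ 1" "y $ 2"] show ?thesis by (simp only: V)
qed

section \<open>Tight towers\<close>

lemma finite_subgraphD:
  assumes "finite_subgraph H G"
  shows "finite (verts H)" "edges H \<subseteq> pairs (verts H)" "verts H \<subseteq> verts G" "edges H \<subseteq> edges G" "simple_graph H"
  using assms by (auto simp: finite_subgraph_def subgraph_def simple_graph_iff)

lemma finite_subgraphI:
  "finite S \<Longrightarrow> S \<subseteq> verts G \<Longrightarrow> E \<subseteq> edges G \<Longrightarrow> E \<subseteq> pairs S \<Longrightarrow> finite_subgraph (S, E) G"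
  by (simp add: finite_subgraph_def subgraph_def simple_graph_iff)

lemma flex_on_subset: "flex_on q p F u \<Longrightarrow> E \<subseteq> F \<Longrightarrow> flex_on q p E u"
  by (auto simp: flex_on_def)

lemma affine_coeffs_unique:
  assumes "a *\<^sub>R perp x + b = a' *\<^sub>R perp x + b'" "a *\<^sub>R perp y + b = a' *\<^sub>R perp y + b'" "x \<noteq> y"
  shows "a = a' \<and> b = b'"
proof -
  have "(a - a') *\<^sub>R perp (x - y) = (a *\<^sub>R perp x + b) - (a' *\<^sub>R perp x + b')
      - ((a *\<^sub>R perp y + b) - (a' *\<^sub>R perp y + b'))"
    by (simp add: perp_diff algebra_simps)
  also have "\<dots> = 0" using assms(1,2) by simp
  finally have "a = a'" using assms(3) by simp
  with assms(1) show ?thesis by simp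
qed

text \<open>A flex is trivial on each level. Two vertices fixed in advance lie in all later levels
  at distinct positions, so the coefficients of the motion cannot change from level to level, and
  one motion serves the whole graph.\<close>

lemma tight_tower_imp_rigid:
  fixes G :: "'a graph"
  assumes q: "q > 1" and G: "simple_graph G" and inf: "infinite (verts G)"
    and T: "tight_tower 2 (tight_const q) G T" and vc: "vertex_complete G T"
  shows "rigid TYPE(2) q G"
  unfolding rigid_def infinitesimally_rigid_def
proof (intro allI impI)
  fix p u :: "'a \<Rightarrow> real^2"
  assume gen: "generic q G p" and fl: "infinitesimal_flex q G p u"
  have fin: "finite_subgraph (T k) G" and tk: "tight 2 (tight_const q) (T k)" for k
    using T by (auto simp: tight_tower_def tower_def)
  have mono: "verts (T i) \<subseteq> verts (T k)" if "i \<le> k" for i k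
    using T lift_Suc_mono_le[of "\<lambda>k. verts (T k)", OF _ that]
    by (auto simp: tight_tower_def tower_def subgraph_def)
  have V: "verts G = (\<Union>k. verts (T k))" using vc by (simp add: vertex_complete_def)
  have flG: "flex_on q p (edges G) u"
    using fl gen infinitesimal_flex_iff[OF q] unfolding generic_def by blast
  have tr: "trivial_on q p (verts (T k)) u" and inj: "inj_on p (verts (T k))" for k
    using generic_tight_imp_rigid[OF q gen fin tk flex_on_subset[OF flG finite_subgraphD(4)[OF fin]]] by auto
  obtain x where x: "x \<in> verts G" using inf by (metis finite.emptyI ex_in_conv)
  have "infinite (verts G - {x})" using inf by simp
  then obtain y where y: "y \<in> verts G" "y \<noteq> x" by (metis DiffD1 DiffD2 finite.emptyI ex_in_conv singletonI)
  from x y(1) obtain i j where ij: "x \<in> verts (T i)" "y \<in> verts (T j)" unfolding V by blast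
  define k where "k = max i j"
  have xy: "x \<in> verts (T n)" "y \<in> verts (T n)" if "k \<le> n" for n
    using ij mono[of i n] mono[of j n] that by (auto simp: k_def)
  obtain a b where ab: "q \<noteq> 2 \<longrightarrow> a = 0" "\<forall>v\<in>verts (T k). u v = a *\<^sub>R perp (p v) + b"
    using tr[of k] unfolding trivial_on_def by blast
  have "u v = a *\<^sub>R perp (p v) + b" if v: "v \<in> verts G" for v
  proof -
    from v obtain j where j: "v \<in> verts (T j)" unfolding V by blast
    define n where "n = max j k"
    have vn: "v \<in> verts (T n)" and kn: "k \<le> n" using j mono[of j n] by (auto simp: n_def)
    obtain a' b' where ab': "\<forall>v\<in>verts (T n). u v = a' *\<^sub>R perp (p v) + b'"
      using tr[of n] unfolding trivial_on_def by blast
    have "p x \<noteq> p y" using inj[of k] xy[OF order_refl] y(2) by (auto dest: inj_onD)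
    moreover have "a *\<^sub>R perp (p x) + b = a' *\<^sub>R perp (p x) + b'"
      using bspec[OF ab(2) xy(1)[OF order_refl]] bspec[OF ab' xy(1)[OF kn]] by simp
    moreover have "a *\<^sub>R perp (p y) + b = a' *\<^sub>R perp (p y) + b'"
      using bspec[OF ab(2) xy(2)[OF order_refl]] bspec[OF ab' xy(2)[OF kn]] by simp
    ultimately have "a = a' \<and> b = b'" by (intro affine_coeffs_unique)
    then show ?thesis using ab' vn by simp
  qed
  then have "trivial_on q p (verts G) u" using ab(1) unfolding trivial_on_def by blast
  then show "trivial_flex q G p u" by (rule trivial_on_imp_trivial_flex)
qed

section \<open>From rigidity to tight subgraphs and towers\<close>

lemma maximal_sparse_extension:
  assumes "finite E" "F0 \<subseteq> E" "msparse l (edge_indicator F0)"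
  obtains F where "F0 \<subseteq> F" "F \<subseteq> E" "msparse l (edge_indicator F)"
    "\<And>e. e \<in> E \<Longrightarrow> e \<notin> F \<Longrightarrow> \<not> msparse l (edge_indicator (insert e F))"
proof -
  define A where "A = {F \<in> Pow E. msparse l (edge_indicator F)}"
  have "finite A" "F0 \<in> A" using assms by (auto simp: A_def)
  from finite_has_maximal2[OF this] obtain F where F: "F \<in> A" "F0 \<subseteq> F" "\<forall>B\<in>A. F \<subseteq> B \<longrightarrow> F = B"
    by auto
  show thesis
  proof (rule that[OF F(2)])
    show "F \<subseteq> E" "msparse l (edge_indicator F)" using F(1) by (auto simp: A_def)
    fix e assume e: "e \<in> E" "e \<notin> F"
    then have "insert e F \<notin> A" using F(3) by blast
    then show "\<not> msparse l (edge_indicator (insert e F))" using F(1) e(1) by (auto simp: A_def)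
  qed
qed

lemma ample_maximal_span:
  fixes p :: "'a \<Rightarrow> real^2"
  assumes q: "q > 1" and am: "ample q V p" and S: "finite S" "S \<subseteq> V" and E: "E \<subseteq> pairs S" and F: "F \<subseteq> E"
    and sp: "sparse_edges q F"
    and max: "\<And>e. e \<in> E \<Longrightarrow> e \<notin> F \<Longrightarrow> \<not> sparse_edges q (insert e F)"
    and e: "e \<in> E"
  shows "edge_row q p e 0 \<in> row_space.span (edge_rows q p F)"
proof (rule edge_row_in_span_of_maximal[OF S(1) E F _ _ e])
  have FV: "F \<subseteq> pairs V" using F E pairs_mono[OF S(2)] by blast
  have "finite F" using F E S(1) by (meson finite_pairs finite_subset)
  then show "solvable q p (edge_indicator F)" by (rule ampleD[OF am _ FV sp])
  fix f assume f: "f \<in> E" "f \<notin> F"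
  have sub: "insert f F \<subseteq> pairs S" using f F E by blast
  show "\<not> solvable q p (edge_indicator (insert f F))"
  proof
    assume sol: "solvable q p (edge_indicator (insert f F))"
    have "p v \<noteq> p w" if "{v, w} \<in> insert f F" for v w
      using subsetD[OF sub that] S(2) ample_inj_on[OF am] by (auto dest: inj_onD)
    from solvable_imp_msparse[OF S(1) sub this sol] max[OF f] show False by blast
  qed
qed

context
  fixes G :: "'a graph" and q :: real and p :: "'a \<Rightarrow> real^2"
  assumes q: "q > 1" and G: "simple_graph G" and am: "ample q (verts G) p"
    and rig: "infinitesimally_rigid q G p"
begin

lemma ample_generic: "generic q G p"
  by (rule ample_imp_generic[OF q am G])

text \<open>The condition \<open>k + tight_const q < 4\<close> allows the copies that an edge may
  have: \<open>k = 0\<close> for \<open>q = 2\<close>, and \<open>k \<le> 1\<close> otherwise. In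
  the second case infinitesimal rigid motions are constant, so the rate vanishes in both
  directions.\<close>

lemma flex_fixes_pair:
  assumes fl: "flex_on q p (edges G) u" and vw: "v \<in> verts G" "w \<in> verts G" and k: "k + tight_const q < 4"
  shows "edge_rate q k p u v w = 0"
proof -
  have "p \<in> placements G" using ample_generic by (simp add: generic_def)
  then have "infinitesimal_flex q G p u" using infinitesimal_flex_iff[OF q] fl by blast
  then obtain \<gamma> where \<gamma>: "infinitesimal_rigid_motion q \<gamma>" "\<forall>v\<in>verts G. u v = \<gamma> (p v)"
    using rig unfolding infinitesimally_rigid_def trivial_flex_def by blast
  show ?thesis
  proof (cases "q = 2")
    case True
    then have "k = 0" using k by (simp add: tight_const_def)
    then show ?thesis
      using infinitesimal_rigid_motion_orthogonal[OF q \<gamma>(1)] \<gamma>(2) vw by (simp add: edge_dir_def)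
  next
    case False
    have "u v = u w"
      using infinitesimal_rigid_motion_constant[OF q False \<gamma>(1), of "p v" "p w"] \<gamma>(2) vw by simp
    then show ?thesis by simp
  qed
qed

lemma edge_row_in_span:
  assumes vw: "v \<in> verts G" "w \<in> verts G" "v \<noteq> w" and k: "k + tight_const q < 4"
  shows "edge_row q p {v, w} k \<in> row_space.span (edge_rows q p (edges G))"
proof (rule ccontr)
  assume "\<not> ?thesis"
  then obtain h where h: "functional h" "h (edge_row q p {v, w} k) = 1"
    "\<forall>r\<in>edge_rows q p (edges G). h r = 0"
    using functional_separation by blast
  have val: "h (edge_row q p {x, y} j) = edge_dir q j (p x - p y) \<bullet> (functional_flex h x - functional_flex h y)"
    if "x \<noteq> y" for x y j
  proof -
    have "h (edge_row q p {x, y} j) = pairing {x, y} (edge_row q p {x, y} j) (functional_flex h)"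
      by (rule functional_eq_pairing[OF h(1)]) (use that in \<open>auto intro!: row_on_edge_row\<close>)
    then show ?thesis using pairing_edge_row[of "{x, y}" x y] that by simp
  qed
  have "flex_on q p (edges G) (functional_flex h)"
    unfolding flex_on_def
  proof (intro allI impI)
    fix x y assume e: "{x, y} \<in> edges G"
    then have "x \<noteq> y" using subsetD[OF G[unfolded simple_graph_iff] e] by simp
    moreover have "h (edge_row q p {x, y} 0) = 0" using h(3) e by blast
    ultimately show "signed_power (q - 1) (p x - p y) \<bullet> (functional_flex h x - functional_flex h y) = 0"
      using val[of x y 0] by (simp add: edge_dir_def)
  qed
  from flex_fixes_pair[OF this vw(1,2) k] val[OF vw(3), of k] h(2) show False by simp
qed

text \<open>Without such a subgraph no sparse edge set blocks the pair, so ampleness provides a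
  motion that is annihilated by a row basis \<open>F\<close> and moves the pair at rate one. But
  rigidity puts the row of the pair into the span of finitely many rows.\<close>

lemma exists_tight_subgraph_of_pair:
  assumes vw: "v \<in> verts G" "w \<in> verts G" "v \<noteq> w"
  shows "\<exists>H. finite_subgraph H G \<and> tight 2 (tight_const q) H \<and> v \<in> verts H \<and> w \<in> verts H"
proof (rule ccontr)
  assume no: "\<not> ?thesis"
  let ?R = "\<lambda>e. edge_row q p e 0" and ?l = "tight_const q"
  have EV: "edges G \<subseteq> pairs (verts G)" using G by (simp add: simple_graph_iff)
  have add: "msparse ?l (add_edge {v, w} (edge_indicator F))"
    if F: "F \<subseteq> edges G" and sp: "msparse ?l (edge_indicator F)" for F
  proof (rule ccontr)
    assume "\<not> ?thesis"
    then obtain S where S: "finite S" "2 \<le> card S" "{v, w} \<in> pairs S"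
      "edge_count (edge_indicator F) S + ?l = 2 * card S"
      using not_msparse_add_edgeE[OF sp] by metis
    \<comment> \<open>A tight set cannot have vertices outside \<open>G\<close>: dropping them would
      keep the edges and lower the bound.\<close>
    define S' where "S' = S \<inter> verts G"
    have S': "finite S'" "S' \<subseteq> S" "v \<in> S'" "w \<in> S'" using S(1,3) vw by (auto simp: S'_def)
    have Feq: "F \<inter> pairs S = F \<inter> pairs S'" using F EV unfolding S'_def pairs_Int by blast
    have "card {v, w} \<le> card S'" using S' by (intro card_mono) auto
    then have "card (F \<inter> pairs S') + ?l \<le> 2 * card S'"
      using msparseD[OF sp S'(1)] vw(3) S'(1) by (simp add: edge_count_edge_indicator)
    moreover have t: "card (F \<inter> pairs S') + ?l = 2 * card S"
      using S(1,4) Feq by (simp add: edge_count_edge_indicator)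
    ultimately have "S' = S" using card_seteq[OF S(1) S'(2)] by simp
    have H: "finite_subgraph (S', F \<inter> pairs S') G"
      using S'(1) F by (intro finite_subgraphI) (auto simp: S'_def)
    have "msparse ?l (edge_indicator (F \<inter> pairs S'))"
      by (rule msparse_mono[OF sp]) (simp add: edge_indicator_def)
    then have "sparse 2 ?l (S', F \<inter> pairs S')"
      using sparse_iff_msparse[OF finite_subgraphD(5)[OF H] tight_const_le_4] by simp
    then have "tight 2 ?l (S', F \<inter> pairs S')"
      using S'(1) t \<open>S' = S\<close> by (simp add: tight_def)
    then show False using no H S' by auto
  qed
  have "\<exists>E. finite E \<and> E \<subseteq> edges G \<and> edge_row q p {v, w} k \<in> row_space.span (?R ` E)"
    if k: "k + ?l < 4" for k
  proof -
    from edge_row_in_span[OF vw k] obtain t r where t: "finite t" "t \<subseteq> ?R ` edges G"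
      "edge_row q p {v, w} k = (\<Sum>a\<in>t. (\<lambda>x. r a * a x))"
      unfolding row_space.span_explicit by blast
    then obtain E where E: "E \<subseteq> edges G" "finite E" "t = ?R ` E"
      using finite_subset_image[OF t(1,2)] by blast
    have "edge_row q p {v, w} k \<in> row_space.span (?R ` E)"
      unfolding t(3) E(3) by (intro row_space.span_sum row_space.span_scale row_space.span_base)
    with E show ?thesis by blast
  qed
  then obtain Ek where Ek: "\<And>k. k + ?l < 4 \<Longrightarrow> finite (Ek k) \<and> Ek k \<subseteq> edges G \<and>
      edge_row q p {v, w} k \<in> row_space.span (?R ` Ek k)" by metis
  \<comment> \<open>Finitely many edges whose rows span the row of every admissible copy of the
    pair; which copy is relevant is known only after \<open>F\<close> has been chosen.\<close>
  define E where "E = (\<Union>k\<in>{k. k + ?l < 4}. Ek k)"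
  have "finite {k. k + ?l < 4}" by (rule finite_subset[of _ "{..<4}"]) auto
  then have E: "finite E" "E \<subseteq> edges G"
    unfolding E_def using Ek by (blast, blast)
  have rowE: "edge_row q p {v, w} k \<in> row_space.span (?R ` E)" if k: "k + ?l < 4" for k
  proof -
    have "?R ` Ek k \<subseteq> ?R ` E" using k by (intro image_mono) (auto simp: E_def)
    then show ?thesis using Ek[OF k] row_space.span_mono by blast
  qed
  have "msparse ?l (edge_indicator {})"
    by (rule msparse_few_edges) (simp add: tight_const_def)
  then obtain F where F: "F \<subseteq> E" "msparse ?l (edge_indicator F)"
    "\<And>e. e \<in> E \<Longrightarrow> e \<notin> F \<Longrightarrow> \<not> msparse ?l (edge_indicator (insert e F))"
    using maximal_sparse_extension[OF E(1), of "{}" ?l] by auto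
  define S where "S = insert v (insert w (\<Union>E))"
  have S: "finite S" "S \<subseteq> verts G"
  proof -
    have "E \<subseteq> pairs (verts G)" using E(2) EV by (rule order.trans)
    then have "\<And>e. e \<in> E \<Longrightarrow> finite e \<and> e \<subseteq> verts G"
      using finite_pairs_element by (auto simp: pairs_def)
    then show "finite S" "S \<subseteq> verts G" using E(1) vw unfolding S_def by auto
  qed
  have ES: "E \<subseteq> pairs S" using E(2) EV unfolding S_def pairs_def by blast
  have "?R ` E \<subseteq> row_space.span (?R ` F)"
    using ample_maximal_span[OF q am S ES F] by blast
  then have "row_space.span (?R ` E) \<subseteq> row_space.span (?R ` F)"
    using row_space.span_minimal[OF _ row_space.subspace_span] by blast
  then have rowF: "edge_row q p {v, w} k \<in> row_space.span (?R ` F)" if "k + ?l < 4" for k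
    using rowE[OF that] by blast
  have eq: "add_edge {v, w} (edge_indicator F) = (\<lambda>e. edge_indicator F e + edge_indicator {{v, w}} e)"
    by (auto simp: add_edge_def edge_indicator_def fun_eq_iff)
  have FG: "F \<subseteq> edges G" using F(1) E(2) by blast
  have finF: "finite F" using F(1) E(1) finite_subset by blast
  \<comment> \<open>The new edge becomes copy number \<open>k\<close>, the second one if
    \<open>F\<close> already joins the pair.\<close>
  define k where "k = edge_indicator F {v, w}"
  have sp: "msparse ?l (add_edge {v, w} (edge_indicator F))" by (rule add[OF FG F(2)])
  have k4: "k + ?l < 4"
    using msparse_multiplicity[OF sp vw(3)] by (simp add: k_def add_edge_def)
  have "solvable q p (add_edge {v, w} (edge_indicator F))"
    using am[unfolded ample_def, rule_format, of F "{{v, w}}"] finF FG EV vw sp unfolding eq by auto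
  then obtain f where f0: "\<And>x y k. x \<noteq> y \<Longrightarrow> k < edge_indicator F {x, y} \<Longrightarrow>
      edge_rate q k p f x y = 0"
    "edge_dir q (edge_indicator F {v, w}) (p v - p w) \<bullet> (f v - f w) = 1"
    using solvable_add_edge_flex[OF _ vw(3)] by metis
  note f = f0(1) f0(2)[folded k_def]
  have "pairing S r f = 0" if r: "r \<in> ?R ` F" for r
  proof -
    from r obtain e where e: "e \<in> F" "r = ?R e" by blast
    then have "e \<in> pairs S" using F(1) ES by blast
    then obtain x y where xy: "e = {x, y}" "x \<noteq> y" "x \<in> S" "y \<in> S" by (rule pairsE)
    have "0 < edge_indicator F {x, y}" using e(1) xy(1) by (simp add: edge_indicator_def)
    from f(1)[OF xy(2) this] show ?thesis
      by (simp add: e(2) xy(1) pairing_edge_row[OF S(1) xy(3,4,2)])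
  qed
  then have "pairing S (edge_row q p {v, w} k) f = 0"
    using functional_vanishes_on_span[OF functional_pairing _ rowF[OF k4]] by blast
  then show False
    using f(2) pairing_edge_row[OF S(1) _ _ vw(3), of q p k f] by (simp add: S_def)
qed

lemma tight_subgraph_rigid:
  assumes "finite_subgraph H G" "tight 2 (tight_const q) H" "flex_on q p (edges H) u"
  shows "trivial_on q p (verts H) u"
  by (rule generic_tight_imp_rigid(1)[OF q ample_generic assms])

text \<open>A triangle is sparse for \<open>q = 2\<close>, so some motion changes only the side
  \<open>{x, y}\<close> to first order; for collinear points the three sides are not
  independent.\<close>

lemma triangle_noncollinear:
  assumes xyw: "x \<in> verts G" "y \<in> verts G" "w \<in> verts G" "x \<noteq> y" "y \<noteq> w" "x \<noteq> w"
    and q2: "q = 2" and eq: "\<alpha> *\<^sub>R (p y - p x) = \<beta> *\<^sub>R (p w - p x)"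
  shows "\<alpha> = 0 \<and> \<beta> = 0"
proof -
  define F where "F = {{x, y}, {x, w}, {y, w}}"
  have "sparse_edges q F"
  proof (rule msparse_few_edges)
    fix S :: "'a set" assume S: "finite S" "2 \<le> card S"
    have "card F \<le> 3" unfolding F_def by (intro card_insert_le_m1) auto
    moreover have "card (F \<inter> pairs S) \<le> card F" by (intro card_mono) (auto simp: F_def)
    moreover have "card (F \<inter> pairs S) \<le> 1" if "card S = 2"
    proof -
      have "F \<inter> pairs S \<subseteq> {S}"
        using that S(1) card_subset_eq[OF S(1)] by (auto simp: pairs_def)
      then show ?thesis using card_mono[of "{S}" "F \<inter> pairs S"] by simp
    qed
    ultimately show "card (F \<inter> pairs S) + tight_const q \<le> 2 * card S"
      using S(2) q2 by (cases "card S = 2") (auto simp: tight_const_def)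
  qed
  then have "solvable q p (edge_indicator F)"
    using xyw by (intro ampleD[OF am]) (auto simp: F_def)
  from this[unfolded solvable_def, rule_format, of "\<lambda>e k. of_bool (e = {x, y})"]
  obtain u where u: "\<And>v v' k. v \<noteq> v' \<Longrightarrow> k < edge_indicator F {v, v'} \<Longrightarrow>
      edge_rate q k p u v v' = of_bool ({v, v'} = {x, y})" by blast
  define A B Y W where "A = p y - p x" and "B = p w - p x" and "Y = u y - u x" and "W = u w - u x"
  have inF: "0 < edge_indicator F {y, x}" "0 < edge_indicator F {w, x}" "0 < edge_indicator F {y, w}"
    by (auto simp: edge_indicator_def F_def insert_commute)
  have "{w, x} \<noteq> {x, y}" "{y, w} \<noteq> {x, y}" using xyw by (auto simp: doubleton_eq_iff)
  then have e: "A \<bullet> Y = 1" "B \<bullet> W = 0" "(A - B) \<bullet> (Y - W) = 0"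
    using u[OF _ inF(1)] u[OF _ inF(2)] u[OF _ inF(3)] xyw q2
    by (simp_all add: edge_dir_def A_def B_def Y_def W_def insert_commute)
  have ne: "A \<noteq> B" "B \<noteq> 0" using xyw ample_inj_on[OF am] by (auto simp: A_def B_def dest: inj_onD)
  have AB: "\<alpha> *\<^sub>R A = \<beta> *\<^sub>R B" using eq by (simp add: A_def B_def)
  have "\<alpha> * (A \<bullet> Y) = \<beta> * (B \<bullet> Y)" "\<alpha> * (A \<bullet> W) = \<beta> * (B \<bullet> W)"
    using arg_cong[OF AB, of "\<lambda>z. z \<bullet> Y"] arg_cong[OF AB, of "\<lambda>z. z \<bullet> W"] by simp_all
  then have *: "\<alpha> = \<beta> * (B \<bullet> Y)" "\<alpha> * (A \<bullet> W) = 0" using e by simp_all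
  have "A \<bullet> W + B \<bullet> Y = 1" using e by (simp add: inner_diff_left inner_diff_right)
  with * have "\<alpha> = 0 \<or> \<alpha> = \<beta>" by auto
  then show ?thesis using AB ne by auto
qed

text \<open>For \<open>q = 2\<close> three rigid pieces meet pairwise at \<open>x\<close>,
  \<open>y\<close>, \<open>w\<close>, which are not collinear, so their angular velocities agree.
  Otherwise rigid pieces only translate, and one common vertex forces equal translations.\<close>

lemma union_with_tight_rigid:
  assumes H: "finite_subgraph H G" and rH: "\<And>u. flex_on q p (edges H) u \<Longrightarrow> trivial_on q p (verts H) u"
    and x: "x \<in> verts G" "x \<notin> verts H" and y: "y \<in> verts H"
    and two: "q = 2 \<Longrightarrow> w \<in> verts H \<and> w \<noteq> y"
  shows "\<exists>K. finite_subgraph K G \<and> insert x (verts H) \<subseteq> verts K \<and>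
    (\<forall>u. flex_on q p (edges K) u \<longrightarrow> trivial_on q p (verts K) u)"
proof -
  \<comment> \<open>For \<open>q \<noteq> 2\<close> both auxiliary subgraphs are attached at
    \<open>y\<close>.\<close>
  define w' where "w' = (if q = 2 then w else y)"
  have w': "w' \<in> verts H" using two y by (simp add: w'_def)
  have HV: "verts H \<subseteq> verts G" using finite_subgraphD[OF H] by simp
  have xy: "x \<noteq> y" "x \<noteq> w'" using x y w' by auto
  obtain T where T: "finite_subgraph T G" "tight 2 (tight_const q) T" "x \<in> verts T" "y \<in> verts T"
    using exists_tight_subgraph_of_pair[of x y] x y HV xy by blast
  obtain T' where T': "finite_subgraph T' G" "tight 2 (tight_const q) T'" "x \<in> verts T'" "w' \<in> verts T'"
    using exists_tight_subgraph_of_pair[of x w'] x w' HV xy by blast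
  define K where "K = (verts H \<union> verts T \<union> verts T', edges H \<union> edges T \<union> edges T')"
  have "finite_subgraph K G"
    unfolding K_def
  proof (rule finite_subgraphI)
    let ?S = "verts H \<union> verts T \<union> verts T'"
    show "finite ?S"
      using finite_subgraphD(1)[OF H] finite_subgraphD(1)[OF T(1)] finite_subgraphD(1)[OF T'(1)] by simp
    show "?S \<subseteq> verts G"
      using finite_subgraphD(3)[OF H] finite_subgraphD(3)[OF T(1)] finite_subgraphD(3)[OF T'(1)] by simp
    show "edges H \<union> edges T \<union> edges T' \<subseteq> edges G"
      using finite_subgraphD(4)[OF H] finite_subgraphD(4)[OF T(1)] finite_subgraphD(4)[OF T'(1)] by simp
    have "edges X \<subseteq> pairs ?S" if "finite_subgraph X G" "verts X \<subseteq> ?S" for X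
      using finite_subgraphD(2)[OF that(1)] pairs_mono[OF that(2)] by (rule order.trans)
    then show "edges H \<union> edges T \<union> edges T' \<subseteq> pairs ?S"
      using H T(1) T'(1) by (intro Un_least) (simp_all add: le_supI1 le_supI2)
  qed
  moreover have "insert x (verts H) \<subseteq> verts K" using T(3) by (auto simp: K_def)
  moreover have "trivial_on q p (verts K) u" if fl: "flex_on q p (edges K) u" for u
  proof -
    have "trivial_on q p (verts H) u"
      by (rule rH[OF flex_on_subset[OF fl]]) (auto simp: K_def)
    then obtain a1 b1 where 1: "q \<noteq> 2 \<longrightarrow> a1 = 0" "\<And>v. v \<in> verts H \<Longrightarrow> u v = a1 *\<^sub>R perp (p v) + b1"
      unfolding trivial_on_def by blast
    have "trivial_on q p (verts T) u"
      by (rule tight_subgraph_rigid[OF T(1,2) flex_on_subset[OF fl]]) (auto simp: K_def)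
    then obtain a2 b2 where 2: "q \<noteq> 2 \<longrightarrow> a2 = 0" "\<And>v. v \<in> verts T \<Longrightarrow> u v = a2 *\<^sub>R perp (p v) + b2"
      unfolding trivial_on_def by blast
    have "trivial_on q p (verts T') u"
      by (rule tight_subgraph_rigid[OF T'(1,2) flex_on_subset[OF fl]]) (auto simp: K_def)
    then obtain a3 b3 where 3: "q \<noteq> 2 \<longrightarrow> a3 = 0" "\<And>v. v \<in> verts T' \<Longrightarrow> u v = a3 *\<^sub>R perp (p v) + b3"
      unfolding trivial_on_def by blast
    have a: "a1 = a2 \<and> a1 = a3"
    proof (cases "q = 2")
      case True
      have w: "w' \<noteq> y" using two[OF True] True by (simp add: w'_def)
      have "u y - u w' = a1 *\<^sub>R perp (p y - p w')"
        unfolding 1(2)[OF y] 1(2)[OF w'] by (simp add: perp_diff algebra_simps)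
      moreover have "u y - u x = a2 *\<^sub>R perp (p y - p x)"
        unfolding 2(2)[OF T(3)] 2(2)[OF T(4)] by (simp add: perp_diff algebra_simps)
      moreover have "u w' - u x = a3 *\<^sub>R perp (p w' - p x)"
        unfolding 3(2)[OF T'(3)] 3(2)[OF T'(4)] by (simp add: perp_diff algebra_simps)
      moreover have "u y - u w' = (u y - u x) - (u w' - u x)" by simp
      ultimately have "a1 *\<^sub>R perp (p y - p w') = a2 *\<^sub>R perp (p y - p x) - a3 *\<^sub>R perp (p w' - p x)"
        by simp
      then have "perp ((a1 - a2) *\<^sub>R (p y - p x)) = perp ((a1 - a3) *\<^sub>R (p w' - p x))"
        by (simp add: vec_eq_2_iff algebra_simps)
      then have "(a1 - a2) *\<^sub>R (p y - p x) = (a1 - a3) *\<^sub>R (p w' - p x)"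
        by (simp add: vec_eq_2_iff)
      from triangle_noncollinear[OF x(1) _ _ xy(1) _ xy(2) True this] y w' HV w show ?thesis by auto
    next
      case False
      then show ?thesis using 1 2 3 by simp
    qed
    then have a23: "a2 = a1" "a3 = a1" by auto
    have "b2 = b1" using 1(2)[OF y] 2(2)[OF T(4)] unfolding a23 by simp
    moreover have "b3 = b1" using 1(2)[OF w'] 3(2)[OF T'(4)] unfolding a23 by simp
    ultimately have "u v = a1 *\<^sub>R perp (p v) + b1" if "v \<in> verts K" for v
      using that 1(2)[of v] 2(2)[of v] 3(2)[of v] a23 by (auto simp: K_def)
    then show ?thesis
      unfolding trivial_on_def using 1(1) by blast
  qed
  ultimately show ?thesis by blast
qed

lemma exists_rigid_container:
  assumes "finite S" "S \<subseteq> verts G"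
  shows "\<exists>H. finite_subgraph H G \<and> S \<subseteq> verts H \<and>
    (\<forall>u. flex_on q p (edges H) u \<longrightarrow> trivial_on q p (verts H) u)"
  using assms
proof (induction S rule: finite_induct)
  case empty
  have "finite_subgraph ({}, {}) G" by (intro finite_subgraphI) auto
  then show ?case by (intro exI[of _ "({}, {})"]) (auto simp: trivial_on_def)
next
  case (insert x S)
  then obtain H where H: "finite_subgraph H G" "S \<subseteq> verts H"
    "\<And>u. flex_on q p (edges H) u \<Longrightarrow> trivial_on q p (verts H) u" by auto
  have x: "x \<in> verts G" using insert by simp
  have HV: "verts H \<subseteq> verts G" using finite_subgraphD[OF H(1)] by simp
  consider "x \<in> verts H" | "verts H = {}" | y where "x \<notin> verts H" "y \<in> verts H" by blast
  then show ?case
  proof cases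
    case 1
    then show ?thesis using H by (intro exI[of _ H] conjI) auto
  next
    case 2
    have "finite_subgraph ({x}, {}) G" using x by (intro finite_subgraphI) auto
    moreover have "trivial_on q p {x} u" for u
      unfolding trivial_on_def by (intro exI[of _ 0] exI[of _ "u x"]) simp
    moreover have "S = {}" using 2 H(2) by simp
    ultimately show ?thesis by (intro exI[of _ "({x}, {})"]) simp
  next
    case 3
    show ?thesis
    proof (cases "q = 2 \<and> verts H = {y}")
      \<comment> \<open>A single vertex leaves no second point of attachment in the Euclidean case;
        a tight subgraph through \<open>x\<close> and \<open>y\<close> takes the place of
        \<open>H\<close>.\<close>
      case True
      have "y \<in> verts G" "x \<noteq> y" using 3 HV by auto
      then obtain T where T: "finite_subgraph T G" "tight 2 (tight_const q) T" "x \<in> verts T" "y \<in> verts T"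
        using exists_tight_subgraph_of_pair[OF x] by blast
      then show ?thesis
        using True H(2) tight_subgraph_rigid[OF T(1,2)] by (intro exI[of _ T]) auto
    next
      case False
      then have "\<exists>w. q = 2 \<longrightarrow> w \<in> verts H \<and> w \<noteq> y" using 3(2) by blast
      then obtain w where w: "q = 2 \<longrightarrow> w \<in> verts H \<and> w \<noteq> y" by (elim exE)
      obtain K where K: "finite_subgraph K G" "insert x (verts H) \<subseteq> verts K"
        "\<forall>u. flex_on q p (edges K) u \<longrightarrow> trivial_on q p (verts K) u"
        using union_with_tight_rigid[OF H(1,3) x 3 w[THEN mp]] by blast
      then show ?thesis using H(2) by (intro exI[of _ K] conjI) auto
    qed
  qed
qed

text \<open>A maximal sparse edge set above that of \<open>T\<close> inherits rigidity from the
  container, and rigidity forces the tight count. \<open>T\<close> is assumed to be sparse only, so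
  the construction can start from the empty graph, which is not tight.\<close>

lemma tight_extension:
  assumes T: "finite_subgraph T G" and sp: "sparse_edges q (edges T)"
    and x: "x \<in> verts G" and inf: "infinite (verts G)"
  shows "\<exists>T'. finite_subgraph T' G \<and> subgraph T T' \<and> tight 2 (tight_const q) T' \<and> x \<in> verts T'"
proof -
  let ?l = "tight_const q"
  note TD = finite_subgraphD[OF T]
  have "infinite (verts G - {x})" using inf by simp
  then obtain y where y: "y \<in> verts G" "y \<noteq> x" by (metis DiffD1 DiffD2 finite.emptyI ex_in_conv singletonI)
  obtain H where H: "finite_subgraph H G" "insert x (insert y (verts T)) \<subseteq> verts H"
    "\<And>u. flex_on q p (edges H) u \<Longrightarrow> trivial_on q p (verts H) u"
    using exists_rigid_container[of "insert x (insert y (verts T))"] TD x y by auto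
  note HD = finite_subgraphD[OF H(1)]
  have c2: "2 \<le> card (verts H)"
    using card_mono[OF HD(1), of "{x, y}"] H(2) y(2) by auto
  define E where "E = edges H \<union> edges T"
  have E: "E \<subseteq> pairs (verts H)" "E \<subseteq> edges G"
    using HD TD pairs_mono[of "verts T" "verts H"] H(2) by (auto simp: E_def)
  have finE: "finite E" using finite_subset[OF E(1) finite_pairs[OF HD(1)]] .
  obtain F where F: "edges T \<subseteq> F" "F \<subseteq> E" "msparse ?l (edge_indicator F)"
    "\<And>e. e \<in> E \<Longrightarrow> e \<notin> F \<Longrightarrow> \<not> msparse ?l (edge_indicator (insert e F))"
    using maximal_sparse_extension[OF finE _ sp] by (metis E_def Un_upper2)
  have FH: "F \<subseteq> pairs (verts H)" using F(2) E(1) by blast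
  have rigF: "trivial_on q p (verts H) u" if fl: "flex_on q p F u" for u
  proof (rule H(3))
    have "pairing (verts H) r u = 0" if "r \<in> edge_rows q p F" for r
      using fl that flex_on_iff_pairing[OF HD(1) FH] by blast
    then have "pairing (verts H) (edge_row q p e 0) u = 0" if "e \<in> E" for e
      using functional_vanishes_on_span[OF functional_pairing _ ample_maximal_span[OF q am HD(1,3) E(1) F(2,3,4) that]]
      by blast
    then have "flex_on q p E u" using flex_on_iff_pairing[OF HD(1) E(1)] by blast
    then show "flex_on q p (edges H) u" by (rule flex_on_subset) (simp add: E_def)
  qed
  have "inj_on p (verts H)" using ample_inj_on[OF am] HD(3) by (rule inj_on_subset)
  from rigid_imp_card_ge[OF HD(1) c2 this FH rigF]
  have ge: "2 * card (verts H) \<le> card F + ?l" .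
  have "F \<inter> pairs (verts H) = F" using FH by blast
  then have "card F + ?l \<le> 2 * card (verts H)"
    using msparseD[OF F(3) HD(1) c2] HD(1) by (simp add: edge_count_edge_indicator)
  with ge have cF: "card F + ?l = 2 * card (verts H)" by simp
  have T': "finite_subgraph (verts H, F) G"
    using HD(1,3) F(2) E(2) FH by (intro finite_subgraphI) auto
  have "tight 2 ?l (verts H, F)"
    using HD(1) cF F(3) sparse_iff_msparse[OF finite_subgraphD(5)[OF T'] tight_const_le_4]
    by (simp add: tight_def)
  moreover have "subgraph T (verts H, F)"
    using TD(5) H(2) F(1) by (simp add: subgraph_def)
  ultimately show ?thesis using T' H(2) by (intro exI[of _ "(verts H, F)"]) auto
qed

lemma exists_tight_tower:
  assumes count: "countable (verts G)" and inf: "infinite (verts G)"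
  shows "\<exists>T. tight_tower 2 (tight_const q) G T \<and> vertex_complete G T"
proof -
  let ?l = "tight_const q" and ?x = "from_nat_into (verts G)"
  have ne: "verts G \<noteq> {}" using inf by auto
  have x: "?x n \<in> verts G" for n by (rule from_nat_into[OF ne])
  have "\<exists>T. \<forall>n. (finite_subgraph (T n) G \<and> tight 2 ?l (T n) \<and> ?x n \<in> verts (T n)) \<and> subgraph (T n) (T (Suc n))"
  proof (rule dependent_nat_choice)
    have "finite_subgraph ({}, {}) G" by (intro finite_subgraphI) auto
    moreover have "msparse ?l (edge_indicator {})"
      by (rule msparse_few_edges) (simp add: tight_const_def)
    ultimately show "\<exists>T. finite_subgraph T G \<and> tight 2 ?l T \<and> ?x 0 \<in> verts T"
      using tight_extension[OF _ _ x inf, of "({}, {})" 0] unfolding snd_conv by blast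
  next
    fix T n assume T: "finite_subgraph T G \<and> tight 2 ?l T \<and> ?x n \<in> verts T"
    then have "msparse ?l (edge_indicator (edges T))"
      using sparse_iff_msparse[OF finite_subgraphD(5)[OF conjunct1[OF T]] tight_const_le_4]
      unfolding tight_def by blast
    then show "\<exists>T'. (finite_subgraph T' G \<and> tight 2 ?l T' \<and> ?x (Suc n) \<in> verts T') \<and> subgraph T T'"
      using tight_extension[OF _ _ x inf, of T "Suc n"] T by blast
  qed
  then obtain T where T: "\<And>n. finite_subgraph (T n) G" "\<And>n. tight 2 ?l (T n)" "\<And>n. ?x n \<in> verts (T n)"
    "\<And>n. subgraph (T n) (T (Suc n))" by blast
  have "tight_tower 2 ?l G T" using T(1,2,4) by (simp add: tight_tower_def tower_def)
  moreover have "verts G \<subseteq> (\<Union>k. verts (T k))"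
  proof
    fix v assume "v \<in> verts G"
    then obtain n where "v = ?x n" using subset_range_from_nat_into[OF count] by blast
    then show "v \<in> (\<Union>k. verts (T k))" using T(3) by blast
  qed
  then have "vertex_complete G T"
    using finite_subgraphD(3)[OF T(1)] by (auto simp: vertex_complete_def)
  ultimately show ?thesis by blast
qed

end

text \<open>\<open>rigid\<close> quantifies over all generic placements. Forwards it is applied to
  one ample placement, whose existence rules out vacuity; backwards every generic placement is
  treated.\<close>

lemma rigid_iff_tight_tower:
  fixes G :: "'a graph"
  assumes q: "q > 1" and G: "simple_graph G" and V: "countable (verts G)" "infinite (verts G)"
  shows "rigid TYPE(2) q G \<longleftrightarrow> (\<exists>T. tight_tower 2 (tight_const q) G T \<and> vertex_complete G T)"
proof
  assume r: "rigid TYPE(2) q G"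
  obtain p :: "'a \<Rightarrow> real^2" where am: "ample q (verts G) p" using exists_ample[OF q V] by blast
  have "infinitesimally_rigid q G p"
    using r ample_imp_generic[OF q am G] unfolding rigid_def by blast
  from exists_tight_tower[OF q G am this V] show "\<exists>T. tight_tower 2 (tight_const q) G T \<and> vertex_complete G T" .
next
  assume "\<exists>T. tight_tower 2 (tight_const q) G T \<and> vertex_complete G T"
  then show "rigid TYPE(2) q G" using tight_tower_imp_rigid[OF q G V(2)] by blast
qed

theorem theorem3p19:
  fixes G :: "'a graph"
  assumes "simple_graph G" and "countable (verts G)" and "infinite (verts G)"
  shows "(rigid TYPE(2) 2 G \<longleftrightarrow> (\<exists>T. tight_tower 2 3 G T \<and> vertex_complete G T)) \<and>
         (\<forall>q \<in> {1<..<2} \<union> {2<..}.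
            rigid TYPE(2) q G \<longleftrightarrow> (\<exists>T. tight_tower 2 2 G T \<and> vertex_complete G T))"
proof (intro conjI ballI)
  show "rigid TYPE(2) 2 G \<longleftrightarrow> (\<exists>T. tight_tower 2 3 G T \<and> vertex_complete G T)"
    using rigid_iff_tight_tower[OF _ assms, of 2] by (simp add: tight_const_def)
  fix q :: real assume "q \<in> {1<..<2} \<union> {2<..}"
  then have "q > 1" "tight_const q = 2" by (auto simp: tight_const_def)
  then show "rigid TYPE(2) q G \<longleftrightarrow> (\<exists>T. tight_tower 2 2 G T \<and> vertex_complete G T)"
    using rigid_iff_tight_tower[OF _ assms, of q] by simp
qed

end
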